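(* The scheme $\mathcal{B}_{nr}(F)$ of bases in $F$ of discriminant $nr$ is an affine complete intersection.
   Context: Let $p$ be a prime, $k$ the algebraic closure of $\mathbb{F}_p$, $\mathcal{O}=W(k)$, $n,r\ge 1$ integers, $F=\mathcal{O}^n$ with standard basis $e_1,\dots,e_n$. Let $\xi:k\to\mathcal{O}$ be the multiplicative (Teichmüller) representative map with $\xi(0)=0$; the expression $\sum_i \xi(x_i)^{p^{-i}}p^i$ denotes the Witt vector with components $x_0,x_1,\dots$ (also for $x_i$ in any $k$-algebra). Let $S=\{x_{i,j,s}:1\le i,j\le n,\ 0\le s\le nr\}$ be indeterminates, so that $\operatorname{Spec} k[S]$ is affine $n^2(nr+1)$-space, viewed as the space of $n$-tuples $(\boldsymbol{u}_1,\dots,\boldsymbol{u}_n)$ of vectors in $F/p^{nr+1}F$, where $\boldsymbol{u}_i=(u_{i,1},\dots,u_{i,n})$ and $u_{i,j}=\sum_{s=0}^{nr}\xi(x_{i,j,s})^{p^{-s}}p^s\in \mathcal{O}/p^{nr+1}\mathcal{O}$. Write $\boldsymbol{u}_1\wedge\dots\wedge\boldsymbol{u}_n=\Delta\, e_1\wedge\dots\wedge e_n$ with $\Delta=\sum_{i=0}^{nr}\xi(\delta_i)^{p^{-i}}p^i$, $\delta_i\in k[S]$. Let $I=(\delta_0,\dots,\delta_{nr-1})$. The scheme of bases of discriminant $nr$ is $\mathcal{B}_{nr}(F)=\operatorname{Spec}(k[S]_{\delta_{nr}}/I)$. Here "affine complete intersection" means: as the closed subscheme of the principal open subset $\operatorname{Spec}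 k[S]_{\delta_{nr}}$ of affine $n^2(nr+1)$-space defined by the $nr$ equations $\delta_0=\dots=\delta_{nr-1}=0$, it has codimension $nr$ (dimension $n^2(nr+1)-nr$). *)

theory Defs
  imports
    "HOL-Library.Poly_Mapping"
    "HOL-Library.Extended_Nat"
    "HOL-Combinatorics.Permutations"
    "HOL-Algebra.QuotRing"
    "HOL-Algebra.Algebraic_Closure_Type"
begin

type_synonym ('v, 'a) mpoly = "('v \<Rightarrow>\<^sub>0 nat) \<Rightarrow>\<^sub>0 'a"

definition indet :: "'v \<Rightarrow> ('v, 'a::zero_neq_one) mpoly" where
  "indet v = Poly_Mapping.single (Poly_Mapping.single v 1) 1"

text \<open>The ring \<open>k[V]\<close>: the polynomials all of whose indeterminates lie in \<open>V\<close>.\<close>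

definition mpoly_ring :: "'v set \<Rightarrow> ('v, 'a::comm_ring_1) mpoly ring" where
  "mpoly_ring V = \<lparr>
     carrier = {P. \<forall>m \<in> Poly_Mapping.keys P. Poly_Mapping.keys m \<subseteq> V},
     monoid.mult = (\<lambda>P Q. P * Q),
     one = 1,
     ring.zero = 0,
     add = (\<lambda>P Q. P + Q) \<rparr>"

definition int_poly_eval :: "('b, 'm) ring_scheme \<Rightarrow> ('v \<Rightarrow> 'b) \<Rightarrow> ('v, int) mpoly \<Rightarrow> 'b" where
  "int_poly_eval R x P =
     (\<Oplus>\<^bsub>R\<^esub>m \<in> Poly_Mapping.keys P. [Poly_Mapping.lookup P m] \<cdot>\<^bsub>R\<^esub>
        (\<Otimes>\<^bsub>R\<^esub>v \<in> Poly_Mapping.keys m. x v [^]\<^bsub>R\<^esub> Poly_Mapping.lookup m v))"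

definition witt_poly :: "nat \<Rightarrow> nat \<Rightarrow> (nat \<Rightarrow> 'a::comm_semiring_1) \<Rightarrow> 'a" where
  "witt_poly p m x = (\<Sum>i\<le>m. of_nat (p ^ i) * x i ^ (p ^ (m - i)))"

text \<open>
  By Witt's theorem, for \<open>p\<close> prime and \<open>\<phi>\<close> addition or multiplication, there is exactly one
  sequence \<open>\<Phi>\<close> in \<open>\<int>[X\<^sub>0, X\<^sub>1, \<dots>, Y\<^sub>0, Y\<^sub>1, \<dots>]\<close> with
  \<open>w\<^sub>m(\<Phi>) = \<phi> (w\<^sub>m(X)) (w\<^sub>m(Y))\<close> for all \<open>m\<close>.
  The indeterminates \<open>X\<^sub>i\<close>, \<open>Y\<^sub>i\<close> are indexed by \<open>Inl i\<close>, \<open>Inr i\<close>.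
\<close>

definition witt_op_poly ::
  "nat \<Rightarrow> ((nat + nat, int) mpoly \<Rightarrow> (nat + nat, int) mpoly \<Rightarrow> (nat + nat, int) mpoly)
     \<Rightarrow> nat \<Rightarrow> (nat + nat, int) mpoly" where
  "witt_op_poly p \<phi> = (THE \<Phi>. \<forall>m. witt_poly p m \<Phi> =
     \<phi> (witt_poly p m (\<lambda>i. indet (Inl i))) (witt_poly p m (\<lambda>i. indet (Inr i))))"

definition witt_op ::
  "nat \<Rightarrow> nat \<Rightarrow> ('b, 'm) ring_scheme
     \<Rightarrow> ((nat + nat, int) mpoly \<Rightarrow> (nat + nat, int) mpoly \<Rightarrow> (nat + nat, int) mpoly)
     \<Rightarrow> (nat \<Rightarrow> 'b) \<Rightarrow> (nat \<Rightarrow> 'b) \<Rightarrow> nat \<Rightarrow> 'b" where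
  "witt_op p N R \<phi> x y =
     (\<lambda>i. if i < N then int_poly_eval R (case_sum x y) (witt_op_poly p \<phi> i) else \<zero>\<^bsub>R\<^esub>)"

text \<open>
  The ring \<open>W\<^sub>N(R)\<close> of \<open>p\<close>-typical Witt vectors of length \<open>N\<close>.  A Witt vector is the sequence
  of its components \<open>x\<^sub>0, \<dots>, x\<^bsub>N-1\<^esub>\<close>, padded with zeros; in the notation with the Teichmueller
  map \<open>\<xi>\<close> it is \<open>\<Sum>i<N. \<xi>(x\<^sub>i)^(p^-i) p^i\<close>.
\<close>

definition witt_ring :: "nat \<Rightarrow> nat \<Rightarrow> ('b, 'm) ring_scheme \<Rightarrow> (nat \<Rightarrow> 'b) ring" where
  "witt_ring p N R = \<lparr>
     carrier = {x. (\<forall>i<N. x i \<in> carrier R) \<and> (\<forall>i\<ge>N. x i = \<zero>\<^bsub>R\<^esub>)},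
     monoid.mult = witt_op p N R (\<lambda>P Q. P * Q),
     one = (\<lambda>i. if i = 0 \<and> i < N then \<one>\<^bsub>R\<^esub> else \<zero>\<^bsub>R\<^esub>),
     ring.zero = (\<lambda>i. \<zero>\<^bsub>R\<^esub>),
     add = witt_op p N R (\<lambda>P Q. P + Q) \<rparr>"

definition loc_rel :: "('b, 'm) ring_scheme \<Rightarrow> 'b \<Rightarrow> (('b \<times> nat) \<times> ('b \<times> nat)) set" where
  "loc_rel R f = {((a, m), (b, l)). a \<in> carrier R \<and> b \<in> carrier R \<and>
     (\<exists>t::nat. f [^]\<^bsub>R\<^esub> t \<otimes>\<^bsub>R\<^esub> (a \<otimes>\<^bsub>R\<^esub> f [^]\<^bsub>R\<^esub> l) = f [^]\<^bsub>R\<^esub> t \<otimes>\<^bsub>R\<^esub> (b \<otimes>\<^bsub>R\<^esub> f [^]\<^bsub>R\<^esub> m))}"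

text \<open>The fraction \<open>a / f^m\<close>.\<close>

definition loc_frac :: "('b, 'm) ring_scheme \<Rightarrow> 'b \<Rightarrow> 'b \<Rightarrow> nat \<Rightarrow> ('b \<times> nat) set" where
  "loc_frac R f a m = loc_rel R f `` {(a, m)}"

definition localization :: "('b, 'm) ring_scheme \<Rightarrow> 'b \<Rightarrow> ('b \<times> nat) set ring" where
  "localization R f = \<lparr>
     carrier = (carrier R \<times> UNIV) // loc_rel R f,
     monoid.mult = (\<lambda>A B. \<Union>(a, m) \<in> A. \<Union>(b, l) \<in> B. loc_frac R f (a \<otimes>\<^bsub>R\<^esub> b) (m + l)),
     one = loc_frac R f \<one>\<^bsub>R\<^esub> 0,
     ring.zero = loc_frac R f \<zero>\<^bsub>R\<^esub> 0,
     add = (\<lambda>A B. \<Union>(a, m) \<in> A. \<Union>(b, l) \<in> B.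
       loc_frac R f (a \<otimes>\<^bsub>R\<^esub> f [^]\<^bsub>R\<^esub> l \<oplus>\<^bsub>R\<^esub> b \<otimes>\<^bsub>R\<^esub> f [^]\<^bsub>R\<^esub> m) (m + l)) \<rparr>"

definition prime_chain :: "('b, 'm) ring_scheme \<Rightarrow> nat \<Rightarrow> (nat \<Rightarrow> 'b set) \<Rightarrow> bool" where
  "prime_chain R d C \<longleftrightarrow> (\<forall>i\<le>d. primeideal (C i) R) \<and> (\<forall>i<d. C i \<subset> C (Suc i))"

definition krull_dim :: "('b, 'm) ring_scheme \<Rightarrow> enat" where
  "krull_dim R = Sup {enat d | d. \<exists>C. prime_chain R d C}"

definition height :: "('b, 'm) ring_scheme \<Rightarrow> 'b set \<Rightarrow> enat" where
  "height R P = Sup {enat d | d. \<exists>C. prime_chain R d C \<and> C d = P}"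

text \<open>
  The codimension in \<open>Spec R\<close> of the closed subset defined by \<open>J\<close>: the infimum of the
  codimensions of its irreducible closed subsets (\<open>\<infinity>\<close> for the empty set).
\<close>

definition codim :: "('b, 'm) ring_scheme \<Rightarrow> 'b set \<Rightarrow> enat" where
  "codim R J = (INF P \<in> {P. primeideal P R \<and> J \<subseteq> P}. height R P)"

text \<open>The coefficient of \<open>u\<^sub>1 \<and> \<dots> \<and> u\<^sub>n\<close> at \<open>e\<^sub>1 \<and> \<dots> \<and> e\<^sub>n\<close>, where \<open>u\<^sub>i = (u i 1, \<dots>, u i n)\<close>.\<close>

definition ring_det :: "('b, 'm) ring_scheme \<Rightarrow> nat \<Rightarrow> (nat \<Rightarrow> nat \<Rightarrow> 'b) \<Rightarrow> 'b" where
  "ring_det R n u =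
     (\<Oplus>\<^bsub>R\<^esub>\<sigma> \<in> {\<sigma>. \<sigma> permutes {1..n}}.
        (let c = (\<Otimes>\<^bsub>R\<^esub>i \<in> {1..n}. u i (\<sigma> i)) in if evenperm \<sigma> then c else \<ominus>\<^bsub>R\<^esub> c))"

definition base_indets :: "nat \<Rightarrow> nat \<Rightarrow> (nat \<times> nat \<times> nat) set" where
  "base_indets n r = {1..n} \<times> {1..n} \<times> {0..n * r}"

definition generic_entry ::
  "nat \<Rightarrow> nat \<Rightarrow> nat \<Rightarrow> nat \<Rightarrow> nat \<Rightarrow> (nat \<times> nat \<times> nat, 'k::field) mpoly" where
  "generic_entry n r i j = (\<lambda>s. if s \<le> n * r then indet (i, j, s) else 0)"

text \<open>\<open>disc_coeff p n r i\<close> is \<open>\<delta>\<^sub>i\<close>.\<close>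

definition disc_coeff ::
  "nat \<Rightarrow> nat \<Rightarrow> nat \<Rightarrow> nat \<Rightarrow> (nat \<times> nat \<times> nat, 'k::field) mpoly" where
  "disc_coeff p n r =
     ring_det (witt_ring p (n * r + 1) (mpoly_ring (base_indets n r))) n (generic_entry n r)"

text \<open>
  \<open>bases_open\<close> is \<open>k[S]\<close> localized at \<open>\<delta>\<^bsub>nr\<^esub>\<close>, \<open>bases_ideal\<close> the ideal generated in it by the \<open>nr\<close>
  elements \<open>\<delta>\<^sub>0, \<dots>, \<delta>\<^bsub>nr-1\<^esub>\<close>, and \<open>bases_ring\<close> the coordinate ring of the scheme of bases.
\<close>

definition bases_open ::
  "'k::field itself \<Rightarrow> nat \<Rightarrow> nat \<Rightarrow> nat \<Rightarrow> ((nat \<times> nat \<times> nat, 'k) mpoly \<times> nat) set ring" where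
  "bases_open T p n r = localization (mpoly_ring (base_indets n r)) (disc_coeff p n r (n * r))"

definition bases_ideal ::
  "'k::field itself \<Rightarrow> nat \<Rightarrow> nat \<Rightarrow> nat \<Rightarrow> ((nat \<times> nat \<times> nat, 'k) mpoly \<times> nat) set set" where
  "bases_ideal T p n r = Idl\<^bsub>bases_open T p n r\<^esub>
     ((\<lambda>i. loc_frac (mpoly_ring (base_indets n r)) (disc_coeff p n r (n * r))
              (disc_coeff p n r i) 0) ` {..<n * r})"

definition bases_ring ::
  "'k::field itself \<Rightarrow> nat \<Rightarrow> nat \<Rightarrow> nat
     \<Rightarrow> ((nat \<times> nat \<times> nat, 'k) mpoly \<times> nat) set set ring" where
  "bases_ring T p n r = bases_open T p n r Quot bases_ideal T p n r"

end

theory Submission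
  imports Defs "HOL-Library.Product_Lexorder" "HOL-Computational_Algebra.Polynomial"
begin

text \<open>
  Let \<open>N = n\<^sup>2(nr+1)\<close> be the number of indeterminates and \<open>M = N - nr\<close>.  The theorem comes down to two
  statements about the polynomial ring \<open>k[S]\<close>: a prime ideal that contains
  \<open>\<delta>\<^sub>0, \<dots>, \<delta>\<^bsub>nr-1\<^esub>\<close> has height at least \<open>nr\<close> and is the bottom of chains of length at most \<open>M\<close>
  only; and there is a chain of primes of length \<open>M\<close> that contain these elements but not \<open>\<delta>\<^bsub>nr\<^esub>\<close>.
  Since chains in \<open>k[S]\<close> have length at most \<open>N\<close>, the bottom of that chain has height exactly \<open>nr\<close>.
  Chains of primes are moved between \<open>k[S]\<close>, its localization and the quotient by contraction
  and extension.

  Witt vectors enter only through ghost components.  A Witt vector over \<open>k[S]\<close> lifts to one over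
  \<open>\<int>[S]\<close>, where the ghost map is an injective ring homomorphism.  So \<open>\<delta>\<^sub>i\<close> is the reduction of an integer
  polynomial \<open>D\<^sub>i\<close>, and the ghost components of \<open>D\<close> are the determinants of the ghost components of
  the entries (\<open>disc_coeff_lift\<close>).  Everything below about \<open>\<delta>\<^sub>i\<close> is read off from this.

  For the first statement give \<open>x\<^bsub>i,j,s\<^esub>\<close> the weight \<open>p^s\<close>; then \<open>\<delta>\<^sub>i\<close> is homogeneous of weight \<open>n p^i\<close>.
  Restrict the determinant to the matrices of multiplication by \<open>\<Sum>\<^sub>j y\<^sub>j \<pi>^j\<close> on \<open>\<O>[\<pi>]/(\<pi>^n - p)\<close>,
  where each of \<open>y\<^sub>0, \<dots>, y\<^bsub>n-1\<^esub>\<close> has \<open>r\<close> free components.  It is the norm, whose valuation is the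
  least \<open>n v(y\<^sub>j) + j\<close>.  So on this \<open>nr\<close>-dimensional space the common zero of
  \<open>\<delta>\<^sub>0, \<dots>, \<delta>\<^bsub>nr-1\<^esub>\<close> is the origin alone: together with the \<open>M\<close> homogeneous equations of the space
  they cut out only the origin (\<open>disc_graded_system\<close>).  Hence modulo an ideal \<open>P\<close> that contains
  \<open>\<delta>\<^sub>0, \<dots>, \<delta>\<^bsub>nr-1\<^esub>\<close> the polynomials of weight at most \<open>w\<close> span a space whose dimension grows with \<open>w\<close> like
  \<open>w^M\<close> at most, and no more than \<open>M\<close> elements can be algebraically independent modulo \<open>P\<close>
  (\<open>rank_bound\<close>).  A chain of primes above \<open>P\<close> yields as many independent elements as it has steps
  (\<open>chain_witnesses_indep\<close>).  If \<open>P\<close> is prime, it has a maximal set of indeterminates that are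
  independent modulo \<open>P\<close>, and each of the others, at least \<open>nr\<close> many, yields a step of a
  chain below \<open>P\<close> (\<open>prime_chain_below\<close>).

  For the second statement take the generic matrix whose last row is a combination of the other
  rows plus a multiple of \<open>p^(nr) e\<^sub>n\<close>.  It has \<open>M\<close> free components, and specializing these one
  after another to the matrix \<open>diag(1, \<dots>, 1, p^(nr))\<close> gives a chain of kernels
  (\<open>prime_chain_of_bases\<close>).
\<close>

type_synonym coord = "nat \<times> nat \<times> nat"

abbreviation "keys \<equiv> Poly_Mapping.keys"
abbreviation "lookup \<equiv> Poly_Mapping.lookup"
abbreviation "single \<equiv> Poly_Mapping.single"

section \<open>Ring homomorphisms\<close>

locale rhom =
  fixes h :: "'a::comm_ring_1 \<Rightarrow> 'b::comm_ring_1"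
  assumes one: "h 1 = 1"
    and add: "h (a + b) = h a + h b"
    and mult: "h (a * b) = h a * h b"
begin

lemma zero: "h 0 = 0"
  using add[of 0 0] by simp

lemma uminus: "h (- a) = - h a"
  using minus_unique[of "h a" "h (- a)"] add[of a "- a"] zero by simp

lemma diff: "h (a - b) = h a - h b"
  using add[of a "- b"] uminus by simp

lemma sum: "h (sum f A) = (\<Sum>i\<in>A. h (f i))"
  by (induction A rule: infinite_finite_induct) (auto simp: zero add)

lemma prod: "h (prod f A) = (\<Prod>i\<in>A. h (f i))"
  by (induction A rule: infinite_finite_induct) (auto simp: one mult)

lemma power: "h (a ^ n) = h a ^ n"
  by (induction n) (auto simp: one mult)

lemma of_nat: "h (of_nat n) = of_nat n"
  by (induction n) (auto simp: zero one add)

lemma of_int: "h (of_int z) = of_int z"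
  by (cases z rule: int_diff_cases) (simp add: diff of_nat)

end

lemma rhom_compose: "rhom f \<Longrightarrow> rhom g \<Longrightarrow> rhom (\<lambda>x. g (f x))"
  by (simp add: rhom_def)

lemma rhom_of_int: "rhom (of_int :: int \<Rightarrow> 'a::comm_ring_1)"
  by unfold_locales auto

section \<open>Polynomial rings and substitution\<close>

definition const :: "'a::comm_ring_1 \<Rightarrow> ('v, 'a) mpoly" where
  "const c = single 0 c"

definition mon :: "('v \<Rightarrow> 'b::comm_ring_1) \<Rightarrow> ('v \<Rightarrow>\<^sub>0 nat) \<Rightarrow> 'b" where
  "mon x m = (\<Prod>v \<in> keys m. x v ^ lookup m v)"

definition psubst ::
  "('a::comm_ring_1 \<Rightarrow> 'b::comm_ring_1) \<Rightarrow> ('v \<Rightarrow> 'b) \<Rightarrow> ('v, 'a) mpoly \<Rightarrow> 'b" where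
  "psubst h x P = (\<Sum>m \<in> keys P. h (lookup P m) * mon x m)"

definition polys_in :: "'v set \<Rightarrow> ('v, 'a::comm_ring_1) mpoly set" where
  "polys_in V = {P. \<forall>m \<in> keys P. keys m \<subseteq> V}"

lemma rhom_const: "rhom const"
  by unfold_locales (auto simp: const_def single_add mult_single)

lemma mon_superset:
  assumes "finite A" "keys m \<subseteq> A"
  shows "mon x m = (\<Prod>v \<in> A. x v ^ lookup m v)"
  unfolding mon_def
  by (rule prod.mono_neutral_left) (use assms in \<open>auto simp: in_keys_iff\<close>)

lemma mon_zero [simp]: "mon x 0 = 1"
  by (simp add: mon_def)

lemma mon_single: "mon x (single v n) = x v ^ n"
  by (subst mon_superset[of "{v}"]) auto

lemma mon_add: "mon x (m + m') = mon x m * mon x m'"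
proof -
  let ?A = "keys m \<union> keys m'"
  have "mon x (m + m') = (\<Prod>v \<in> ?A. x v ^ lookup (m + m') v)"
    by (rule mon_superset) (auto simp: Poly_Mapping.keys_add)
  also have "\<dots> = mon x m * mon x m'"
    by (simp add: lookup_add power_add prod.distrib mon_superset[of ?A])
  finally show ?thesis .
qed

lemma (in rhom) mon: "h (mon x m) = mon (\<lambda>v. h (x v)) m"
  by (simp add: mon_def prod power)

lemma mon_cong: "(\<And>v. v \<in> keys m \<Longrightarrow> x v = y v) \<Longrightarrow> mon x m = mon y m"
  by (simp add: mon_def cong: prod.cong)

lemma single_sum_expansion: "P = (\<Sum>m \<in> keys P. single m (lookup P m))"
  by (rule poly_mapping_eqI)
     (auto simp: lookup_sum lookup_single when_def in_keys_iff if_distrib sum.delta' cong: if_cong)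

lemma single_eq_mon:
  fixes c :: "'a::comm_ring_1"
  shows "single m c = (const c * mon indet m :: ('v, 'a) mpoly)"
proof -
  have *: "indet v ^ n = (single (single v n) 1 :: ('v, 'a) mpoly)" for v n
    by (induction n) (simp_all add: indet_def mult_single flip: single_add)
  have "mon indet m = (single m 1 :: ('v, 'a) mpoly)"
  proof -
    have "finite A \<Longrightarrow> (\<Prod>v\<in>A. indet v ^ lookup m v) =
        (single (\<Sum>v\<in>A. single v (lookup m v)) 1 :: ('v, 'a) mpoly)" for A
      by (induction A rule: finite_induct) (auto simp: * mult_single)
    from this[of "keys m"] show ?thesis
      by (simp add: mon_def single_sum_expansion[symmetric])
  qed
  then show ?thesis
    by (simp add: const_def mult_single)
qed

lemma mon_indet: "mon indet m = single m 1"
  by (simp add: single_eq_mon rhom.one[OF rhom_const])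

lemma psubst_superset:
  assumes "rhom h" "finite K" "keys P \<subseteq> K"
  shows "psubst h x P = (\<Sum>m \<in> K. h (lookup P m) * mon x m)"
  unfolding psubst_def
  by (rule sum.mono_neutral_left) (use assms in \<open>auto simp: in_keys_iff rhom.zero\<close>)

lemma psubst_add:
  assumes "rhom h"
  shows "psubst h x (P + Q) = psubst h x P + psubst h x Q"
proof -
  let ?K = "keys P \<union> keys Q"
  have "psubst h x (P + Q) = (\<Sum>m \<in> ?K. h (lookup (P + Q) m) * mon x m)"
    by (rule psubst_superset[OF assms]) (auto simp: Poly_Mapping.keys_add)
  also have "\<dots> = psubst h x P + psubst h x Q"
    by (simp add: lookup_add rhom.add[OF assms] distrib_right sum.distrib psubst_superset[OF assms, of ?K])
  finally show ?thesis .
qed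

lemma psubst_single:
  assumes "rhom h"
  shows "psubst h x (single m c) = h c * mon x m"
  by (subst psubst_superset[OF assms, of "{m}"]) auto

lemma psubst_zero [simp]: "psubst h x 0 = 0"
  by (simp add: psubst_def)

lemma psubst_sum:
  assumes "rhom h"
  shows "psubst h x (sum f A) = (\<Sum>i\<in>A. psubst h x (f i))"
  by (induction A rule: infinite_finite_induct) (auto simp: psubst_add[OF assms])

lemma rhom_psubst:
  assumes h: "rhom h"
  shows "rhom (psubst h x)"
proof
  show "psubst h x 1 = 1"
    using psubst_single[OF h, of x 0 1] by (simp add: rhom.one[OF h])
  show "psubst h x (P + Q) = psubst h x P + psubst h x Q" for P Q
    by (rule psubst_add[OF h])
  show "psubst h x (P * Q) = psubst h x P * psubst h x Q" for P Q
  proof -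
    let ?s = "\<lambda>P m. single m (lookup P m)"
    have "P * Q = (\<Sum>m\<in>keys P. ?s P m) * (\<Sum>m\<in>keys Q. ?s Q m)"
      by (simp add: single_sum_expansion[symmetric])
    also have "\<dots> = (\<Sum>m\<in>keys P. \<Sum>m'\<in>keys Q. ?s P m * ?s Q m')"
      by (simp add: sum_product)
    finally have "psubst h x (P * Q) = (\<Sum>m\<in>keys P. \<Sum>m'\<in>keys Q.
        (h (lookup P m) * mon x m) * (h (lookup Q m') * mon x m'))"
      by (simp add: psubst_sum[OF h] mult_single psubst_single[OF h] rhom.mult[OF h] mon_add mult_ac)
    then show ?thesis
      by (simp add: psubst_def sum_product)
  qed
qed

lemma psubst_indet [simp]: "rhom h \<Longrightarrow> psubst h x (indet v) = x v"
  by (simp add: indet_def psubst_single mon_single rhom.one)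

lemma psubst_const [simp]: "rhom h \<Longrightarrow> psubst h x (const c) = h c"
  by (simp add: const_def psubst_single)

lemma psubst_cong:
  assumes "P \<in> polys_in V" "\<And>c. h c = h' c" "\<And>v. v \<in> V \<Longrightarrow> x v = y v"
  shows "psubst h x P = psubst h' y P"
  unfolding psubst_def
  by (intro sum.cong refl arg_cong2[where f = "(*)"] mon_cong assms)
     (use assms(1) in \<open>auto simp: polys_in_def\<close>)

text \<open>
  The universal property of the polynomial ring: homomorphisms are compared on constants and
  indeterminates only.
\<close>

lemma rhom_eq_psubst:
  assumes "rhom F"
  shows "F P = psubst (\<lambda>c. F (const c)) (\<lambda>v. F (indet v)) P"
proof -
  have "F P = (\<Sum>m \<in> keys P. F (single m (lookup P m)))"
    by (simp add: single_sum_expansion[symmetric] flip: rhom.sum[OF assms])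
  also have "\<dots> = psubst (\<lambda>c. F (const c)) (\<lambda>v. F (indet v)) P"
    by (simp add: psubst_def single_eq_mon rhom.mult[OF assms] rhom.mon[OF assms])
  finally show ?thesis .
qed

lemma rhom_eqI:
  assumes "rhom F" "rhom G" "P \<in> polys_in V"
    and "\<And>c. F (const c) = G (const c)" "\<And>v. v \<in> V \<Longrightarrow> F (indet v) = G (indet v)"
  shows "F P = G P"
proof -
  have "psubst (\<lambda>c. F (const c)) (\<lambda>v. F (indet v)) P = psubst (\<lambda>c. G (const c)) (\<lambda>v. G (indet v)) P"
    using assms(3-5) by (rule psubst_cong)
  then show ?thesis
    using rhom_eq_psubst[OF assms(1), of P] rhom_eq_psubst[OF assms(2), of P] by simp
qed

lemma const_int: "const (c :: int) = of_int c"
  by (simp add: const_def flip: single_of_int)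

lemma rhom_int_eqI:
  fixes F G :: "('v, int) mpoly \<Rightarrow> 'b::comm_ring_1"
  assumes "rhom F" "rhom G" "\<And>v. F (indet v) = G (indet v)"
  shows "F P = G P"
  by (rule rhom_eqI[OF assms(1,2), of _ UNIV])
     (auto simp: assms(3) polys_in_def const_int rhom.of_int[OF assms(1)] rhom.of_int[OF assms(2)])

lemma psubst_indet_id: "psubst const indet P = P"
  using rhom_eq_psubst[of "\<lambda>x. x" P] by (simp add: rhom_def)

lemma polys_in_zero [simp]: "0 \<in> polys_in V"
  and polys_in_const [simp]: "const c \<in> polys_in V"
  by (auto simp: polys_in_def const_def)

lemma polys_in_one [simp]: "1 \<in> polys_in V"
  by (auto simp: polys_in_def)

lemma polys_in_indet [simp]: "v \<in> V \<Longrightarrow> indet v \<in> polys_in V"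
  by (auto simp: polys_in_def indet_def)

lemma polys_in_add [simp]: "P \<in> polys_in V \<Longrightarrow> Q \<in> polys_in V \<Longrightarrow> P + Q \<in> polys_in V"
  unfolding polys_in_def using Poly_Mapping.keys_add[of P Q] by blast

lemma polys_in_mult [simp]:
  assumes "P \<in> polys_in V" "Q \<in> polys_in V" shows "P * Q \<in> polys_in V"
  unfolding polys_in_def
proof safe
  fix m v assume m: "m \<in> keys (P * Q)" "v \<in> keys m"
  from m(1) keys_mult[of P Q] obtain a b where "m = a + b" "a \<in> keys P" "b \<in> keys Q"
    by blast
  with m(2) assms Poly_Mapping.keys_add[of a b] show "v \<in> V"
    unfolding polys_in_def by blast
qed

lemma polys_in_uminus [simp]: "P \<in> polys_in V \<Longrightarrow> - P \<in> polys_in V"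
  by (auto simp: polys_in_def in_keys_iff)

lemma polys_in_diff [simp]: "P \<in> polys_in V \<Longrightarrow> Q \<in> polys_in V \<Longrightarrow> P - Q \<in> polys_in V"
  using polys_in_add[OF _ polys_in_uminus, of P V Q] by simp

lemma polys_in_sum [simp]: "(\<And>i. i \<in> A \<Longrightarrow> f i \<in> polys_in V) \<Longrightarrow> sum f A \<in> polys_in V"
  by (induction A rule: infinite_finite_induct) auto

lemma polys_in_prod [simp]: "(\<And>i. i \<in> A \<Longrightarrow> f i \<in> polys_in V) \<Longrightarrow> prod f A \<in> polys_in V"
  by (induction A rule: infinite_finite_induct) auto

lemma polys_in_power [simp]: "P \<in> polys_in V \<Longrightarrow> P ^ n \<in> polys_in V"
  by (induction n) auto

lemma polys_in_mon: "(\<And>v. v \<in> keys m \<Longrightarrow> x v \<in> polys_in V) \<Longrightarrow> mon x m \<in> polys_in V"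
  by (simp add: mon_def)

lemma polys_in_psubst:
  assumes "P \<in> polys_in V" "\<And>c. h c \<in> polys_in U" "\<And>v. v \<in> V \<Longrightarrow> x v \<in> polys_in U"
  shows "psubst h x P \<in> polys_in U"
  unfolding psubst_def
  by (intro polys_in_sum polys_in_mult polys_in_mon assms) (use assms(1) in \<open>auto simp: polys_in_def\<close>)

lemma polys_in_of_int [simp]: "of_int z \<in> polys_in V"
  by (metis polys_in_const rhom.of_int rhom_const)

lemma polys_in_of_nat [simp]: "of_nat m \<in> polys_in V"
  using polys_in_of_int[of "int m" V] by simp

text \<open>Identities between Witt vectors are proved over \<open>\<int>\<close> and carried over by this change of scalars.\<close>

abbreviation red :: "('v, int) mpoly \<Rightarrow> ('v, 'a::comm_ring_1) mpoly" where
  "red \<equiv> psubst of_int indet"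

lemma rhom_red: "rhom red"
  by (rule rhom_psubst[OF rhom_of_int])

lemma rhom_psubst_int: "rhom (psubst of_int x)"
  by (rule rhom_psubst[OF rhom_of_int])

lemma psubst_int_indet [simp]: "psubst of_int x (indet v) = x v"
  by (rule psubst_indet[OF rhom_of_int])

lemma rhom_psubst_const: "rhom (psubst const x)"
  by (rule rhom_psubst[OF rhom_const])

lemma psubst_const_indet [simp]: "psubst const x (indet v) = x v"
  by (rule psubst_indet[OF rhom_const])

section \<open>Ghost components and Witt's theorem\<close>

lemma (in rhom) witt_poly: "h (witt_poly p m x) = witt_poly p m (\<lambda>i. h (x i))"
  by (simp add: witt_poly_def sum mult power of_nat)

lemma witt_poly_cong: "(\<And>i. i \<le> m \<Longrightarrow> x i = y i) \<Longrightarrow> witt_poly p m x = witt_poly p m y"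
  by (simp add: witt_poly_def)

lemma witt_poly_split:
  "witt_poly p m x = (\<Sum>i<m. of_nat p ^ i * x i ^ (p ^ (m - i))) + of_nat p ^ m * x m"
  by (simp add: witt_poly_def lessThan_Suc_atMost[symmetric])

text \<open>
  In \<open>a^p - b^p = (a - b) \<Sum>\<^sub>i b^(p-1-i) a^i\<close> the sum is congruent to \<open>p b^(p-1)\<close> modulo \<open>a - b\<close>, so
  it contributes one more factor \<open>p\<close>.
\<close>

lemma dvd_power_prime_diff:
  fixes a b :: "'a::comm_ring_1"
  assumes "of_nat p ^ Suc k dvd a - b"
  shows "of_nat p ^ Suc (Suc k) dvd a ^ p - b ^ p"
proof -
  have d: "of_nat p dvd a - b"
    using assms by (rule dvd_trans[rotated]) simp
  have "of_nat p dvd (\<Sum>i<p. b ^ (p - Suc i) * a ^ i)"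
  proof -
    have "a - b dvd (\<Sum>i<p. b ^ (p - Suc i) * (a ^ i - b ^ i))"
      by (intro dvd_sum dvd_mult) (simp add: power_diff_sumr2)
    then have "of_nat p dvd (\<Sum>i<p. b ^ (p - Suc i) * (a ^ i - b ^ i))"
      using d dvd_trans by blast
    also have "(\<Sum>i<p. b ^ (p - Suc i) * (a ^ i - b ^ i)) =
        (\<Sum>i<p. b ^ (p - Suc i) * a ^ i) - (\<Sum>i<p. b ^ (p - Suc i) * b ^ i)"
      by (simp add: right_diff_distrib sum_subtractf)
    also have "(\<Sum>i<p. b ^ (p - Suc i) * b ^ i) = (\<Sum>i<p. b ^ (p - 1))"
      by (intro sum.cong refl) (simp flip: power_add)
    also have "\<dots> = of_nat p * b ^ (p - 1)"
      by simp
    finally show ?thesis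
      by (metis diff_add_cancel dvd_add dvd_triv_left)
  qed
  then have "of_nat p ^ Suc k * of_nat p dvd (a - b) * (\<Sum>i<p. b ^ (p - Suc i) * a ^ i)"
    using assms by (rule mult_dvd_mono[rotated])
  then show ?thesis
    by (simp add: power_diff_sumr2 mult_ac)
qed

lemma dvd_power_prime_power_diff:
  fixes a b :: "'a::comm_ring_1"
  assumes "of_nat p dvd a - b"
  shows "of_nat p ^ Suc k dvd a ^ (p ^ k) - b ^ (p ^ k)"
proof (induction k)
  case (Suc k)
  then have "of_nat p ^ Suc (Suc k) dvd (a ^ (p ^ k)) ^ p - (b ^ (p ^ k)) ^ p"
    by (rule dvd_power_prime_diff)
  then show ?case
    by (simp add: mult.commute flip: power_mult)
qed (use assms in simp)

lemma dvd_prime_binomial: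
  fixes a b :: "'a::comm_ring_1"
  assumes "Factorial_Ring.prime p"
  shows "of_nat p dvd (a + b) ^ p - (a ^ p + b ^ p)"
proof -
  have p: "p > 0" "p \<noteq> 0" using assms prime_gt_0_nat by auto
  have "(a + b) ^ p = (\<Sum>k\<le>p. of_nat (p choose k) * a ^ k * b ^ (p - k))"
    by (rule binomial_ring)
  also have "{..p} = insert 0 (insert p {1..<p})"
    using p by auto
  also have "(\<Sum>k\<in>\<dots>. of_nat (p choose k) * a ^ k * b ^ (p - k)) =
      a ^ p + b ^ p + (\<Sum>k=1..<p. of_nat (p choose k) * a ^ k * b ^ (p - k))"
    using p by (simp add: add_ac)
  finally have "(a + b) ^ p - (a ^ p + b ^ p) = (\<Sum>k=1..<p. of_nat (p choose k) * a ^ k * b ^ (p - k))"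
    by simp
  also have "of_nat p dvd \<dots>"
  proof (intro dvd_sum)
    fix k assume "k \<in> {1..<p}"
    then have "p dvd p choose k"
      using assms by (intro dvd_choose_prime) auto
    then have "of_nat p dvd (of_nat (p choose k) :: 'a)"
      by (auto elim!: dvdE)
    then show "of_nat p dvd of_nat (p choose k) * a ^ k * b ^ (p - k)"
      by (intro dvd_mult2)
  qed
  finally show ?thesis .
qed

definition frob_lift :: "nat \<Rightarrow> ('a::comm_ring_1 \<Rightarrow> 'a) \<Rightarrow> bool" where
  "frob_lift p \<sigma> \<longleftrightarrow> rhom \<sigma> \<and> (\<forall>a. of_nat p dvd \<sigma> a - a ^ p)"

text \<open>
  The elements on which \<open>\<sigma>\<close> agrees with the \<open>p\<close>-th power modulo \<open>p\<close> form a subring, by the binomial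
  theorem, and this subring contains the indeterminates.
\<close>

lemma frob_lift_mpoly:
  assumes p: "Factorial_Ring.prime p"
  shows "frob_lift p (psubst of_int (\<lambda>v. indet v ^ p) :: ('v, int) mpoly \<Rightarrow> _)"
  unfolding frob_lift_def
proof (intro conjI allI)
  let ?s = "psubst of_int (\<lambda>v. indet v ^ p) :: ('v, int) mpoly \<Rightarrow> ('v, int) mpoly"
  let ?q = "of_nat p :: ('v, int) mpoly"
  show s: "rhom ?s" by (rule rhom_psubst_int)
  have p0: "p > 0" using p prime_gt_0_nat by auto
  have add: "?q dvd ?s (a + b) - (a + b) ^ p" if "?q dvd ?s a - a ^ p" "?q dvd ?s b - b ^ p" for a b
  proof -
    have "?q dvd (?s a - a ^ p) + (?s b - b ^ p) - ((a + b) ^ p - (a ^ p + b ^ p))"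
      by (rule dvd_diff[OF dvd_add[OF that] dvd_prime_binomial[OF p]])
    then show ?thesis by (simp add: rhom.add[OF s] algebra_simps)
  qed
  have mult: "?q dvd ?s (a * b) - (a * b) ^ p" if "?q dvd ?s a - a ^ p" "?q dvd ?s b - b ^ p" for a b
  proof -
    have "?q dvd (?s a - a ^ p) * ?s b + a ^ p * (?s b - b ^ p)"
      by (rule dvd_add[OF dvd_mult2[OF that(1)] dvd_mult[OF that(2)]])
    then show ?thesis by (simp add: rhom.mult[OF s] algebra_simps)
  qed
  have one: "?q dvd ?s 1 - 1 ^ p"
    by (simp add: rhom.one[OF s])
  have zero: "?q dvd ?s 0 - 0 ^ p"
    using p0 by (simp add: zero_power)
  have neg: "?q dvd ?s (- a) - (- a) ^ p" if "?q dvd ?s a - a ^ p" for a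
  proof -
    have "?q dvd ((a + - a) ^ p - (a ^ p + (- a) ^ p)) - (?s a - a ^ p)"
      by (rule dvd_diff[OF dvd_prime_binomial[OF p] that])
    moreover have "((a + - a) ^ p - (a ^ p + (- a) ^ p)) - (?s a - a ^ p) = ?s (- a) - (- a) ^ p"
      using p0 by (simp add: rhom.uminus[OF s] zero_power)
    ultimately show ?thesis by (simp only:)
  qed
  have nat: "?q dvd ?s (of_nat k) - of_nat k ^ p" for k
    by (induction k) (use add[OF one] zero in auto)
  have int: "?q dvd ?s (of_int z) - of_int z ^ p" for z
    using add[OF nat neg[OF nat]] by (cases z rule: int_diff_cases) simp
  have pow: "?q dvd ?s (a ^ k) - (a ^ k) ^ p" if "?q dvd ?s a - a ^ p" for a k
    by (induction k) (use one mult[OF that] in auto)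
  have prod: "?q dvd ?s (prod f A) - prod f A ^ p" if "\<And>i. i \<in> A \<Longrightarrow> ?q dvd ?s (f i) - f i ^ p"
    for f :: "'v \<Rightarrow> _" and A
    using that by (induction A rule: infinite_finite_induct) (use one mult in auto)
  have sum: "?q dvd ?s (sum f A) - sum f A ^ p" if "\<And>i. i \<in> A \<Longrightarrow> ?q dvd ?s (f i) - f i ^ p"
    for f :: "('v \<Rightarrow>\<^sub>0 nat) \<Rightarrow> _" and A
    using that by (induction A rule: infinite_finite_induct) (use zero add in auto)
  fix a
  have "?q dvd ?s (psubst const indet a) - (psubst const indet a) ^ p"
    unfolding psubst_def[of const] mon_def const_int
    by (intro sum mult int prod pow) simp
  then show "?q dvd ?s a - a ^ p"
    by (simp only: psubst_indet_id)
qed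

text \<open>
  From \<open>\<sigma>(U\<^sub>i) \<equiv> U\<^sub>i^p\<close> modulo \<open>p\<close> follows a congruence of the \<open>p^(m-i)\<close>-th powers modulo \<open>p^(m-i+1)\<close>; the
  factor \<open>p^i\<close> in the ghost component supplies the rest.
\<close>

lemma ghost_frob:
  fixes \<sigma> :: "'a::comm_ring_1 \<Rightarrow> 'a"
  assumes "frob_lift p \<sigma>"
  shows "of_nat p ^ Suc m dvd (\<Sum>i\<le>m. of_nat p ^ i * U i ^ (p ^ (Suc m - i))) - \<sigma> (witt_poly p m U)"
proof -
  have s: "rhom \<sigma>" and f: "\<And>a. of_nat p dvd \<sigma> a - a ^ p"
    using assms by (auto simp: frob_lift_def)
  have "(\<Sum>i\<le>m. of_nat p ^ i * U i ^ (p ^ (Suc m - i))) =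
      (\<Sum>i\<le>m. of_nat p ^ i * (U i ^ p) ^ (p ^ (m - i)))"
    by (intro sum.cong refl) (simp add: Suc_diff_le flip: power_mult)
  then have "(\<Sum>i\<le>m. of_nat p ^ i * U i ^ (p ^ (Suc m - i))) - \<sigma> (witt_poly p m U) =
     - (\<Sum>i\<le>m. of_nat p ^ i * (\<sigma> (U i) ^ (p ^ (m - i)) - (U i ^ p) ^ (p ^ (m - i))))"
    unfolding rhom.witt_poly[OF s]
    by (simp add: witt_poly_def right_diff_distrib sum_subtractf)
  moreover have "of_nat p ^ Suc m dvd (of_nat p ^ i * (\<sigma> (U i) ^ (p ^ (m - i)) - (U i ^ p) ^ (p ^ (m - i))))"
    if "i \<le> m" for i
  proof -
    have "of_nat p ^ i * of_nat p ^ Suc (m - i) dvd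
        of_nat p ^ i * (\<sigma> (U i) ^ (p ^ (m - i)) - (U i ^ p) ^ (p ^ (m - i)))"
      by (intro mult_dvd_mono dvd_refl dvd_power_prime_power_diff f)
    moreover have "of_nat p ^ i * of_nat p ^ Suc (m - i) = (of_nat p ^ Suc m :: 'a)"
      by (subst power_add[symmetric]) (use that in simp)
    ultimately show ?thesis
      by simp
  qed
  ultimately show ?thesis
    by (simp only: dvd_minus_iff) (rule dvd_sum, simp only: atMost_iff)
qed

text \<open>
  Dwork's congruences.  They characterize the ghosts of Witt vectors, and in this form it is
  evident that ghosts are closed under the ring operations.
\<close>

definition ghostly :: "nat \<Rightarrow> ('a::comm_ring_1 \<Rightarrow> 'a) \<Rightarrow> (nat \<Rightarrow> 'a) \<Rightarrow> bool" where
  "ghostly p \<sigma> g \<longleftrightarrow> (\<forall>m. of_nat p ^ Suc m dvd g (Suc m) - \<sigma> (g m))"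

lemma ghostly_witt_poly:
  assumes "frob_lift p \<sigma>"
  shows "ghostly p \<sigma> (\<lambda>m. witt_poly p m U)"
  unfolding ghostly_def
proof
  fix m
  have "of_nat p ^ Suc m dvd ((\<Sum>i\<le>m. of_nat p ^ i * U i ^ (p ^ (Suc m - i))) - \<sigma> (witt_poly p m U))
      + of_nat p ^ Suc m * U (Suc m)"
    by (intro dvd_add ghost_frob[OF assms] dvd_triv_left)
  then show "of_nat p ^ Suc m dvd witt_poly p (Suc m) U - \<sigma> (witt_poly p m U)"
    unfolding witt_poly_split[of p "Suc m"] lessThan_Suc_atMost by (simp add: algebra_simps)
qed

lemma ghostly_add:
  assumes "rhom \<sigma>" "ghostly p \<sigma> f" "ghostly p \<sigma> g"
  shows "ghostly p \<sigma> (\<lambda>m. f m + g m)"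
  unfolding ghostly_def
proof
  fix m
  have "of_nat p ^ Suc m dvd (f (Suc m) - \<sigma> (f m)) + (g (Suc m) - \<sigma> (g m))"
    using assms by (intro dvd_add) (auto simp: ghostly_def)
  then show "of_nat p ^ Suc m dvd f (Suc m) + g (Suc m) - \<sigma> (f m + g m)"
    by (simp add: rhom.add[OF assms(1)] algebra_simps)
qed

lemma ghostly_mult:
  assumes "rhom \<sigma>" "ghostly p \<sigma> f" "ghostly p \<sigma> g"
  shows "ghostly p \<sigma> (\<lambda>m. f m * g m)"
  unfolding ghostly_def
proof
  fix m
  have "of_nat p ^ Suc m dvd (f (Suc m) - \<sigma> (f m)) * g (Suc m) + \<sigma> (f m) * (g (Suc m) - \<sigma> (g m))"
    using assms by (intro dvd_add dvd_mult dvd_mult2) (auto simp: ghostly_def)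
  then show "of_nat p ^ Suc m dvd f (Suc m) * g (Suc m) - \<sigma> (f m * g m)"
    by (simp add: rhom.mult[OF assms(1)] algebra_simps)
qed

lemma ghostly_uminus:
  assumes "rhom \<sigma>" "ghostly p \<sigma> f"
  shows "ghostly p \<sigma> (\<lambda>m. - f m)"
  unfolding ghostly_def
proof
  fix m
  have "of_nat p ^ Suc m dvd - (f (Suc m) - \<sigma> (f m))"
    unfolding dvd_minus_iff using assms by (auto simp: ghostly_def)
  then show "of_nat p ^ Suc m dvd - f (Suc m) - \<sigma> (- f m)"
    by (simp add: rhom.uminus[OF assms(1)])
qed

lemma ghostly_const: "rhom \<sigma> \<Longrightarrow> ghostly p \<sigma> (\<lambda>m. of_int z)"
  by (simp add: ghostly_def rhom.of_int)

lemma ghostly_sum: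
  assumes "rhom \<sigma>" "\<And>i. i \<in> A \<Longrightarrow> ghostly p \<sigma> (f i)"
  shows "ghostly p \<sigma> (\<lambda>m. \<Sum>i\<in>A. f i m)"
  using assms(2) ghostly_const[OF assms(1), of p 0]
  by (induction A rule: infinite_finite_induct) (auto intro: ghostly_add[OF assms(1)])

text \<open>
  The equations \<open>w\<^sub>m(U) = g\<^sub>m\<close> solved for \<open>U\<^sub>m\<close> one after another.  Division by \<open>p^m\<close> is a choice, which is
  meaningful for sequences that satisfy Dwork's congruences.
\<close>

fun unghost :: "nat \<Rightarrow> (nat \<Rightarrow> 'a::comm_ring_1) \<Rightarrow> nat \<Rightarrow> 'a" where
  "unghost p g m = (SOME x. of_nat p ^ m * x = g m - (\<Sum>i<m. of_nat p ^ i * unghost p g i ^ (p ^ (m - i))))"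

declare unghost.simps [simp del]

lemma witt_poly_unghost:
  assumes s: "frob_lift p \<sigma>" and g: "ghostly p \<sigma> g"
  shows "witt_poly p m (unghost p g) = g m"
proof (induction m rule: less_induct)
  case (less m)
  let ?U = "unghost p g"
  let ?S = "\<Sum>i<m. of_nat p ^ i * ?U i ^ (p ^ (m - i))"
  have "of_nat p ^ m dvd g m - ?S"
  proof (cases m)
    case (Suc k)
    have "of_nat p ^ Suc k dvd (g (Suc k) - \<sigma> (g k))
        - ((\<Sum>i\<le>k. of_nat p ^ i * ?U i ^ (p ^ (Suc k - i))) - \<sigma> (witt_poly p k ?U))"
      using g by (intro dvd_diff[OF _ ghost_frob[OF s]]) (simp only: ghostly_def)
    then show ?thesis
      using less.IH[of k] by (simp add: Suc lessThan_Suc_atMost)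
  qed simp
  then obtain x where "of_nat p ^ m * x = g m - ?S"
    by (metis dvdE)
  then have "of_nat p ^ m * ?U m = g m - ?S"
    by (subst unghost.simps) (rule someI)
  then show ?case
    by (simp add: witt_poly_split)
qed

text \<open>
  Without \<open>p\<close>-torsion, \<open>w\<^sub>m\<close> determines the component \<open>m\<close> once the earlier components are known.
\<close>

lemma ghost_inj:
  fixes U Y :: "nat \<Rightarrow> 'a::comm_ring_1"
  assumes free: "\<And>x::'a. of_nat p * x = 0 \<Longrightarrow> x = 0"
    and eq: "\<And>m. m < N \<Longrightarrow> witt_poly p m U = witt_poly p m Y"
  shows "i < N \<Longrightarrow> U i = Y i"
proof (induction i rule: less_induct)
  case (less i)
  have free': "of_nat p ^ k * x = 0 \<Longrightarrow> x = 0" for k and x :: 'a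
    by (induction k) (use free in \<open>auto simp: mult.assoc\<close>)
  have "of_nat p ^ i * U i = of_nat p ^ i * Y i"
    using eq[OF less.prems] less by (simp add: witt_poly_split)
  then have "of_nat p ^ i * (U i - Y i) = 0"
    by (simp add: algebra_simps)
  then show ?case
    using free' by (metis eq_iff_diff_eq_0)
qed

lemma lookup_of_int_mult: "lookup (of_int c * P) m = c * lookup (P :: ('v, int) mpoly) m"
proof -
  have "of_int c * P = Poly_Mapping.map ((*) c) P"
    by (simp add: mult_map_scale_conv_mult flip: single_of_int)
  then show ?thesis
    by (simp add: Poly_Mapping.map.rep_eq when_def)
qed

lemma mpoly_int_torsion_free:
  fixes P :: "('v, int) mpoly"
  assumes "of_nat c * P = 0" "c \<noteq> 0"
  shows "P = 0"
proof (rule poly_mapping_eqI)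
  fix m
  have "int c * lookup P m = 0"
    using lookup_of_int_mult[of "int c" P m] assms(1) by simp
  then show "lookup P m = lookup 0 m"
    using assms(2) by simp
qed

lemma ghost_inj_mpoly:
  fixes U Y :: "nat \<Rightarrow> ('v, int) mpoly"
  assumes "Factorial_Ring.prime p" "\<And>m. m < N \<Longrightarrow> witt_poly p m U = witt_poly p m Y" "i < N"
  shows "U i = Y i"
  by (rule ghost_inj[OF mpoly_int_torsion_free assms(2,3)]) (use assms(1) prime_gt_0_nat in auto)

lemma ghost_realizable:
  fixes g :: "nat \<Rightarrow> ('v, int) mpoly"
  assumes "Factorial_Ring.prime p" "ghostly p (psubst of_int (\<lambda>v. indet v ^ p)) g"
  obtains U where "\<And>m. witt_poly p m U = g m"
  using witt_poly_unghost[OF frob_lift_mpoly[OF assms(1)] assms(2)] by blast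

text \<open>
  Witt's theorem for addition and multiplication: Dwork's congruences give existence of the
  polynomials, injectivity of the ghost map uniqueness, so the definite description denotes them.
\<close>

lemma witt_op_poly_ghost:
  assumes p: "Factorial_Ring.prime p"
    and \<phi>: "\<phi> = (\<lambda>P Q. P + Q) \<or> \<phi> = (\<lambda>P Q. P * Q)"
  shows "witt_poly p m (witt_op_poly p \<phi>) =
     \<phi> (witt_poly p m (\<lambda>i. indet (Inl i))) (witt_poly p m (\<lambda>i. indet (Inr i)))"
proof -
  let ?g = "\<lambda>m. \<phi> (witt_poly p m (\<lambda>i. indet (Inl i))) (witt_poly p m (\<lambda>i. indet (Inr i)))"
  note f = frob_lift_mpoly[OF p, where 'v = "nat + nat"]
  then have "ghostly p (psubst of_int (\<lambda>v. indet v ^ p)) ?g"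
    using \<phi> by (auto intro!: ghostly_add ghostly_mult ghostly_witt_poly simp: frob_lift_def)
  then obtain U where U: "\<And>m. witt_poly p m U = ?g m"
    using ghost_realizable[OF p] by blast
  have "\<exists>!\<Phi>. \<forall>m. witt_poly p m \<Phi> = ?g m"
  proof (rule ex1I[of _ U])
    fix Y assume "\<forall>m. witt_poly p m Y = ?g m"
    then show "Y = U"
      using U ghost_inj_mpoly[OF p, of "Suc _" Y U] by (metis ext lessI)
  qed (use U in auto)
  from theI'[OF this] show ?thesis
    unfolding witt_op_poly_def by blast
qed

lemma witt_op_poly_eval_ghost:
  fixes x y :: "nat \<Rightarrow> 'b::comm_ring_1"
  assumes p: "Factorial_Ring.prime p"
  shows "witt_poly p m (\<lambda>i. psubst of_int (case_sum x y) (witt_op_poly p (\<lambda>P Q. P + Q) i)) =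
          witt_poly p m x + witt_poly p m y"
    and "witt_poly p m (\<lambda>i. psubst of_int (case_sum x y) (witt_op_poly p (\<lambda>P Q. P * Q) i)) =
          witt_poly p m x * witt_poly p m y"
  using witt_op_poly_ghost[OF p, of "\<lambda>P Q. P + Q" m] witt_op_poly_ghost[OF p, of "\<lambda>P Q. P * Q" m]
  by (simp_all flip: rhom.witt_poly[OF rhom_psubst_int]
        add: rhom.add[OF rhom_psubst_int] rhom.mult[OF rhom_psubst_int])
     (simp_all add: rhom.witt_poly[OF rhom_psubst_int])

lemma ghost_leading_zero:
  fixes U :: "nat \<Rightarrow> 'a::comm_ring_1"
  assumes "\<And>i. i < c \<Longrightarrow> U i = 0" "m < c" "p > 0"
  shows "witt_poly p m U = 0"
  using assms by (auto simp: witt_poly_def zero_power intro!: sum.neutral)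

text \<open>
  The remaining terms of the ghost component are divisible by higher powers of \<open>p\<close>.
\<close>

lemma ghost_leading_term:
  fixes U :: "nat \<Rightarrow> 'a::comm_ring_1"
  assumes "\<And>i. i < c \<Longrightarrow> U i = 0" "c \<le> m" "p > 0"
  shows "of_nat p ^ Suc c dvd witt_poly p m U - of_nat p ^ c * U c ^ (p ^ (m - c))"
proof -
  have "witt_poly p m U = of_nat p ^ c * U c ^ (p ^ (m - c)) +
      (\<Sum>i\<in>{..m} - {c}. of_nat p ^ i * U i ^ (p ^ (m - i)))"
    using assms(2) by (simp add: witt_poly_def sum.remove[of _ c])
  moreover have "of_nat p ^ Suc c dvd (\<Sum>i\<in>{..m} - {c}. of_nat p ^ i * U i ^ (p ^ (m - i)))"
  proof (intro dvd_sum)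
    fix i assume "i \<in> {..m} - {c}"
    then consider "i < c" | "Suc c \<le> i" by fastforce
    then show "of_nat p ^ Suc c dvd of_nat p ^ i * U i ^ (p ^ (m - i))"
      by cases (use assms in \<open>auto simp: le_imp_power_dvd zero_power simp del: power_Suc intro: dvd_mult2\<close>)
  qed
  ultimately show ?thesis
    by simp
qed

lemma ghost_leading_dvd:
  fixes U :: "nat \<Rightarrow> 'a::comm_ring_1"
  assumes "\<And>i. i < c \<Longrightarrow> U i = 0" "p > 0"
  shows "of_nat p ^ c dvd witt_poly p m U"
proof (cases "m < c")
  case False
  then have "of_nat p ^ Suc c dvd witt_poly p m U - of_nat p ^ c * U c ^ (p ^ (m - c))"
    using assms by (intro ghost_leading_term) auto
  then have "of_nat p ^ c dvd witt_poly p m U - of_nat p ^ c * U c ^ (p ^ (m - c))"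
    by (rule dvd_trans[rotated]) simp
  then have "of_nat p ^ c dvd witt_poly p m U - of_nat p ^ c * U c ^ (p ^ (m - c)) + of_nat p ^ c * U c ^ (p ^ (m - c))"
    by (intro dvd_add) auto
  then show ?thesis by simp
qed (use assms ghost_leading_zero[of c U m p] in simp)

text \<open>
  Valuations are read off from ghost components: if \<open>E\<^sub>0, \<dots>, E\<^bsub>m-1\<^esub>\<close> are divisible by \<open>p\<close>, then
  \<open>p^i E\<^sub>i^(p^(m-i))\<close> is divisible by \<open>p^(m+1)\<close> for \<open>i < m\<close>, because \<open>p^(m-i) > m - i\<close>, and only the
  term \<open>p^m E\<^sub>m\<close> is left.
\<close>

lemma ghost_dvd_leading:
  fixes E :: "nat \<Rightarrow> ('v, int) mpoly"
  assumes p: "Factorial_Ring.prime p"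
    and d: "\<And>m. m < t \<Longrightarrow> of_nat p ^ Suc m dvd witt_poly p m E"
  shows "i < t \<Longrightarrow> of_nat p dvd E i"
    and "of_nat p ^ Suc t dvd witt_poly p t E - of_nat p ^ t * E t"
proof -
  have p2: "p \<ge> 2" using p by (rule prime_ge_2_nat)
  have low: "of_nat p ^ Suc m dvd of_nat p ^ i * E i ^ (p ^ (m - i))"
    if "i < m" "of_nat p dvd E i" for i m
  proof -
    have "Suc (m - i) \<le> p ^ (m - i)"
      using less_exp[of "m - i"] power_mono[OF p2, of "m - i"] by linarith
    then have "of_nat p ^ Suc (m - i) dvd (of_nat p ^ (p ^ (m - i)) :: ('v, int) mpoly)"
      by (rule le_imp_power_dvd)
    also have "\<dots> dvd E i ^ (p ^ (m - i))"
      using that(2) by (rule dvd_power_same)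
    finally have "of_nat p ^ i * of_nat p ^ Suc (m - i) dvd of_nat p ^ i * E i ^ (p ^ (m - i))"
      by (intro mult_dvd_mono dvd_refl)
    moreover have "of_nat p ^ i * of_nat p ^ Suc (m - i) = (of_nat p ^ Suc m :: ('v, int) mpoly)"
      by (subst power_add[symmetric]) (use that(1) in simp)
    ultimately show ?thesis
      by simp
  qed
  have E: "of_nat p dvd E i" if "i < t" for i
    using that
  proof (induction i rule: less_induct)
    case (less i)
    have "of_nat p ^ Suc i dvd witt_poly p i E - (\<Sum>j<i. of_nat p ^ j * E j ^ (p ^ (i - j)))"
      using less by (intro dvd_diff d dvd_sum low) auto
    then obtain x where "of_nat p ^ i * E i = of_nat p ^ Suc i * x"
      by (auto simp: witt_poly_split simp del: power_Suc elim: dvdE)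
    then have "of_nat (p ^ i) * (E i - of_nat p * x) = 0"
      by (simp add: algebra_simps)
    from mpoly_int_torsion_free[OF this] p2 have "E i = of_nat p * x"
      by simp
    then show ?case by simp
  qed
  then show "i < t \<Longrightarrow> of_nat p dvd E i" .
  show "of_nat p ^ Suc t dvd witt_poly p t E - of_nat p ^ t * E t"
    unfolding witt_poly_split by (simp del: power_Suc) (intro dvd_sum low E, auto)
qed

section \<open>The Witt ring of a polynomial ring\<close>

lemma mpoly_ring_simps [simp]:
  "carrier (mpoly_ring V) = polys_in V"
  "a \<otimes>\<^bsub>mpoly_ring V\<^esub> b = a * b"
  "a \<oplus>\<^bsub>mpoly_ring V\<^esub> b = a + b"
  "\<one>\<^bsub>mpoly_ring V\<^esub> = 1"
  "\<zero>\<^bsub>mpoly_ring V\<^esub> = 0"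
  by (simp_all add: mpoly_ring_def polys_in_def)

lemma cring_mpoly_ring: "cring (mpoly_ring V :: ('v, 'a::comm_ring_1) mpoly ring)"
proof (intro cringI abelian_groupI comm_monoidI)
  fix x :: "('v, 'a) mpoly"
  assume "x \<in> carrier (mpoly_ring V)"
  then show "\<exists>y\<in>carrier (mpoly_ring V). y \<oplus>\<^bsub>mpoly_ring V\<^esub> x = \<zero>\<^bsub>mpoly_ring V\<^esub>"
    by (intro bexI[of _ "- x"]) auto
qed (auto simp: algebra_simps)

lemma mpoly_ring_nat_pow [simp]: "x [^]\<^bsub>mpoly_ring V\<^esub> (n :: nat) = x ^ n"
  by (induction n) (simp_all add: nat_pow_def mult.commute)

lemma mpoly_ring_finsum:
  fixes f :: "'i \<Rightarrow> ('v, 'a::comm_ring_1) mpoly"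
  assumes "\<And>i. i \<in> A \<Longrightarrow> f i \<in> polys_in V"
  shows "finsum (mpoly_ring V) f A = sum f A"
proof -
  interpret R: cring "mpoly_ring V :: ('v, 'a) mpoly ring" by (rule cring_mpoly_ring)
  show ?thesis
    using assms by (induction A rule: infinite_finite_induct) (auto simp: R.finsum_infinite R.finsum_insert Pi_def)
qed

lemma mpoly_ring_finprod:
  fixes f :: "'i \<Rightarrow> ('v, 'a::comm_ring_1) mpoly"
  assumes "\<And>i. i \<in> A \<Longrightarrow> f i \<in> polys_in V"
  shows "finprod (mpoly_ring V) f A = prod f A"
proof -
  interpret R: cring "mpoly_ring V :: ('v, 'a) mpoly ring" by (rule cring_mpoly_ring)
  show ?thesis
    using assms by (induction A rule: infinite_finite_induct) (auto simp: R.finprod_infinite R.finprod_insert Pi_def)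
qed

lemma mpoly_ring_a_inv:
  fixes x :: "('v, 'a::comm_ring_1) mpoly"
  assumes "x \<in> polys_in V"
  shows "\<ominus>\<^bsub>mpoly_ring V\<^esub> x = - x"
proof -
  interpret R: cring "mpoly_ring V :: ('v, 'a) mpoly ring" by (rule cring_mpoly_ring)
  show ?thesis
    using assms by (intro R.minus_equality) auto
qed

lemma mpoly_ring_add_pow_nat:
  fixes x :: "('v, 'a::comm_ring_1) mpoly"
  assumes "x \<in> polys_in V"
  shows "[(k :: nat)] \<cdot>\<^bsub>mpoly_ring V\<^esub> x = of_nat k * x"
  using assms
proof (induction k)
  case (Suc k)
  interpret R: cring "mpoly_ring V :: ('v, 'a) mpoly ring" by (rule cring_mpoly_ring)
  show ?case
    using Suc R.add.nat_pow_Suc[of k x] by (simp add: algebra_simps)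
qed (simp add: add_pow_def)

lemma mpoly_ring_add_pow_int:
  fixes x :: "('v, 'a::comm_ring_1) mpoly"
  assumes "x \<in> polys_in V"
  shows "[(z :: int)] \<cdot>\<^bsub>mpoly_ring V\<^esub> x = of_int z * x"
proof -
  interpret R: cring "mpoly_ring V :: ('v, 'a) mpoly ring" by (rule cring_mpoly_ring)
  have int: "[int k] \<cdot>\<^bsub>mpoly_ring V\<^esub> x = of_nat k * x" for k
    using mpoly_ring_add_pow_nat[OF assms, of k] by (simp add: add_pow_def int_pow_int)
  show ?thesis
  proof (cases "z \<ge> 0")
    case True
    then show ?thesis
      using int[of "nat z"] by simp
  next
    case False
    then have "[z] \<cdot>\<^bsub>mpoly_ring V\<^esub> x = \<ominus>\<^bsub>mpoly_ring V\<^esub> ([int (nat (- z))] \<cdot>\<^bsub>mpoly_ring V\<^esub> x)"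
      using R.add.int_pow_neg[of x "- z"] assms by simp
    also have "\<dots> = - (of_nat (nat (- z)) * x)"
      unfolding int using assms by (intro mpoly_ring_a_inv polys_in_mult) (metis polys_in_of_int of_int_of_nat_eq)
    finally show ?thesis
      using False by simp
  qed
qed

text \<open>
  Evaluation inside the structure is substitution in the ambient type; from here on the
  operations of Witt vectors are substitutions.
\<close>

lemma int_poly_eval_mpoly_ring:
  assumes "\<And>v. x v \<in> polys_in V"
  shows "int_poly_eval (mpoly_ring V) x P = psubst of_int x P"
proof -
  have *: "(\<Otimes>\<^bsub>mpoly_ring V\<^esub>v \<in> keys m. x v [^]\<^bsub>mpoly_ring V\<^esub> lookup m v) = mon x m" for m
    using assms by (simp add: mpoly_ring_finprod mon_def)
  have "mon x m \<in> polys_in V" for m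
    using assms by (intro polys_in_mon) auto
  then show ?thesis
    unfolding int_poly_eval_def * psubst_def
    by (simp add: mpoly_ring_add_pow_int mpoly_ring_finsum)
qed

lemma carrier_witt_ring:
  "carrier (witt_ring p N (mpoly_ring V)) = {x. (\<forall>i. x i \<in> polys_in V) \<and> (\<forall>i\<ge>N. x i = 0)}"
  by (auto simp: witt_ring_def) (metis linorder_not_less polys_in_zero)

lemma witt_ring_op_simps:
  "\<one>\<^bsub>witt_ring p N (mpoly_ring V)\<^esub> = (\<lambda>i. if i = 0 \<and> i < N then 1 else 0)"
  "\<zero>\<^bsub>witt_ring p N (mpoly_ring V)\<^esub> = (\<lambda>i. 0)"
  by (simp_all add: witt_ring_def cong: if_cong)

lemma witt_ring_ops:
  assumes "x \<in> carrier (witt_ring p N (mpoly_ring V))" "y \<in> carrier (witt_ring p N (mpoly_ring V))"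
  shows "x \<oplus>\<^bsub>witt_ring p N (mpoly_ring V)\<^esub> y =
      (\<lambda>i. if i < N then psubst of_int (case_sum x y) (witt_op_poly p (\<lambda>P Q. P + Q) i) else 0)"
    and "x \<otimes>\<^bsub>witt_ring p N (mpoly_ring V)\<^esub> y =
      (\<lambda>i. if i < N then psubst of_int (case_sum x y) (witt_op_poly p (\<lambda>P Q. P * Q) i) else 0)"
proof -
  have "case_sum x y v \<in> polys_in V" for v
    using assms by (auto simp: carrier_witt_ring split: sum.splits)
  then show "x \<oplus>\<^bsub>witt_ring p N (mpoly_ring V)\<^esub> y =
      (\<lambda>i. if i < N then psubst of_int (case_sum x y) (witt_op_poly p (\<lambda>P Q. P + Q) i) else 0)"
    and "x \<otimes>\<^bsub>witt_ring p N (mpoly_ring V)\<^esub> y =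
      (\<lambda>i. if i < N then psubst of_int (case_sum x y) (witt_op_poly p (\<lambda>P Q. P * Q) i) else 0)"
    by (simp_all add: witt_ring_def witt_op_def int_poly_eval_mpoly_ring cong: if_cong)
qed

text \<open>
  The Witt vector \<open>x\<close> of length \<open>N\<close> is the image under \<open>h\<close> of one over \<open>\<int>[\<dots>]\<close> with ghost components \<open>g\<close>.
  Since the ghost components determine the lift, arithmetic with \<open>x\<close> becomes componentwise
  arithmetic with \<open>g\<close>.
\<close>

definition lifts ::
  "nat \<Rightarrow> nat \<Rightarrow> (('w, int) mpoly \<Rightarrow> 'b::comm_ring_1) \<Rightarrow> (nat \<Rightarrow> 'b) \<Rightarrow> (nat \<Rightarrow> ('w, int) mpoly) \<Rightarrow> bool" where
  "lifts p N h x g \<longleftrightarrow>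
     (\<exists>U. (\<forall>i. x i = h (U i)) \<and> (\<forall>i\<ge>N. U i = 0) \<and> (\<forall>m<N. witt_poly p m U = g m))"

lemma lifts_unique:
  assumes "Factorial_Ring.prime p" "lifts p N h x g" "lifts p N h y g"
  shows "x = y"
proof
  fix i
  obtain U U' where U: "\<forall>i. x i = h (U i)" "\<forall>i\<ge>N. U i = 0" "\<forall>m<N. witt_poly p m U = g m"
    and U': "\<forall>i. y i = h (U' i)" "\<forall>i\<ge>N. U' i = 0" "\<forall>m<N. witt_poly p m U' = g m"
    using assms(2,3) by (auto simp: lifts_def)
  have "U i = U' i"
    using U(2,3) U'(2,3) ghost_inj_mpoly[OF assms(1), of N U U' i] by (cases "i < N") auto
  then show "x i = y i"
    using U U' by simp
qed

text \<open>Ghost components below \<open>N\<close> depend on the components below \<open>N\<close> only, so the lift may be cut off there.\<close>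

lemma lifts_truncate:
  assumes "rhom h" "\<And>i. x i = (if i < N then h (U i) else 0)" "\<And>m. m < N \<Longrightarrow> witt_poly p m U = g m"
  shows "lifts p N h x g"
  unfolding lifts_def
proof (intro exI[of _ "\<lambda>i. if i < N then U i else 0"] conjI allI impI)
  fix m assume m: "m < N"
  have "witt_poly p m (\<lambda>i. if i < N then U i else 0) = witt_poly p m U"
    using m by (intro witt_poly_cong) auto
  then show "witt_poly p m (\<lambda>i. if i < N then U i else 0) = g m"
    using assms(3)[OF m] by simp
qed (auto simp: assms(2) rhom.zero[OF assms(1)])

lemma lifts_ops:
  assumes p: "Factorial_Ring.prime p" and h: "rhom h"
    and x: "x \<in> carrier (witt_ring p N (mpoly_ring V))" "lifts p N h x f"
    and y: "y \<in> carrier (witt_ring p N (mpoly_ring V))" "lifts p N h y g"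
  shows "lifts p N h (x \<oplus>\<^bsub>witt_ring p N (mpoly_ring V)\<^esub> y) (\<lambda>m. f m + g m)"
    and "lifts p N h (x \<otimes>\<^bsub>witt_ring p N (mpoly_ring V)\<^esub> y) (\<lambda>m. f m * g m)"
proof -
  obtain U U' where U: "\<forall>i. x i = h (U i)" "\<forall>m<N. witt_poly p m U = f m"
    and U': "\<forall>i. y i = h (U' i)" "\<forall>m<N. witt_poly p m U' = g m"
    using x(2) y(2) by (auto simp: lifts_def)
  have *: "psubst of_int (case_sum x y) P = h (psubst of_int (case_sum U U') P)" for P
    by (rule rhom_int_eqI[OF rhom_psubst_int rhom_compose[OF rhom_psubst_int h]])
       (auto simp: U U' split: sum.splits)
  show "lifts p N h (x \<oplus>\<^bsub>witt_ring p N (mpoly_ring V)\<^esub> y) (\<lambda>m. f m + g m)"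
    by (rule lifts_truncate[OF h, where U = "\<lambda>i. psubst of_int (case_sum U U') (witt_op_poly p (\<lambda>P Q. P + Q) i)"])
       (auto simp: witt_ring_ops[OF x(1) y(1)] * witt_op_poly_eval_ghost[OF p] U U')
  show "lifts p N h (x \<otimes>\<^bsub>witt_ring p N (mpoly_ring V)\<^esub> y) (\<lambda>m. f m * g m)"
    by (rule lifts_truncate[OF h, where U = "\<lambda>i. psubst of_int (case_sum U U') (witt_op_poly p (\<lambda>P Q. P * Q) i)"])
       (auto simp: witt_ring_ops[OF x(1) y(1)] * witt_op_poly_eval_ghost[OF p] U U')
qed

lemma witt_poly_zero:
  assumes "p > 0"
  shows "witt_poly p m (\<lambda>i. 0) = 0"
  by (auto simp: witt_poly_def zero_power assms intro!: sum.neutral)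

lemma witt_poly_one:
  assumes "p > 0"
  shows "witt_poly p m (\<lambda>i. if i = 0 then 1 else 0) = 1"
  using assms by (auto simp: witt_poly_def zero_power if_distrib if_distribR cong: if_cong)

lemma lifts_zero_one:
  assumes p: "Factorial_Ring.prime p" and h: "rhom h"
  shows "lifts p N h \<zero>\<^bsub>witt_ring p N (mpoly_ring V)\<^esub> (\<lambda>m. 0)"
    and "lifts p N h \<one>\<^bsub>witt_ring p N (mpoly_ring V)\<^esub> (\<lambda>m. 1)"
proof -
  have p0: "p > 0" using p prime_gt_0_nat by auto
  show "lifts p N h \<zero>\<^bsub>witt_ring p N (mpoly_ring V)\<^esub> (\<lambda>m. 0)"
    by (rule lifts_truncate[OF h, where U = "\<lambda>i. 0"])
       (auto simp: witt_ring_op_simps rhom.zero[OF h] witt_poly_zero[OF p0])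
  show "lifts p N h \<one>\<^bsub>witt_ring p N (mpoly_ring V)\<^esub> (\<lambda>m. 1)"
    by (rule lifts_truncate[OF h, where U = "\<lambda>i. if i = 0 then 1 else 0"])
       (auto simp: witt_ring_op_simps rhom.zero[OF h] rhom.one[OF h] witt_poly_one[OF p0])
qed

lemma lifts_neg_exists:
  fixes h :: "('w, int) mpoly \<Rightarrow> ('v, 'a::comm_ring_1) mpoly"
  assumes p: "Factorial_Ring.prime p" and h: "rhom h" "\<And>P. h P \<in> polys_in V"
    and "lifts p N h x g"
  shows "\<exists>y \<in> carrier (witt_ring p N (mpoly_ring V)). lifts p N h y (\<lambda>m. - g m)"
proof -
  obtain U where U: "\<forall>m<N. witt_poly p m U = g m"
    using assms(4) by (auto simp: lifts_def)
  note f = frob_lift_mpoly[OF p, where 'v = 'w]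
  then have "ghostly p (psubst of_int (\<lambda>v. indet v ^ p)) (\<lambda>m. - witt_poly p m U)"
    by (intro ghostly_uminus ghostly_witt_poly) (auto simp: frob_lift_def)
  then obtain Y where Y: "\<And>m. witt_poly p m Y = - witt_poly p m U"
    using ghost_realizable[OF p] by blast
  show ?thesis
  proof (rule bexI)
    show "lifts p N h (\<lambda>i. if i < N then h (Y i) else 0) (\<lambda>m. - g m)"
      by (rule lifts_truncate[OF h(1), where U = Y]) (auto simp: Y U)
  qed (use h(2) in \<open>auto simp: carrier_witt_ring\<close>)
qed

text \<open>
  Finitely many Witt vectors can be lifted simultaneously to Witt vectors over a polynomial ring
  over \<open>\<int>\<close>, where the ghost components determine them; so identities need only be checked for
  ghost components.
\<close>

lemma lifts_exist:
  fixes xs :: "nat \<Rightarrow> nat \<Rightarrow> ('v, 'a::comm_ring_1) mpoly"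
  assumes "\<And>c. xs c \<in> carrier (witt_ring p N (mpoly_ring V))"
  obtains h :: "(nat \<times> nat, int) mpoly \<Rightarrow> _" and g
  where "rhom h" "\<And>P. h P \<in> polys_in V" "\<And>c. lifts p N h (xs c) (g c)"
proof
  let ?h = "psubst of_int (\<lambda>(c, i). xs c i) :: (nat \<times> nat, int) mpoly \<Rightarrow> _"
  show h: "rhom ?h" by (rule rhom_psubst_int)
  show "?h P \<in> polys_in V" for P
    using assms by (intro polys_in_psubst[of _ UNIV]) (auto simp: polys_in_def[of UNIV] carrier_witt_ring)
  show "lifts p N ?h (xs c) (\<lambda>m. witt_poly p m (\<lambda>i. indet (c, i)))" for c
    using assms[of c] by (intro lifts_truncate[OF h]) (auto simp: carrier_witt_ring)
qed

lemma witt_ring_closed: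
  assumes "x \<in> carrier (witt_ring p N (mpoly_ring V))" "y \<in> carrier (witt_ring p N (mpoly_ring V))"
  shows "x \<oplus>\<^bsub>witt_ring p N (mpoly_ring V)\<^esub> y \<in> carrier (witt_ring p N (mpoly_ring V))"
    and "x \<otimes>\<^bsub>witt_ring p N (mpoly_ring V)\<^esub> y \<in> carrier (witt_ring p N (mpoly_ring V))"
proof -
  have "psubst of_int (case_sum x y) P \<in> polys_in V" for P
    using assms by (intro polys_in_psubst[of _ UNIV]) (auto simp: polys_in_def[of UNIV] carrier_witt_ring split: sum.splits)
  then show "x \<oplus>\<^bsub>witt_ring p N (mpoly_ring V)\<^esub> y \<in> carrier (witt_ring p N (mpoly_ring V))"
    and "x \<otimes>\<^bsub>witt_ring p N (mpoly_ring V)\<^esub> y \<in> carrier (witt_ring p N (mpoly_ring V))"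
    unfolding witt_ring_ops[OF assms] by (auto simp: carrier_witt_ring)
qed

text \<open>
  Both sides of an axiom have lifts with the same ghost components.
\<close>

lemma cring_witt_ring:
  assumes p: "Factorial_Ring.prime p"
  shows "cring (witt_ring p N (mpoly_ring V :: ('v, 'a::comm_ring_1) mpoly ring))"
proof -
  let ?W = "witt_ring p N (mpoly_ring V :: ('v, 'a) mpoly ring)"
  have zc: "\<zero>\<^bsub>?W\<^esub> \<in> carrier ?W" "\<one>\<^bsub>?W\<^esub> \<in> carrier ?W"
    by (auto simp: carrier_witt_ring witt_ring_op_simps)
  note rules = lifts_ops[OF p, of _ _ N V] lifts_zero_one[OF p, of _ N V] witt_ring_closed[of _ p N V] zc
  have lift: thesis if "x \<in> carrier ?W" "y \<in> carrier ?W" "z \<in> carrier ?W"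
    "\<And>(h :: (nat \<times> nat, int) mpoly \<Rightarrow> _) f g k. rhom h \<Longrightarrow> (\<And>P. h P \<in> polys_in V) \<Longrightarrow>
        lifts p N h x f \<Longrightarrow> lifts p N h y g \<Longrightarrow> lifts p N h z k \<Longrightarrow> thesis" for x y z thesis
  proof -
    define xs where "xs c = (if c = 0 then x else if c = 1 then y else z)" for c :: nat
    have "xs c \<in> carrier ?W" for c
      using that by (auto simp: xs_def)
    then obtain h :: "(nat \<times> nat, int) mpoly \<Rightarrow> _" and g
      where h: "rhom h" "\<And>P. h P \<in> polys_in V" "\<And>c. lifts p N h (xs c) (g c)"
      using lifts_exist[of xs p N V] by metis
    from h(3)[of 0] h(3)[of 1] h(3)[of 2] show thesis
      by (intro that(4)[OF h(1,2)]) (auto simp: xs_def)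
  qed
  have eq: "x = y" if "lifts p N h x f" "lifts p N h y g" "f = g"
    for h :: "(nat \<times> nat, int) mpoly \<Rightarrow> ('v, 'a) mpoly" and f g x y
    using lifts_unique[OF p] that by blast
  show ?thesis
  proof (intro cringI abelian_groupI comm_monoidI)
    fix x y z assume x: "x \<in> carrier ?W" and y: "y \<in> carrier ?W" and z: "z \<in> carrier ?W"
    note lift = lift[OF x y z]
    show "x \<oplus>\<^bsub>?W\<^esub> y \<oplus>\<^bsub>?W\<^esub> z = x \<oplus>\<^bsub>?W\<^esub> (y \<oplus>\<^bsub>?W\<^esub> z)"
      by (rule lift, rule eq, (rule rules x y z | assumption)+, simp add: add.assoc)
    show "x \<otimes>\<^bsub>?W\<^esub> y \<otimes>\<^bsub>?W\<^esub> z = x \<otimes>\<^bsub>?W\<^esub> (y \<otimes>\<^bsub>?W\<^esub> z)"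
      by (rule lift, rule eq, (rule rules x y z | assumption)+, simp add: mult.assoc)
    show "(x \<oplus>\<^bsub>?W\<^esub> y) \<otimes>\<^bsub>?W\<^esub> z = x \<otimes>\<^bsub>?W\<^esub> z \<oplus>\<^bsub>?W\<^esub> y \<otimes>\<^bsub>?W\<^esub> z"
      by (rule lift, rule eq, (rule rules x y z | assumption)+, simp add: distrib_right)
    show "x \<oplus>\<^bsub>?W\<^esub> y = y \<oplus>\<^bsub>?W\<^esub> x"
      by (rule lift, rule eq, (rule rules x y z | assumption)+, simp add: add.commute)
    show "x \<otimes>\<^bsub>?W\<^esub> y = y \<otimes>\<^bsub>?W\<^esub> x"
      by (rule lift, rule eq, (rule rules x y z | assumption)+, simp add: mult.commute)
    show "\<zero>\<^bsub>?W\<^esub> \<oplus>\<^bsub>?W\<^esub> x = x"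
      by (rule lift, rule eq, (rule rules x y z | assumption)+, simp)
    show "\<one>\<^bsub>?W\<^esub> \<otimes>\<^bsub>?W\<^esub> x = x"
      by (rule lift, rule eq, (rule rules x y z | assumption)+, simp)
    show "\<exists>y\<in>carrier ?W. y \<oplus>\<^bsub>?W\<^esub> x = \<zero>\<^bsub>?W\<^esub>"
    proof (rule lift)
      fix h :: "(nat \<times> nat, int) mpoly \<Rightarrow> _" and f
      assume h: "rhom h" "\<And>P. h P \<in> polys_in V" and l: "lifts p N h x f"
      obtain x' where x': "x' \<in> carrier ?W" "lifts p N h x' (\<lambda>m. - f m)"
        using lifts_neg_exists[OF p h l] by blast
      then have "x' \<oplus>\<^bsub>?W\<^esub> x = \<zero>\<^bsub>?W\<^esub>"
        using lifts_ops(1)[OF p h(1) x' x l] lifts_zero_one(1)[OF p h(1)] by (intro lifts_unique[OF p]) simp_all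
      with x' show ?thesis by blast
    qed
  qed (use zc witt_ring_closed[of _ p N V] in auto)
qed

lemma lifts_a_inv:
  assumes p: "Factorial_Ring.prime p" and h: "rhom h" "\<And>P. h P \<in> polys_in V"
    and x: "x \<in> carrier (witt_ring p N (mpoly_ring V))" "lifts p N h x g"
  shows "lifts p N h (\<ominus>\<^bsub>witt_ring p N (mpoly_ring V)\<^esub> x) (\<lambda>m. - g m)"
proof -
  interpret W: cring "witt_ring p N (mpoly_ring V)" by (rule cring_witt_ring[OF p])
  obtain y where y: "y \<in> carrier (witt_ring p N (mpoly_ring V))" "lifts p N h y (\<lambda>m. - g m)"
    using lifts_neg_exists[OF p h x(2)] by blast
  have "y \<oplus>\<^bsub>witt_ring p N (mpoly_ring V)\<^esub> x = \<zero>\<^bsub>witt_ring p N (mpoly_ring V)\<^esub>"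
    using lifts_ops(1)[OF p h(1) y x] lifts_zero_one(1)[OF p h(1), of N V]
    by (intro lifts_unique[OF p]) simp_all
  then have "\<ominus>\<^bsub>witt_ring p N (mpoly_ring V)\<^esub> x = y"
    by (rule W.minus_equality[OF _ x(1) y(1)])
  then show ?thesis
    using y by simp
qed

lemma lifts_finsum_finprod:
  assumes p: "Factorial_Ring.prime p" and h: "rhom h" and "finite A"
    and x: "\<And>a. a \<in> A \<Longrightarrow> x a \<in> carrier (witt_ring p N (mpoly_ring V))" "\<And>a. a \<in> A \<Longrightarrow> lifts p N h (x a) (g a)"
  shows "lifts p N h (\<Oplus>\<^bsub>witt_ring p N (mpoly_ring V)\<^esub>a\<in>A. x a) (\<lambda>m. \<Sum>a\<in>A. g a m)"
    and "lifts p N h (\<Otimes>\<^bsub>witt_ring p N (mpoly_ring V)\<^esub>a\<in>A. x a) (\<lambda>m. \<Prod>a\<in>A. g a m)"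
proof -
  interpret W: cring "witt_ring p N (mpoly_ring V)" by (rule cring_witt_ring[OF p])
  show "lifts p N h (\<Oplus>\<^bsub>witt_ring p N (mpoly_ring V)\<^esub>a\<in>A. x a) (\<lambda>m. \<Sum>a\<in>A. g a m)"
    using assms(3) x
    by (induction A rule: finite_induct)
       (auto simp: W.finsum_insert Pi_def intro!: lifts_zero_one[OF p h] lifts_ops[OF p h] W.finsum_closed)
  show "lifts p N h (\<Otimes>\<^bsub>witt_ring p N (mpoly_ring V)\<^esub>a\<in>A. x a) (\<lambda>m. \<Prod>a\<in>A. g a m)"
    using assms(3) x
    by (induction A rule: finite_induct)
       (auto simp: W.finprod_insert Pi_def intro!: lifts_zero_one[OF p h] lifts_ops[OF p h] W.finprod_closed)
qed

section \<open>The ghost components of the discriminant\<close>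

definition leibniz_det :: "nat \<Rightarrow> (nat \<Rightarrow> nat \<Rightarrow> 'a::comm_ring_1) \<Rightarrow> 'a" where
  "leibniz_det n u = (\<Sum>\<pi> | \<pi> permutes {1..n}. (if evenperm \<pi> then 1 else - 1) * (\<Prod>i\<in>{1..n}. u i (\<pi> i)))"

lemma lifts_ring_det:
  assumes p: "Factorial_Ring.prime p" and h: "rhom h" "\<And>P. h P \<in> polys_in V"
    and u: "\<And>i j. i \<in> {1..n} \<Longrightarrow> j \<in> {1..n} \<Longrightarrow> u i j \<in> carrier (witt_ring p N (mpoly_ring V))"
      "\<And>i j. i \<in> {1..n} \<Longrightarrow> j \<in> {1..n} \<Longrightarrow> lifts p N h (u i j) (\<lambda>m. g m i j)"
  shows "lifts p N h (ring_det (witt_ring p N (mpoly_ring V)) n u) (\<lambda>m. leibniz_det n (g m))"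
proof -
  let ?W = "witt_ring p N (mpoly_ring V)"
  interpret W: cring ?W by (rule cring_witt_ring[OF p])
  show ?thesis
    unfolding ring_det_def leibniz_det_def
  proof (rule lifts_finsum_finprod(1)[OF p h(1)])
    fix \<pi> assume "\<pi> \<in> {\<pi>. \<pi> permutes {1..n}}"
    then have \<pi>: "\<pi> i \<in> {1..n}" if "i \<in> {1..n}" for i
      using permutes_in_image[of \<pi> "{1..n}" i] that by simp
    have c: "(\<Otimes>\<^bsub>?W\<^esub>i\<in>{1..n}. u i (\<pi> i)) \<in> carrier ?W"
      by (intro W.finprod_closed) (use u \<pi> in auto)
    have l: "lifts p N h (\<Otimes>\<^bsub>?W\<^esub>i\<in>{1..n}. u i (\<pi> i)) (\<lambda>m. \<Prod>i\<in>{1..n}. g m i (\<pi> i))"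
      by (rule lifts_finsum_finprod(2)[OF p h(1)]) (use u \<pi> in auto)
    show "(let c = \<Otimes>\<^bsub>?W\<^esub>i\<in>{1..n}. u i (\<pi> i) in if evenperm \<pi> then c else \<ominus>\<^bsub>?W\<^esub> c) \<in> carrier ?W"
      using c by (auto simp: Let_def)
    show "lifts p N h (let c = \<Otimes>\<^bsub>?W\<^esub>i\<in>{1..n}. u i (\<pi> i) in if evenperm \<pi> then c else \<ominus>\<^bsub>?W\<^esub> c)
        (\<lambda>m. (if evenperm \<pi> then 1 else - 1) * (\<Prod>i\<in>{1..n}. g m i (\<pi> i)))"
      using l lifts_a_inv[OF p h c l] by (auto simp: Let_def)
  qed (simp add: finite_permutations)
qed

definition entry_lift :: "nat \<Rightarrow> nat \<Rightarrow> nat \<Rightarrow> nat \<Rightarrow> nat \<Rightarrow> (coord, int) mpoly" where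
  "entry_lift n r i j s = (if s \<le> n * r then indet (i, j, s) else 0)"

text \<open>
  All that is used about the \<open>\<delta>\<^sub>i\<close>: they are reductions of integer polynomials whose ghost
  components are the determinants of the ghost components of the entries.
\<close>

lemma disc_coeff_lift:
  assumes p: "Factorial_Ring.prime p"
  obtains D :: "nat \<Rightarrow> (coord, int) mpoly"
  where "\<And>m. m \<le> n * r \<Longrightarrow> witt_poly p m D = leibniz_det n (\<lambda>i j. witt_poly p m (entry_lift n r i j))"
    and "\<And>i. (disc_coeff p n r i :: (coord, 'k::field) mpoly) =
           psubst of_int (\<lambda>v. if v \<in> base_indets n r then indet v else 0) (D i)"
proof -
  let ?S = "base_indets n r"
  let ?h = "psubst of_int (\<lambda>v. if v \<in> ?S then indet v else 0) :: (coord, int) mpoly \<Rightarrow> (coord, 'k) mpoly"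
  have h: "rhom ?h" "\<And>P. ?h P \<in> polys_in ?S"
    by (rule rhom_psubst_int, rule polys_in_psubst[of _ UNIV]) (auto simp: polys_in_def[of UNIV])
  have "lifts p (n * r + 1) ?h (disc_coeff p n r) (\<lambda>m. leibniz_det n (\<lambda>i j. witt_poly p m (entry_lift n r i j)))"
    unfolding disc_coeff_def
  proof (rule lifts_ring_det[OF p h])
    fix i j assume ij: "i \<in> {1..n}" "j \<in> {1..n}"
    then have S: "(i, j, s) \<in> ?S" if "s \<le> n * r" for s
      using that by (auto simp: base_indets_def)
    show "generic_entry n r i j \<in> carrier (witt_ring p (n * r + 1) (mpoly_ring ?S :: (coord, 'k) mpoly ring))"
      using S by (auto simp: carrier_witt_ring generic_entry_def)
    show "lifts p (n * r + 1) ?h (generic_entry n r i j) (\<lambda>m. witt_poly p m (entry_lift n r i j))"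
      using S by (intro lifts_truncate[OF h(1)]) (auto simp: generic_entry_def entry_lift_def)
  qed
  then show thesis
    using that by (auto simp: lifts_def less_Suc_eq_le)
qed

section \<open>Ideals of a polynomial ring\<close>

definition ideal_in :: "'v set \<Rightarrow> ('v, 'a::comm_ring_1) mpoly set \<Rightarrow> bool" where
  "ideal_in V J \<longleftrightarrow> J \<subseteq> polys_in V \<and> 0 \<in> J \<and> (\<forall>a\<in>J. \<forall>b\<in>J. a + b \<in> J) \<and>
     (\<forall>a\<in>polys_in V. \<forall>b\<in>J. a * b \<in> J)"

definition prime_in :: "'v set \<Rightarrow> ('v, 'a::comm_ring_1) mpoly set \<Rightarrow> bool" where
  "prime_in V P \<longleftrightarrow> ideal_in V P \<and> 1 \<notin> P \<and>
     (\<forall>a\<in>polys_in V. \<forall>b\<in>polys_in V. a * b \<in> P \<longrightarrow> a \<in> P \<or> b \<in> P)"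

lemma ideal_inD:
  assumes "ideal_in V J"
  shows "a \<in> J \<Longrightarrow> a \<in> polys_in V" and "0 \<in> J" and "a \<in> J \<Longrightarrow> b \<in> J \<Longrightarrow> a + b \<in> J"
    and "a \<in> polys_in V \<Longrightarrow> b \<in> J \<Longrightarrow> a * b \<in> J" and "b \<in> polys_in V \<Longrightarrow> a \<in> J \<Longrightarrow> a * b \<in> J"
  using assms by (auto simp: ideal_in_def mult.commute)

lemma ideal_in_uminus: "ideal_in V J \<Longrightarrow> a \<in> J \<Longrightarrow> - a \<in> J"
  using ideal_inD(4)[of V J "- 1" a] by simp

lemma ideal_in_diff: "ideal_in V J \<Longrightarrow> a \<in> J \<Longrightarrow> b \<in> J \<Longrightarrow> a - b \<in> J"
  using ideal_inD(3)[of V J a "- b"] ideal_in_uminus[of V J b] by simp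

lemma ideal_in_sum: "ideal_in V J \<Longrightarrow> (\<And>i. i \<in> A \<Longrightarrow> f i \<in> J) \<Longrightarrow> sum f A \<in> J"
  by (induction A rule: infinite_finite_induct) (simp_all add: ideal_inD(2,3))

lemma ideal_iff_ideal_in: "ideal J (mpoly_ring V) \<longleftrightarrow> ideal_in V J"
proof
  assume "ideal J (mpoly_ring V)"
  then interpret ideal J "mpoly_ring V" .
  show "ideal_in V J"
    using a_subset additive_subgroup.zero_closed[OF is_additive_subgroup]
      additive_subgroup.a_closed[OF is_additive_subgroup] I_l_closed by (auto simp: ideal_in_def)
next
  assume J: "ideal_in V J"
  interpret R: cring "mpoly_ring V :: ('a, 'b) mpoly ring" by (rule cring_mpoly_ring)
  have inv: "\<ominus>\<^bsub>mpoly_ring V\<^esub> x = - x" if "x \<in> J" for x :: "('a, 'b) mpoly"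
    using mpoly_ring_a_inv[of x V] ideal_inD(1)[OF J that] by simp
  show "ideal J (mpoly_ring V)"
  proof (rule idealI[OF R.ring_axioms])
    show "subgroup J (add_monoid (mpoly_ring V))"
      using ideal_inD[OF J] ideal_in_uminus[OF J]
      by (intro R.add.subgroupI) (auto simp: inv simp flip: a_inv_def)
  qed (use ideal_inD[OF J] in auto)
qed

lemma primeideal_iff_prime_in: "primeideal P (mpoly_ring V) \<longleftrightarrow> prime_in V P"
proof
  assume "primeideal P (mpoly_ring V)"
  then interpret primeideal P "mpoly_ring V" .
  have "1 \<notin> P"
    using one_imp_carrier I_notcarr by auto
  then show "prime_in V P"
    using is_ideal I_prime by (auto simp: prime_in_def ideal_iff_ideal_in)
next
  assume P: "prime_in V P"
  then have "ideal P (mpoly_ring V)" "1 \<notin> P"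
    by (auto simp: prime_in_def ideal_iff_ideal_in)
  then show "primeideal P (mpoly_ring V)"
    using P cring_mpoly_ring[of V] polys_in_one[of V]
    by (intro primeidealI) (auto simp: prime_in_def)
qed

lemma prime_inD:
  assumes "prime_in V P"
  shows "ideal_in V P" and "1 \<notin> P"
    and "a \<in> polys_in V \<Longrightarrow> b \<in> polys_in V \<Longrightarrow> a * b \<in> P \<Longrightarrow> a \<in> P \<or> b \<in> P"
  using assms by (auto simp: prime_in_def)

lemma prime_in_power: "prime_in V P \<Longrightarrow> a \<in> polys_in V \<Longrightarrow> a ^ k \<in> P \<Longrightarrow> a \<in> P"
  by (induction k) (use prime_inD(2)[of V P] prime_inD(3)[of V P a "a ^ _"] polys_in_power[of a V] in auto)

section \<open>Weights\<close>

text \<open>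
  The grading is encoded by the substitution \<open>x\<^sub>v \<mapsto> x\<^sub>v \<tau>^(wt v)\<close>: the coefficient of \<open>\<tau>^w\<close> is
  the homogeneous component of weight \<open>w\<close>.
\<close>

definition wgrade :: "('v \<Rightarrow> nat) \<Rightarrow> ('v, 'a::comm_ring_1) mpoly \<Rightarrow> ('v, 'a) mpoly poly" where
  "wgrade wt = psubst (\<lambda>c. [:const c:]) (\<lambda>v. Polynomial.monom (indet v) (wt v))"

definition homog :: "('v \<Rightarrow> nat) \<Rightarrow> nat \<Rightarrow> ('v, 'a::comm_ring_1) mpoly \<Rightarrow> bool" where
  "homog wt w f \<longleftrightarrow> wgrade wt f = Polynomial.monom f w"

abbreviation wcomp :: "('v \<Rightarrow> nat) \<Rightarrow> nat \<Rightarrow> ('v, 'a::comm_ring_1) mpoly \<Rightarrow> ('v, 'a) mpoly" where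
  "wcomp wt w f \<equiv> Polynomial.coeff (wgrade wt f) w"

definition mwt :: "('v \<Rightarrow> nat) \<Rightarrow> ('v \<Rightarrow>\<^sub>0 nat) \<Rightarrow> nat" where
  "mwt wt m = (\<Sum>v\<in>keys m. wt v * lookup m v)"

lemma rhom_pCons_const: "rhom (\<lambda>c. [:const c:])"
  by unfold_locales (auto simp: rhom.add[OF rhom_const] rhom.mult[OF rhom_const] rhom.one[OF rhom_const])

lemma rhom_wgrade: "rhom (wgrade wt)"
  unfolding wgrade_def by (rule rhom_psubst[OF rhom_pCons_const])

lemma wgrade_single: "wgrade wt (single m c) = Polynomial.monom (single m c) (mwt wt m)"
proof -
  have "finite A \<Longrightarrow> (\<Prod>v\<in>A. Polynomial.monom (indet v :: ('a, 'b) mpoly) (wt v) ^ lookup m v) =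
      Polynomial.monom (\<Prod>v\<in>A. indet v ^ lookup m v) (\<Sum>v\<in>A. wt v * lookup m v)" for A
    by (induction A rule: finite_induct) (auto simp: monom_power mult_monom)
  then have "wgrade wt (single m c) = [:const c:] * Polynomial.monom (mon indet m) (mwt wt m)"
    by (simp add: wgrade_def psubst_single[OF rhom_pCons_const] mon_def mwt_def)
  then show ?thesis
    by (simp add: single_eq_mon smult_monom)
qed

lemma homog_single: "homog wt (mwt wt m) (single m c)"
  by (simp add: homog_def wgrade_single)

lemma homog_indet: "homog wt (wt v) (indet v)"
  by (simp add: homog_def wgrade_def psubst_indet[OF rhom_pCons_const])

lemma homog_zero [simp]: "homog wt w 0"
  by (simp add: homog_def rhom.zero[OF rhom_wgrade])

lemma homog_one [simp]: "homog wt 0 1"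
  by (simp add: homog_def rhom.one[OF rhom_wgrade] one_pCons monom_0)

lemma homog_of_nat [simp]: "homog wt 0 (of_nat k)"
  by (simp add: homog_def rhom.of_nat[OF rhom_wgrade] of_nat_poly monom_0)

lemma homog_add: "homog wt w f \<Longrightarrow> homog wt w g \<Longrightarrow> homog wt w (f + g)"
  by (simp add: homog_def rhom.add[OF rhom_wgrade] add_monom)

lemma homog_uminus: "homog wt w f \<Longrightarrow> homog wt w (- f)"
  by (simp add: homog_def rhom.uminus[OF rhom_wgrade] minus_monom)

lemma homog_diff: "homog wt w f \<Longrightarrow> homog wt w g \<Longrightarrow> homog wt w (f - g)"
  by (simp add: homog_def rhom.diff[OF rhom_wgrade] diff_monom)

lemma homog_mult: "homog wt w f \<Longrightarrow> homog wt w' g \<Longrightarrow> homog wt (w + w') (f * g)"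
  by (simp add: homog_def rhom.mult[OF rhom_wgrade] mult_monom)

lemma homog_power: "homog wt w f \<Longrightarrow> homog wt (w * k) (f ^ k)"
  by (simp add: homog_def rhom.power[OF rhom_wgrade] monom_power)

lemma homog_sum: "(\<And>i. i \<in> A \<Longrightarrow> homog wt w (f i)) \<Longrightarrow> homog wt w (sum f A)"
  by (induction A rule: infinite_finite_induct) (auto intro: homog_add)

lemma homog_prod:
  "finite A \<Longrightarrow> (\<And>i. i \<in> A \<Longrightarrow> homog wt (w i) (f i)) \<Longrightarrow> homog wt (sum w A) (prod f A)"
  by (induction A rule: finite_induct) (auto intro: homog_mult)

lemma wcomp_eq:
  "wcomp wt w f = (\<Sum>m\<in>keys f. if mwt wt m = w then single m (lookup f m) else 0)"
proof -
  have "wgrade wt f = (\<Sum>m\<in>keys f. wgrade wt (single m (lookup f m)))"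
    by (simp add: single_sum_expansion[symmetric] flip: rhom.sum[OF rhom_wgrade])
  then show ?thesis
    by (simp add: wgrade_single coeff_sum)
qed

lemma homog_wcomp: "homog wt w (wcomp wt w f)"
  unfolding wcomp_eq by (rule homog_sum) (auto intro: homog_single)

lemma wcomp_homog: "homog wt w f \<Longrightarrow> wcomp wt w f = f"
  by (simp add: homog_def)

lemma polys_in_wcomp: "f \<in> polys_in V \<Longrightarrow> wcomp wt w f \<in> polys_in V"
  unfolding wcomp_eq by (intro polys_in_sum) (auto simp: polys_in_def)

lemma sum_wcomp: "(\<Sum>w\<le>Polynomial.degree (wgrade wt f). wcomp wt w f) = f"
proof -
  have "rhom (\<lambda>q. poly q (1 :: ('a, 'b) mpoly))"
    by unfold_locales auto
  then have "poly (wgrade wt f) 1 = f"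
    by (intro rhom_eqI[of "\<lambda>f. poly (wgrade wt f) 1" "\<lambda>x. x" f UNIV, OF rhom_compose[OF rhom_wgrade]])
       (auto simp: rhom_def polys_in_def wgrade_def psubst_const[OF rhom_pCons_const]
          psubst_indet[OF rhom_pCons_const] poly_monom)
  then show ?thesis
    by (simp add: poly_altdef)
qed

lemma wcomp_mult_homog:
  assumes "homog wt w f"
  shows "wcomp wt k (f * g) = (if w \<le> k then f * wcomp wt (k - w) g else 0)"
  using assms by (simp add: homog_def rhom.mult[OF rhom_wgrade] coeff_monom_mult)

text \<open>
  A homogeneous polynomial has only monomials of its weight, and substitution preserves the
  weight of each.
\<close>

lemma psubst_homog:
  assumes "homog wt w f" "f \<in> polys_in V" "rhom h" "\<And>c. homog wt' 0 (h c)"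
    and "\<And>v. v \<in> V \<Longrightarrow> homog wt' (wt v) (x v)"
  shows "homog wt' w (psubst h x f)"
proof -
  have "mwt wt m = w" if "m \<in> keys f" for m
  proof (rule ccontr)
    assume "mwt wt m \<noteq> w"
    then have "lookup (wcomp wt w f) m = 0"
      unfolding wcomp_eq lookup_sum by (intro sum.neutral) (auto simp: lookup_single when_def)
    then show False
      using that wcomp_homog[OF assms(1)] by (simp add: in_keys_iff)
  qed
  moreover have "homog wt' (mwt wt m) (mon x m)" if "m \<in> keys f" for m
    unfolding mon_def mwt_def using that assms(2,5)
    by (intro homog_prod homog_power) (auto simp: polys_in_def)
  ultimately show ?thesis
    unfolding psubst_def using homog_mult[OF assms(4)]
    by (intro homog_sum) force
qed

section \<open>Independence modulo an ideal and counting\<close>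

interpretation mpv: vector_space "\<lambda>c f. const c * f :: ('v, 'a::field) mpoly"
  by unfold_locales (auto simp: algebra_simps rhom.add[OF rhom_const] rhom.mult[OF rhom_const] rhom.one[OF rhom_const])

lemma subspace_ideal_in: "ideal_in V J \<Longrightarrow> mpv.subspace J"
  by (auto simp: mpv.subspace_def ideal_inD)

text \<open>
  A dimension count in the quotient by \<open>P\<close>.  The vectors \<open>F a\<close> may coincide modulo \<open>P\<close>, and then
  their difference is the required combination.
\<close>

lemma dependent_mod_subspace:
  fixes F :: "'i \<Rightarrow> ('v, 'a::field) mpoly"
  assumes P: "mpv.subspace P" and "finite G" "finite A" "card A > card G"
    and F: "\<And>a. a \<in> A \<Longrightarrow> F a \<in> mpv.span (P \<union> G)"
  obtains c where "\<exists>a\<in>A. c a \<noteq> 0" "(\<Sum>a\<in>A. const (c a) * F a) \<in> P"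
proof -
  have "\<exists>g. g \<in> mpv.span G \<and> F a - g \<in> P" if "a \<in> A" for a
  proof -
    from F[OF that] obtain x g where "F a = x + g" "x \<in> P" "g \<in> mpv.span G"
      unfolding mpv.span_Un using mpv.span_eq_iff[THEN iffD2, OF P] by auto
    then show ?thesis by (intro exI[of _ g]) auto
  qed
  then obtain g where g: "\<And>a. a \<in> A \<Longrightarrow> g a \<in> mpv.span G" "\<And>a. a \<in> A \<Longrightarrow> F a - g a \<in> P"
    by metis
  have "\<exists>c. (\<exists>a\<in>A. c a \<noteq> 0) \<and> (\<Sum>a\<in>A. const (c a) * g a) = 0"
  proof (cases "inj_on g A")
    case False
    then obtain a b where ab: "a \<in> A" "b \<in> A" "a \<noteq> b" "g a = g b"
      by (auto simp: inj_on_def)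
    let ?c = "\<lambda>i. if i = a then 1 else if i = b then - 1 else (0 :: 'a)"
    have "(\<Sum>i\<in>A. const (?c i) * g i) = (\<Sum>i\<in>{a, b}. const (?c i) * g i)"
      using assms(3) ab by (intro sum.mono_neutral_right) (auto simp: rhom.zero[OF rhom_const])
    also have "\<dots> = 0"
      using ab by (simp add: rhom.one[OF rhom_const] rhom.uminus[OF rhom_const])
    finally show ?thesis
      using ab by (intro exI[of _ ?c]) auto
  next
    case True
    have "mpv.dependent (g ` A)"
    proof (rule ccontr)
      assume "mpv.independent (g ` A)"
      then have "card (g ` A) \<le> card G"
        using mpv.independent_span_bound[OF assms(2), of "g ` A"] g(1) by auto
      then show False
        using card_image[OF True] assms(4) by simp
    qed
    then obtain u where u: "\<exists>v\<in>g ` A. u v \<noteq> 0" "(\<Sum>v\<in>g ` A. const (u v) * v) = 0"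
      using mpv.dependent_finite[of "g ` A"] assms(3) by auto
    then show ?thesis
      using True by (intro exI[of _ "u \<circ> g"]) (auto simp: sum.reindex)
  qed
  then obtain c where c: "\<exists>a\<in>A. c a \<noteq> 0" "(\<Sum>a\<in>A. const (c a) * g a) = 0"
    by blast
  have "(\<Sum>a\<in>A. const (c a) * F a) = (\<Sum>a\<in>A. const (c a) * (F a - g a))"
    using c(2) by (simp add: right_diff_distrib sum_subtractf)
  also have "\<dots> \<in> P"
    using g(2) by (intro mpv.subspace_sum[OF P] mpv.subspace_scale[OF P])
  finally show thesis
    using that c(1) by blast
qed

fun lmon :: "'b::comm_ring_1 list \<Rightarrow> nat list \<Rightarrow> 'b" where
  "lmon (f # fs) (a # as) = f ^ a * lmon fs as"
| "lmon _ _ = 1"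

text \<open>
  Linear independence of the monomials in \<open>fs\<close> modulo \<open>P\<close>; for an ideal \<open>P\<close> this is
  algebraic independence of \<open>fs\<close> modulo \<open>P\<close>.
\<close>

definition mono_indep :: "('v, 'a::field) mpoly set \<Rightarrow> ('v, 'a) mpoly list \<Rightarrow> bool" where
  "mono_indep P fs \<longleftrightarrow> (\<forall>A c. finite A \<longrightarrow> (\<forall>\<alpha>\<in>A. length \<alpha> = length fs) \<longrightarrow>
     (\<Sum>\<alpha>\<in>A. const (c \<alpha>) * lmon fs \<alpha>) \<in> P \<longrightarrow> (\<forall>\<alpha>\<in>A. c \<alpha> = 0))"

lemma polys_in_lmon: "set fs \<subseteq> polys_in V \<Longrightarrow> lmon fs \<alpha> \<in> polys_in V"
  by (induction fs \<alpha> rule: lmon.induct) auto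

text \<open>
  The list picks one element from each step \<open>P\<^bsub>i+1\<^esub> - P\<^sub>i\<close> of a chain of primes that starts with \<open>P\<close>.
\<close>

fun chain_witnesses :: "'v set \<Rightarrow> ('v, 'a::field) mpoly set \<Rightarrow> ('v, 'a) mpoly list \<Rightarrow> bool" where
  "chain_witnesses V P [] \<longleftrightarrow> prime_in V P"
| "chain_witnesses V P (f # fs) \<longleftrightarrow> prime_in V P \<and> f \<in> polys_in V \<and> f \<notin> P \<and>
     (\<exists>Q. P \<subseteq> Q \<and> f \<in> Q \<and> chain_witnesses V Q fs)"

lemma chain_witnesses_prime: "chain_witnesses V P fs \<Longrightarrow> prime_in V P"
  by (cases fs) auto

lemma chain_witnesses_polys: "chain_witnesses V P fs \<Longrightarrow> set fs \<subseteq> polys_in V"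
  by (induction fs arbitrary: P) auto

text \<open>
  In a relation modulo \<open>P\<close> the lowest power of the first witness \<open>f\<close> can be cancelled, because \<open>P\<close>
  is prime and \<open>f \<notin> P\<close>.  Modulo the next prime, which contains \<open>f\<close>, only the terms with that
  lowest power survive, and they form a relation between the remaining witnesses.
\<close>

lemma chain_witnesses_indep:
  "chain_witnesses V P fs \<Longrightarrow> mono_indep P fs"
proof (induction fs arbitrary: P)
  case Nil
  then have P: "ideal_in V P" "1 \<notin> P" by (auto dest: prime_inD)
  show ?case
    unfolding mono_indep_def
  proof (intro allI impI ballI)
    fix A c \<alpha> assume A: "finite A" "\<forall>\<alpha>\<in>A. length \<alpha> = length []" "\<alpha> \<in> A"
      and s: "(\<Sum>\<alpha>\<in>A. const (c \<alpha>) * lmon [] \<alpha>) \<in> P"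
    then have "A = {[]}" "\<alpha> = []" by auto
    with s have c: "const (c []) \<in> P" by simp
    show "c \<alpha> = 0"
    proof (rule ccontr)
      assume "c \<alpha> \<noteq> 0"
      then have "const (inverse (c [])) * const (c []) = (1 :: ('a, 'b) mpoly)"
        using \<open>\<alpha> = []\<close> by (simp flip: rhom.mult[OF rhom_const] add: rhom.one[OF rhom_const])
      moreover have "const (inverse (c [])) * const (c []) \<in> P"
        using c P by (intro ideal_inD(4)[OF P(1)]) auto
      ultimately show False using P by simp
    qed
  qed
next
  case (Cons f fs)
  then obtain Q where P: "prime_in V P" and f: "f \<in> polys_in V" "f \<notin> P" "f \<in> Q"
    and Q: "P \<subseteq> Q" "chain_witnesses V Q fs" by auto
  have IH: "mono_indep Q fs" by (rule Cons.IH[OF Q(2)])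
  have Qi: "ideal_in V Q" using chain_witnesses_prime[OF Q(2)] by (rule prime_inD)
  have fs: "set fs \<subseteq> polys_in V" by (rule chain_witnesses_polys[OF Q(2)])
  show ?case
    unfolding mono_indep_def
  proof (intro allI impI, rule ccontr)
    fix A c assume A: "finite A" "\<forall>\<alpha>\<in>A. length \<alpha> = length (f # fs)"
      and s: "(\<Sum>\<alpha>\<in>A. const (c \<alpha>) * lmon (f # fs) \<alpha>) \<in> P" and n: "\<not> (\<forall>\<alpha>\<in>A. c \<alpha> = 0)"
    define B where "B = {\<alpha>\<in>A. c \<alpha> \<noteq> 0}"
    \<comment> \<open>The lowest exponent of \<open>f\<close> in the relation.\<close>
    define k where "k = Min (hd ` B)"
    have B: "finite B" "B \<noteq> {}" "B \<subseteq> A"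
      using A n by (auto simp: B_def)
    have kmin: "k \<le> hd \<alpha>" if "\<alpha> \<in> B" for \<alpha>
      using B that by (simp add: k_def)
    have "k \<in> hd ` B"
      unfolding k_def using B by (intro Min_in) auto
    then obtain \<alpha>0 where \<alpha>0: "\<alpha>0 \<in> B" "hd \<alpha>0 = k" by auto
    have dec: "\<alpha> = hd \<alpha> # tl \<alpha>" "length (tl \<alpha>) = length fs" if "\<alpha> \<in> A" for \<alpha>
      using A(2) that by (cases \<alpha>; auto)+
    let ?t = "\<lambda>\<alpha>. const (c \<alpha>) * (f ^ (hd \<alpha> - k) * lmon fs (tl \<alpha>))"
    have t: "?t \<alpha> \<in> polys_in V" for \<alpha>
      using f polys_in_lmon[OF fs] by auto
    have "(\<Sum>\<alpha>\<in>A. const (c \<alpha>) * lmon (f # fs) \<alpha>) = (\<Sum>\<alpha>\<in>B. const (c \<alpha>) * lmon (f # fs) \<alpha>)"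
      using A by (intro sum.mono_neutral_right) (auto simp: B_def rhom.zero[OF rhom_const])
    also have "\<dots> = (\<Sum>\<alpha>\<in>B. f ^ k * ?t \<alpha>)"
    proof (rule sum.cong[OF refl])
      fix \<alpha> assume "\<alpha> \<in> B"
      then have "lmon (f # fs) \<alpha> = f ^ (k + (hd \<alpha> - k)) * lmon fs (tl \<alpha>)"
        using dec[of \<alpha>] kmin[of \<alpha>] B by (metis le_add_diff_inverse lmon.simps(1) subsetD)
      then show "const (c \<alpha>) * lmon (f # fs) \<alpha> = f ^ k * ?t \<alpha>"
        by (simp add: power_add mult_ac)
    qed
    finally have "f ^ k * (\<Sum>\<alpha>\<in>B. ?t \<alpha>) \<in> P"
      using s by (simp add: sum_distrib_left)
    then have "(\<Sum>\<alpha>\<in>B. ?t \<alpha>) \<in> P"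
      using prime_inD(3)[OF P, of "f ^ k" "\<Sum>\<alpha>\<in>B. ?t \<alpha>"] prime_in_power[OF P f(1)] f t by auto
    then have Bsum: "(\<Sum>\<alpha>\<in>B. ?t \<alpha>) \<in> Q"
      using Q by auto
    let ?B0 = "{\<alpha>\<in>B. hd \<alpha> = k}"
    have rest: "(\<Sum>\<alpha>\<in>B - ?B0. ?t \<alpha>) \<in> Q"
    proof (rule ideal_in_sum[OF Qi])
      fix \<alpha> assume "\<alpha> \<in> B - ?B0"
      then have "hd \<alpha> - k = Suc (hd \<alpha> - k - 1)"
        using kmin[of \<alpha>] by auto
      then have "?t \<alpha> = (const (c \<alpha>) * (f ^ (hd \<alpha> - k - 1) * lmon fs (tl \<alpha>))) * f"
        by (metis (no_types, lifting) mult.assoc mult.commute power_Suc2)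
      then show "?t \<alpha> \<in> Q"
        using f polys_in_lmon[OF fs] by (simp only:) (intro ideal_inD(4)[OF Qi], auto)
    qed
    have "(\<Sum>\<alpha>\<in>B. ?t \<alpha>) - (\<Sum>\<alpha>\<in>B - ?B0. ?t \<alpha>) = (\<Sum>\<alpha>\<in>?B0. ?t \<alpha>)"
      using sum.subset_diff[of ?B0 B ?t] B(1) by simp
    then have "(\<Sum>\<alpha>\<in>?B0. ?t \<alpha>) \<in> Q"
      using ideal_in_diff[OF Qi Bsum rest] by (simp only:)
    moreover have "(\<Sum>\<alpha>\<in>?B0. ?t \<alpha>) = (\<Sum>\<beta>\<in>tl ` ?B0. const (c (k # \<beta>)) * lmon fs \<beta>)"
    proof -
      have hd_tl: "\<alpha> = k # tl \<alpha>" if "\<alpha> \<in> ?B0" for \<alpha>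
        using dec(1)[of \<alpha>] B(3) that by auto
      have "inj_on tl ?B0"
        by (rule inj_onI) (metis hd_tl)
      then have "(\<Sum>\<beta>\<in>tl ` ?B0. const (c (k # \<beta>)) * lmon fs \<beta>) =
          (\<Sum>\<alpha>\<in>?B0. const (c (k # tl \<alpha>)) * lmon fs (tl \<alpha>))"
        by (simp add: sum.reindex)
      also have "\<dots> = (\<Sum>\<alpha>\<in>?B0. ?t \<alpha>)"
      proof (rule sum.cong[OF refl])
        fix \<alpha> assume \<alpha>: "\<alpha> \<in> ?B0"
        then have "c (k # tl \<alpha>) = c \<alpha>"
          using hd_tl[OF \<alpha>] by simp
        with \<alpha> show "const (c (k # tl \<alpha>)) * lmon fs (tl \<alpha>) = ?t \<alpha>"
          by simp
      qed
      finally show ?thesis by simp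
    qed
    ultimately have "(\<Sum>\<beta>\<in>tl ` ?B0. const (c (k # \<beta>)) * lmon fs \<beta>) \<in> Q" by simp
    moreover have "finite (tl ` ?B0)" "\<forall>\<beta>\<in>tl ` ?B0. length \<beta> = length fs"
      using B dec(2) by auto
    moreover have "tl \<alpha>0 \<in> tl ` ?B0"
      using \<alpha>0 by auto
    ultimately have "c (k # tl \<alpha>0) = 0"
      using IH[unfolded mono_indep_def, rule_format, of "tl ` ?B0" "\<lambda>\<beta>. c (k # \<beta>)"] by blast
    moreover have "\<alpha>0 = k # tl \<alpha>0"
      using dec(1)[of \<alpha>0] \<alpha>0 B by auto
    ultimately show False
      using \<alpha>0(1) by (simp add: B_def)
  qed
qed

text \<open>
  Distinct monomials in \<open>ts\<close> are linearly independent in \<open>k[ts]\<close>, which meets \<open>P\<close> in \<open>0\<close> only.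
\<close>

lemma indets_indep:
  fixes P :: "('v, 'a::field) mpoly set"
  assumes "distinct ts" "P \<inter> polys_in (set ts) \<subseteq> {0}"
  shows "mono_indep P (map indet ts)"
proof -
  define M :: "'v list \<Rightarrow> nat list \<Rightarrow> 'v \<Rightarrow>\<^sub>0 nat" where
    "M = (\<lambda>ts \<alpha>. \<Sum>(t, a)\<leftarrow>zip ts \<alpha>. single t a)"
  have M: "lmon (map indet ts) \<alpha> = (single (M ts \<alpha>) 1 :: ('v, 'a) mpoly)" if "length \<alpha> = length ts" for ts and \<alpha>
    using that[symmetric]
  proof (induction ts \<alpha> rule: list_induct2)
    case (Cons t ts a \<alpha>)
    have "indet t ^ a = (single (single t a) 1 :: ('v, 'a) mpoly)"
      using mon_indet[of "single t a"] by (simp add: mon_single)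
    then show ?case
      using Cons by (simp add: M_def mult_single)
  qed (simp add: M_def)
  have keys: "lookup (M ts \<alpha>) t = 0" if "length \<alpha> = length ts" "t \<notin> set ts" for t ts \<alpha>
    using that(1)[symmetric] that(2)
    by (induction ts \<alpha> rule: list_induct2) (auto simp: M_def lookup_add lookup_single_not_eq)
  have inj: "\<alpha> = \<beta>" if "M ts \<alpha> = M ts \<beta>" "length \<alpha> = length ts" "length \<beta> = length ts" "distinct ts" for ts \<alpha> \<beta>
    using that
  proof (induction ts arbitrary: \<alpha> \<beta>)
    case (Cons t ts)
    obtain a \<alpha>' b \<beta>' where ab: "\<alpha> = a # \<alpha>'" "\<beta> = b # \<beta>'"
      using Cons.prems by (cases \<alpha>; cases \<beta>) auto
    have eq: "single t a + M ts \<alpha>' = single t b + M ts \<beta>'"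
      using Cons.prems(1) by (simp add: ab M_def)
    have "a = b"
      using arg_cong[OF eq, of "\<lambda>m. lookup m t"] Cons.prems keys[of \<alpha>' ts t] keys[of \<beta>' ts t]
      by (simp add: ab lookup_add)
    then show ?case
      using eq Cons by (auto simp: ab)
  qed simp
  show ?thesis
    unfolding mono_indep_def
  proof (intro allI impI ballI)
    fix A c \<alpha>
    assume A: "finite A" "\<forall>\<alpha>\<in>A. length \<alpha> = length (map indet ts)" "\<alpha> \<in> A"
      and s: "(\<Sum>\<alpha>\<in>A. const (c \<alpha>) * lmon (map indet ts) \<alpha>) \<in> P"
    have "(\<Sum>\<alpha>\<in>A. const (c \<alpha>) * lmon (map indet ts) \<alpha>) \<in> polys_in (set ts)"
      by (intro polys_in_sum polys_in_mult polys_in_lmon) auto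
    with s assms(2) have "(\<Sum>\<beta>\<in>A. const (c \<beta>) * lmon (map indet ts) \<beta>) = 0"
      by auto
    then have "0 = lookup (\<Sum>\<beta>\<in>A. const (c \<beta>) * lmon (map indet ts) \<beta>) (M ts \<alpha>)"
      by simp
    also have "\<dots> = (\<Sum>\<beta>\<in>A. if \<beta> = \<alpha> then c \<beta> else 0)"
      unfolding lookup_sum
    proof (rule sum.cong[OF refl])
      fix \<beta> assume "\<beta> \<in> A"
      then have "const (c \<beta>) * lmon (map indet ts) \<beta> = single (M ts \<beta>) (c \<beta>)"
        using A M[of \<beta> ts] by (simp add: const_def mult_single)
      then show "lookup (const (c \<beta>) * lmon (map indet ts) \<beta>) (M ts \<alpha>) = (if \<beta> = \<alpha> then c \<beta> else 0)"
        using inj[of ts \<beta> \<alpha>] A \<open>\<beta> \<in> A\<close> assms(1) by (auto simp: lookup_single when_def)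
    qed
    finally show "c \<alpha> = 0"
      using A by simp
  qed
qed

section \<open>Homogeneous systems of parameters\<close>

definition comb_in :: "'v set \<Rightarrow> 'i set \<Rightarrow> ('i \<Rightarrow> ('v, 'a::comm_ring_1) mpoly) \<Rightarrow> ('v, 'a) mpoly set" where
  "comb_in V I \<delta> = {\<Sum>i\<in>I. \<delta> i * g i | g. \<forall>i\<in>I. g i \<in> polys_in V}"

definition sum_ideal :: "('v, 'a::comm_ring_1) mpoly set \<Rightarrow> ('v, 'a) mpoly set \<Rightarrow> ('v, 'a) mpoly set" where
  "sum_ideal J K = {a + b | a b. a \<in> J \<and> b \<in> K}"

lemma ideal_in_comb_in:
  fixes \<delta> :: "'i \<Rightarrow> ('v, 'a::comm_ring_1) mpoly"
  assumes "\<And>i. i \<in> I \<Longrightarrow> \<delta> i \<in> polys_in V"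
  shows "ideal_in V (comb_in V I \<delta>)"
  unfolding ideal_in_def
proof (intro conjI ballI)
  show "comb_in V I \<delta> \<subseteq> polys_in V"
    using assms by (auto simp: comb_in_def)
  show "0 \<in> comb_in V I \<delta>"
    unfolding comb_in_def by (intro CollectI exI[of _ "\<lambda>_. 0"]) auto
next
  fix a b assume "a \<in> comb_in V I \<delta>" "b \<in> comb_in V I \<delta>"
  then obtain g h where "a = (\<Sum>i\<in>I. \<delta> i * g i)" "b = (\<Sum>i\<in>I. \<delta> i * h i)"
    "\<forall>i\<in>I. g i \<in> polys_in V" "\<forall>i\<in>I. h i \<in> polys_in V"
    by (auto simp: comb_in_def)
  then show "a + b \<in> comb_in V I \<delta>"
    unfolding comb_in_def by (intro CollectI exI[of _ "\<lambda>i. g i + h i"]) (auto simp: sum.distrib distrib_left)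
next
  fix a b :: "('v, 'a) mpoly" assume a: "a \<in> polys_in V" and "b \<in> comb_in V I \<delta>"
  then obtain h where "b = (\<Sum>i\<in>I. \<delta> i * h i)" "\<forall>i\<in>I. h i \<in> polys_in V"
    by (auto simp: comb_in_def)
  then show "a * b \<in> comb_in V I \<delta>"
    unfolding comb_in_def using a
    by (intro CollectI exI[of _ "\<lambda>i. a * h i"]) (auto simp: sum_distrib_left mult_ac)
qed

lemma generator_in_comb_in: "finite I \<Longrightarrow> i \<in> I \<Longrightarrow> \<delta> i \<in> comb_in V I \<delta>"
  unfolding comb_in_def
  by (intro CollectI exI[of _ "\<lambda>j. if j = i then 1 else 0"]) (auto simp: if_distrib cong: if_cong)

lemma ideal_in_sum_ideal:
  fixes J K :: "('v, 'a::comm_ring_1) mpoly set"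
  assumes "ideal_in V J" "ideal_in V K"
  shows "ideal_in V (sum_ideal J K)"
  unfolding ideal_in_def
proof (intro conjI ballI)
  show "sum_ideal J K \<subseteq> polys_in V"
    using ideal_inD(1)[OF assms(1)] ideal_inD(1)[OF assms(2)] by (auto simp: sum_ideal_def)
  show "0 \<in> sum_ideal J K"
    using ideal_inD(2)[OF assms(1)] ideal_inD(2)[OF assms(2)]
    unfolding sum_ideal_def by (intro CollectI exI[of _ 0]) auto
next
  fix a b assume "a \<in> sum_ideal J K" "b \<in> sum_ideal J K"
  then obtain a1 a2 b1 b2 where "a = a1 + a2" "b = b1 + b2" "a1 \<in> J" "b1 \<in> J" "a2 \<in> K" "b2 \<in> K"
    by (auto simp: sum_ideal_def)
  then show "a + b \<in> sum_ideal J K"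
    unfolding sum_ideal_def
    by (intro CollectI exI[of _ "a1 + b1"] exI[of _ "a2 + b2"])
       (auto simp: algebra_simps ideal_inD(3)[OF assms(1)] ideal_inD(3)[OF assms(2)])
next
  fix a b :: "('v, 'a) mpoly" assume a: "a \<in> polys_in V" and "b \<in> sum_ideal J K"
  then obtain b1 b2 where "b = b1 + b2" "b1 \<in> J" "b2 \<in> K"
    by (auto simp: sum_ideal_def)
  then show "a * b \<in> sum_ideal J K"
    unfolding sum_ideal_def using a
    by (intro CollectI exI[of _ "a * b1"] exI[of _ "a * b2"])
       (auto simp: algebra_simps ideal_inD(4)[OF assms(1)] ideal_inD(4)[OF assms(2)])
qed

lemma sum_ideal_left: "ideal_in V K \<Longrightarrow> a \<in> J \<Longrightarrow> a \<in> sum_ideal J K"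
  and sum_ideal_right: "ideal_in V J \<Longrightarrow> b \<in> K \<Longrightarrow> b \<in> sum_ideal J K"
  unfolding sum_ideal_def by (force dest: ideal_inD(2))+

lemma finite_bounded_monomials:
  assumes "finite V"
  shows "finite {m. keys m \<subseteq> V \<and> (\<forall>v\<in>V. lookup m v < (E::nat))}" (is "finite ?M")
proof (rule finite_imageD)
  let ?r = "\<lambda>m. restrict (lookup m) V"
  have "?r ` ?M \<subseteq> V \<rightarrow>\<^sub>E {..<E}"
    by auto
  then show "finite (?r ` ?M)"
    by (rule finite_subset) (use assms in \<open>auto intro: finite_PiE\<close>)
  show "inj_on ?r ?M"
  proof (rule inj_onI)
    fix m m' assume m: "m \<in> ?M" "m' \<in> ?M" and eq: "?r m = ?r m'"
    show "m = m'"
    proof (rule poly_mapping_eqI)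
      fix v
      show "lookup m v = lookup m' v"
      proof (cases "v \<in> V")
        case True
        then show ?thesis using fun_cong[OF eq, of v] by simp
      next
        case False
        then have "v \<notin> keys m" "v \<notin> keys m'" using m by auto
        then show ?thesis by (simp add: in_keys_iff)
      qed
    qed
  qed
qed

text \<open>
  The last assumption says that the homogeneous elements \<open>\<delta>\<^sub>i\<close> and \<open>\<theta>\<^sub>j\<close> cut out only the origin.  If there
  are as many of them as indeterminates, they are a homogeneous system of parameters.
\<close>

locale graded_system =
  fixes V :: "'v set" and wt :: "'v \<Rightarrow> nat"
    and I :: "'i set" and \<delta> :: "'i \<Rightarrow> ('v, 'a::field) mpoly" and e :: "'i \<Rightarrow> nat"
    and L :: "'j set" and \<theta> :: "'j \<Rightarrow> ('v, 'a) mpoly" and d :: "'j \<Rightarrow> nat"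
  assumes finite_V: "finite V" and wt_pos: "v \<in> V \<Longrightarrow> wt v > 0"
    and finite_I: "finite I" and \<delta>_in: "i \<in> I \<Longrightarrow> \<delta> i \<in> polys_in V" and \<delta>_homog: "i \<in> I \<Longrightarrow> homog wt (e i) (\<delta> i)"
    and finite_L: "finite L" and \<theta>_in: "j \<in> L \<Longrightarrow> \<theta> j \<in> polys_in V" and \<theta>_homog: "j \<in> L \<Longrightarrow> homog wt (d j) (\<theta> j)"
    and d_pos: "j \<in> L \<Longrightarrow> d j > 0"
    and nilpotent: "v \<in> V \<Longrightarrow> \<exists>k. indet v ^ k \<in> sum_ideal (comb_in V I \<delta>) (comb_in V L \<theta>)"
begin

abbreviation "J \<equiv> sum_ideal (comb_in V I \<delta>) (comb_in V L \<theta>)"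

lemma ideal_J: "ideal_in V J"
  by (intro ideal_in_sum_ideal ideal_in_comb_in \<delta>_in \<theta>_in)

text \<open>
  A monomial of large weight contains a high power of some indeterminate.
\<close>

lemma monomial_bound:
  obtains E where "\<And>m. keys m \<subseteq> V \<Longrightarrow> E \<le> mwt wt m \<Longrightarrow> single m 1 \<in> J" "E > 0"
proof -
  obtain k where k: "\<And>v. v \<in> V \<Longrightarrow> indet v ^ k v \<in> J"
    using nilpotent by metis
  show thesis
  proof (rule that)
    fix m assume m: "keys m \<subseteq> V" and E: "(\<Sum>v\<in>V. wt v * k v) + 1 \<le> mwt wt m"
    have "mwt wt m = (\<Sum>v\<in>V. wt v * lookup m v)"
      unfolding mwt_def using m finite_V by (intro sum.mono_neutral_left) (auto simp: in_keys_iff)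
    then have "\<exists>v\<in>V. k v < lookup m v"
      using E sum_mono[of V "\<lambda>v. wt v * lookup m v" "\<lambda>v. wt v * k v"]
      by (metis add.commute le_trans mult_le_mono2 not_less not_less_eq_eq plus_1_eq_Suc)
    then obtain v where v: "v \<in> V" "k v < lookup m v" by blast
    have "mon indet m = (\<Prod>u\<in>V. indet u ^ lookup m u :: ('v, 'a) mpoly)"
      by (rule mon_superset[OF finite_V m])
    also have "\<dots> = indet v ^ lookup m v * (\<Prod>u\<in>V - {v}. indet u ^ lookup m u)"
      using finite_V v(1) by (rule prod.remove)
    also have "indet v ^ lookup m v = indet v ^ k v * indet v ^ (lookup m v - k v)"
      using v(2) by (simp flip: power_add)
    finally have eq: "(single m 1 :: ('v, 'a) mpoly) = indet v ^ k v *
        (indet v ^ (lookup m v - k v) * (\<Prod>u\<in>V - {v}. indet u ^ lookup m u))"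
      by (simp only: mon_indet mult.assoc)
    show "single m 1 \<in> J"
      unfolding eq
      by (intro ideal_inD(5)[OF ideal_J _ k[OF v(1)]] polys_in_mult polys_in_prod polys_in_power polys_in_indet v(1)) auto
  qed simp
qed

text \<open>
  Modulo the \<open>\<delta>\<^sub>i\<close>, polynomials of weight at most \<open>w\<close> are combinations of products of the \<open>\<theta>\<^sub>j\<close>,
  with exponents at most \<open>w\<close>, and finitely many monomials.  So their number grows with \<open>w\<close> like a
  polynomial of degree \<open>card L\<close>, and no more than \<open>card L\<close> elements can have independent monomials.
\<close>

theorem rank_bound:
  assumes P: "ideal_in V P" "\<delta> ` I \<subseteq> P" and fs: "set fs \<subseteq> polys_in V" and indep: "mono_indep P fs"
  shows "length fs \<le> card L"
proof (rule ccontr)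
  assume "\<not> length fs \<le> card L"
  then have len: "card L + 1 \<le> length fs" by simp
  obtain E where E: "\<And>m. keys m \<subseteq> V \<Longrightarrow> E \<le> mwt wt m \<Longrightarrow> single m 1 \<in> J" "E > 0"
    using monomial_bound by metis
  define B where "B = (\<lambda>m. single m (1::'a)) ` {m. keys m \<subseteq> V \<and> mwt wt m < E}"
  have fB: "finite B"
  proof -
    have "{m. keys m \<subseteq> V \<and> mwt wt m < E} \<subseteq>
        {m. keys m \<subseteq> V \<and> (\<forall>v\<in>V. lookup m v < E)}"
    proof safe
      fix m v assume m: "keys m \<subseteq> V" "mwt wt m < E" "v \<in> V"
      have "mwt wt m = (\<Sum>v\<in>V. wt v * lookup m v)"
        unfolding mwt_def using m finite_V by (intro sum.mono_neutral_left) (auto simp: in_keys_iff)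
      moreover have "wt v * lookup m v \<le> (\<Sum>v\<in>V. wt v * lookup m v)"
        using finite_V m(3) by (intro member_le_sum) auto
      moreover have "lookup m v \<le> wt v * lookup m v"
        using wt_pos[OF m(3)] by simp
      ultimately show "lookup m v < E" using m(2) by linarith
    qed
    then show ?thesis
      unfolding B_def using finite_bounded_monomials[OF finite_V] finite_subset by blast
  qed
  define G where "G W = (\<lambda>(b, \<gamma>). b * (\<Prod>j\<in>L. \<theta> j ^ \<gamma> j)) ` (B \<times> (L \<rightarrow>\<^sub>E {..W}))" for W :: nat
  have fG: "finite (G W)" for W
    unfolding G_def using fB finite_L by (intro finite_imageI finite_cartesian_product finite_PiE) auto
  have cG: "card (G W) \<le> card B * (W + 1) ^ card L" for W
  proof -
    have "card (G W) \<le> card (B \<times> (L \<rightarrow>\<^sub>E {..W}))"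
      unfolding G_def using fB finite_L by (intro card_image_le finite_cartesian_product finite_PiE) auto
    then show ?thesis
      using finite_L by (simp add: card_cartesian_product card_PiE)
  qed
  have Gmono: "G W \<subseteq> G W'" if "W \<le> W'" for W W'
    unfolding G_def using that by (intro image_mono Sigma_mono PiE_mono) auto
  define S where "S W = mpv.span (P \<union> G W)" for W
  have Smono: "S W \<subseteq> S W'" if "W \<le> W'" for W W'
    unfolding S_def using Gmono[OF that] by (intro mpv.span_mono) auto
  have PS: "x \<in> P \<Longrightarrow> x \<in> S W" for x W
    unfolding S_def by (intro mpv.span_base) auto
  have SS: "mpv.subspace (S W)" for W
    unfolding S_def by (rule mpv.subspace_span)
  have mult: "\<theta> j * x \<in> S (Suc W)" if j: "j \<in> L" and x: "x \<in> S W" for j x W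
    using x unfolding S_def[of W]
  proof (rule mpv.span_induct)
    show "mpv.subspace {x. \<theta> j * x \<in> S (Suc W)}"
      unfolding mpv.subspace_def using SS[of "Suc W"]
      by (auto simp: mpv.subspace_def distrib_left mult.left_commute)
  next
    fix x assume "x \<in> P \<union> G W"
    then consider "x \<in> P" | "x \<in> G W" by blast
    then show "\<theta> j * x \<in> S (Suc W)"
    proof cases
      case 1
      then show ?thesis by (intro PS ideal_inD(4)[OF P(1)] \<theta>_in j)
    next
      case 2
      then obtain b \<gamma> where b: "b \<in> B" "\<gamma> \<in> L \<rightarrow>\<^sub>E {..W}" "x = b * (\<Prod>j\<in>L. \<theta> j ^ \<gamma> j)"
        by (auto simp: G_def)
      let ?\<gamma> = "\<gamma>(j := Suc (\<gamma> j))"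
      have "(\<Prod>i\<in>L. \<theta> i ^ ?\<gamma> i) = \<theta> j * (\<Prod>i\<in>L. \<theta> i ^ \<gamma> i)"
        using finite_L j by (simp add: prod.remove mult.assoc)
      then have "\<theta> j * x = b * (\<Prod>i\<in>L. \<theta> i ^ ?\<gamma> i)"
        using b(3) by (simp add: mult_ac)
      moreover have "?\<gamma> \<in> L \<rightarrow>\<^sub>E {..Suc W}"
        using b(2) j by (auto simp: PiE_iff extensional_def le_Suc_eq)
      ultimately have "\<theta> j * x \<in> G (Suc W)"
        unfolding G_def using b(1) by (intro image_eqI[of _ _ "(b, ?\<gamma>)"]) auto
      then show ?thesis
        unfolding S_def by (intro mpv.span_base) auto
    qed
  qed
  have BG: "b \<in> S W" if "b \<in> B" for b W
  proof -
    have "b \<in> G W"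
      unfolding G_def using that by (intro image_eqI[of _ _ "(b, restrict (\<lambda>_. 0) L)"]) auto
    then show ?thesis
      unfolding S_def by (intro mpv.span_base) auto
  qed
  have hom: "f \<in> S w" if "homog wt w f" "f \<in> polys_in V" for w f
    using that
  proof (induction w arbitrary: f rule: less_induct)
    case (less w)
    have f: "f = (\<Sum>m\<in>{m\<in>keys f. mwt wt m = w}. const (lookup f m) * single m 1)"
    proof -
      have "f = wcomp wt w f"
        using wcomp_homog[OF less.prems(1)] by simp
      also have "\<dots> = (\<Sum>m\<in>{m\<in>keys f. mwt wt m = w}. single m (lookup f m))"
        unfolding wcomp_eq by (rule sum.inter_filter[symmetric]) simp
      finally show ?thesis
        by (simp add: const_def mult_single)
    qed
    have keys: "keys m \<subseteq> V" if "m \<in> keys f" for m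
      using that less.prems(2) by (auto simp: polys_in_def)
    show ?case
    proof (cases "w < E")
      case True
      then have "single m 1 \<in> S w" if "m \<in> {m\<in>keys f. mwt wt m = w}" for m
        using that keys by (intro BG) (auto simp: B_def)
      then show ?thesis
        by (subst f) (intro mpv.subspace_sum[OF SS] mpv.subspace_scale[OF SS])
    next
      case False
      then have "single m 1 \<in> J" if "m \<in> {m\<in>keys f. mwt wt m = w}" for m
        using that keys by (intro E) auto
      then have "f \<in> J"
        by (subst f) (intro ideal_in_sum[OF ideal_J] ideal_inD(4)[OF ideal_J] polys_in_const)
      then obtain g h where gh: "\<forall>i\<in>I. g i \<in> polys_in V" "\<forall>j\<in>L. h j \<in> polys_in V"
        "f = (\<Sum>i\<in>I. \<delta> i * g i) + (\<Sum>j\<in>L. \<theta> j * h j)"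
        by (auto simp: sum_ideal_def comb_in_def)
      have "f = wcomp wt w f"
        using wcomp_homog[OF less.prems(1)] by simp
      also have "\<dots> = (\<Sum>i\<in>I. wcomp wt w (\<delta> i * g i)) + (\<Sum>j\<in>L. wcomp wt w (\<theta> j * h j))"
        unfolding gh(3) by (simp add: rhom.add[OF rhom_wgrade] rhom.sum[OF rhom_wgrade] coeff_sum)
      also have "\<dots> \<in> S w"
      proof (rule mpv.subspace_add[OF SS]; rule mpv.subspace_sum[OF SS])
        fix i assume i: "i \<in> I"
        have "\<delta> i * wcomp wt (w - e i) (g i) \<in> P"
          using i gh(1) P(2) by (intro ideal_inD(5)[OF P(1)] polys_in_wcomp) auto
        then show "wcomp wt w (\<delta> i * g i) \<in> S w"
          using PS mpv.subspace_0[OF SS] by (simp add: wcomp_mult_homog[OF \<delta>_homog[OF i]])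
      next
        fix j assume j: "j \<in> L"
        have "\<theta> j * wcomp wt (w - d j) (h j) \<in> S w" if "d j \<le> w"
        proof -
          have "wcomp wt (w - d j) (h j) \<in> S (w - d j)"
            using that d_pos[OF j] gh(2) j by (intro less.IH homog_wcomp polys_in_wcomp) auto
          then have "\<theta> j * wcomp wt (w - d j) (h j) \<in> S (Suc (w - d j))"
            by (rule mult[OF j])
          moreover have "S (Suc (w - d j)) \<subseteq> S w"
            using that d_pos[OF j] by (intro Smono) auto
          ultimately show ?thesis by blast
        qed
        then show "wcomp wt w (\<theta> j * h j) \<in> S w"
          using mpv.subspace_0[OF SS] by (simp add: wcomp_mult_homog[OF \<theta>_homog[OF j]])
      qed
      finally show ?thesis .
    qed
  qed
  have deg: "f \<in> S W" if "f \<in> polys_in V" "Polynomial.degree (wgrade wt f) \<le> W" for f W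
  proof -
    have "(\<Sum>w\<le>Polynomial.degree (wgrade wt f). wcomp wt w f) \<in> S W"
    proof (rule mpv.subspace_sum[OF SS])
      fix w assume "w \<in> {..Polynomial.degree (wgrade wt f)}"
      then show "wcomp wt w f \<in> S W"
        using hom[OF homog_wcomp polys_in_wcomp[OF that(1)], of w] Smono[of w W] that(2) by auto
    qed
    then show ?thesis by (simp only: sum_wcomp)
  qed
  define K where "K = (\<Sum>f\<leftarrow>fs. Polynomial.degree (wgrade wt f))"
  have degm: "Polynomial.degree (wgrade wt (lmon fs \<alpha>)) \<le> D * (\<Sum>f\<leftarrow>fs. Polynomial.degree (wgrade wt f))"
    if "set \<alpha> \<subseteq> {..D}" for fs \<alpha> D
    using that
  proof (induction fs \<alpha> rule: lmon.induct)
    case (1 f fs a \<alpha>)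
    have "Polynomial.degree (wgrade wt (lmon (f # fs) (a # \<alpha>))) \<le>
        Polynomial.degree (wgrade wt f ^ a) + Polynomial.degree (wgrade wt (lmon fs \<alpha>))"
      by (simp add: rhom.mult[OF rhom_wgrade] rhom.power[OF rhom_wgrade] degree_mult_le)
    also have "Polynomial.degree (wgrade wt f ^ a) \<le> Polynomial.degree (wgrade wt f) * a"
      by (rule degree_power_le)
    also have "\<dots> \<le> D * Polynomial.degree (wgrade wt f)"
      using 1(2) by (simp add: mult.commute)
    finally show ?case
      using 1 by (simp add: distrib_left)
  qed (simp_all add: rhom.one[OF rhom_wgrade])
  \<comment> \<open>\<open>(D+1)^(length fs)\<close> monomials in \<open>fs\<close> have exponents up to \<open>D\<close>; they lie in the span of at most
    \<open>card B * (D*K+1)^(card L) \<le> D * (D+1)^(card L)\<close> elements, which are too few.\<close>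
  define D where "D = card B * (K + 1) ^ card L"
  let ?A = "{\<alpha>. set \<alpha> \<subseteq> {..D} \<and> length \<alpha> = length fs}"
  have fA: "finite ?A"
    by (rule finite_lists_length_eq) simp
  have "card (G (D * K)) \<le> card B * (D * K + 1) ^ card L"
    by (rule cG)
  also have "\<dots> \<le> card B * ((K + 1) * (D + 1)) ^ card L"
    by (intro mult_le_mono power_mono) (auto simp: algebra_simps)
  also have "\<dots> = D * (D + 1) ^ card L"
    by (simp only: D_def power_mult_distrib mult.assoc)
  also have "\<dots> < (D + 1) ^ (card L + 1)"
    by simp
  also have "\<dots> \<le> (D + 1) ^ length fs"
    using len by (intro power_increasing) auto
  also have "\<dots> = card ?A"
    by (simp add: card_lists_length_eq)
  finally have less: "card (G (D * K)) < card ?A" .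
  have span: "lmon fs \<alpha> \<in> mpv.span (P \<union> G (D * K))" if "\<alpha> \<in> ?A" for \<alpha>
    unfolding S_def[symmetric] using that degm[of \<alpha> D fs] polys_in_lmon[OF fs]
    by (intro deg) (auto simp: K_def)
  obtain c where "\<exists>\<alpha>\<in>?A. c \<alpha> \<noteq> 0" "(\<Sum>\<alpha>\<in>?A. const (c \<alpha>) * lmon fs \<alpha>) \<in> P"
    by (rule dependent_mod_subspace[OF subspace_ideal_in[OF P(1)] fG fA less span])
  then show False
    using indep fA unfolding mono_indep_def by blast
qed

end

section \<open>Chains of primes\<close>

text \<open>
  The coefficients are polynomials in the other indeterminates, kept in the ring of all
  polynomials.
\<close>

definition univ_in :: "'v \<Rightarrow> ('v, 'a::comm_ring_1) mpoly \<Rightarrow> ('v, 'a) mpoly poly" where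
  "univ_in v = psubst (\<lambda>c. [:const c:]) (\<lambda>u. if u = v then [:0, 1:] else [:indet u:])"

lemma rhom_univ_in: "rhom (univ_in v)"
  unfolding univ_in_def by (rule rhom_psubst[OF rhom_pCons_const])

lemma univ_in_const_indet:
  "univ_in v (const c) = [:const c:]" "univ_in v (indet u) = (if u = v then [:0, 1:] else [:indet u:])"
  by (simp_all add: univ_in_def psubst_const[OF rhom_pCons_const] psubst_indet[OF rhom_pCons_const])

lemma poly_univ_in: "poly (univ_in v f) (indet v) = f"
proof -
  have "rhom (\<lambda>q. poly q (indet v :: ('a, 'b) mpoly))"
    by unfold_locales auto
  then show ?thesis
    by (intro rhom_eqI[of "\<lambda>f. poly (univ_in v f) (indet v)" "\<lambda>x. x" f UNIV, OF rhom_compose[OF rhom_univ_in]])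
       (auto simp: rhom_def polys_in_def univ_in_const_indet)
qed

lemma univ_in_free:
  assumes "f \<in> polys_in U" "v \<notin> U"
  shows "univ_in v f = [:f:]"
proof -
  have "rhom (\<lambda>f :: ('a, 'b) mpoly. [:f:])"
    by unfold_locales auto
  then show ?thesis
    by (rule rhom_eqI[OF rhom_univ_in _ assms(1)]) (use assms(2) in \<open>auto simp: univ_in_const_indet\<close>)
qed

lemma coeff_univ_in:
  assumes "f \<in> polys_in U"
  shows "Polynomial.coeff (univ_in v f) k \<in> polys_in (U - {v})"
proof -
  define C where "C = {q. \<forall>k. Polynomial.coeff q k \<in> (polys_in (U - {v}) :: ('a, 'b) mpoly set)}"
  have mult: "p * q \<in> C" if "p \<in> C" "q \<in> C" for p q
    using that by (auto simp: C_def coeff_mult)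
  have one: "1 \<in> C" by (auto simp: C_def)
  have prod: "prod g A \<in> C" if "\<And>i. i \<in> A \<Longrightarrow> g i \<in> C" for g :: "'a \<Rightarrow> _" and A
    using that by (induction A rule: infinite_finite_induct) (auto intro: mult one)
  have pow: "q ^ n \<in> C" if "q \<in> C" for q n
    by (induction n) (auto intro: mult one that)
  have sum: "sum g A \<in> C" if "\<And>i. i \<in> A \<Longrightarrow> g i \<in> C" for g :: "('a \<Rightarrow>\<^sub>0 nat) \<Rightarrow> _" and A
    using that by (auto simp: C_def coeff_sum)
  have const: "[:const c:] \<in> C" for c
    by (auto simp: C_def coeff_pCons split: nat.splits)
  have ind: "(if u = v then [:0, 1:] else [:indet u:]) \<in> C" if "u \<in> U" for u
    using that by (auto simp: C_def coeff_pCons split: nat.splits)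
  have "univ_in v f \<in> C"
    unfolding univ_in_def psubst_def mon_def
    by (intro sum mult const prod pow ind) (use assms in \<open>auto simp: polys_in_def\<close>)
  then show ?thesis by (simp add: C_def)
qed

text \<open>
  The prime \<open>(Q \<inter> k[V - {v}]) k[V]\<close>, described by its elements.
\<close>

definition ext_prime :: "'v set \<Rightarrow> 'v \<Rightarrow> ('v, 'a::comm_ring_1) mpoly set \<Rightarrow> ('v, 'a) mpoly set" where
  "ext_prime V v Q = {f \<in> polys_in V. \<forall>k. Polynomial.coeff (univ_in v f) k \<in> Q}"

text \<open>
  A polynomial is recovered from its coefficients with respect to \<open>v\<close>.
\<close>

lemma ext_prime_subset:
  assumes "ideal_in V Q" "v \<in> V"
  shows "ext_prime V v Q \<subseteq> Q"
proof
  fix f assume f: "f \<in> ext_prime V v Q"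
  have "poly (univ_in v f) (indet v) \<in> Q"
    unfolding poly_altdef using f assms(2)
    by (intro ideal_in_sum[OF assms(1)] ideal_inD(5)[OF assms(1)]) (auto simp: ext_prime_def)
  then show "f \<in> Q" by (simp only: poly_univ_in)
qed

text \<open>
  If neither factor has all coefficients in \<open>Q\<close>, take the first coefficients outside \<open>Q\<close>, of
  degrees \<open>i\<close> and \<open>j\<close>: modulo \<open>Q\<close>, their product is the coefficient of degree \<open>i + j\<close> of the product.
\<close>

lemma prime_in_ext_prime:
  fixes Q :: "('v, 'a::comm_ring_1) mpoly set"
  assumes Q: "prime_in V Q"
  shows "prime_in V (ext_prime V v Q)"
  unfolding prime_in_def
proof (intro conjI ballI impI)
  note Qi = prime_inD(1)[OF Q]
  have co: "Polynomial.coeff (univ_in v f) k \<in> polys_in V" if "f \<in> polys_in V" for f k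
    using coeff_univ_in[OF that, of v k] by (auto simp: polys_in_def)
  show "ideal_in V (ext_prime V v Q)"
    unfolding ideal_in_def
  proof (intro conjI ballI)
    fix a b :: "('v, 'a) mpoly" assume "a \<in> polys_in V" "b \<in> ext_prime V v Q"
    then show "a * b \<in> ext_prime V v Q"
      using co[of a] by (auto simp: ext_prime_def rhom.mult[OF rhom_univ_in] coeff_mult
          intro!: ideal_in_sum[OF Qi] ideal_inD(4)[OF Qi])
  qed (auto simp: ext_prime_def rhom.add[OF rhom_univ_in] rhom.zero[OF rhom_univ_in] ideal_inD(2,3)[OF Qi])
  show "1 \<notin> ext_prime V v Q"
  proof
    assume "1 \<in> ext_prime V v Q"
    then have "Polynomial.coeff (univ_in v 1) 0 \<in> Q"
      by (auto simp: ext_prime_def)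
    then show False
      using prime_inD(2)[OF Q] by (simp add: rhom.one[OF rhom_univ_in])
  qed
  fix a b :: "('v, 'a) mpoly" assume a: "a \<in> polys_in V" and b: "b \<in> polys_in V" and ab: "a * b \<in> ext_prime V v Q"
  show "a \<in> ext_prime V v Q \<or> b \<in> ext_prime V v Q"
  proof (rule ccontr)
    let ?a = "Polynomial.coeff (univ_in v a)" and ?b = "Polynomial.coeff (univ_in v b)"
    assume "\<not> ?thesis"
    then have ex: "\<exists>i. ?a i \<notin> Q" "\<exists>j. ?b j \<notin> Q"
      using a b by (auto simp: ext_prime_def)
    define i j where "i = (LEAST i. ?a i \<notin> Q)" and "j = (LEAST j. ?b j \<notin> Q)"
    have i: "?a i \<notin> Q" "\<And>i'. i' < i \<Longrightarrow> ?a i' \<in> Q" and j: "?b j \<notin> Q" "\<And>j'. j' < j \<Longrightarrow> ?b j' \<in> Q"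
      using LeastI_ex[OF ex(1)] LeastI_ex[OF ex(2)] not_less_Least unfolding i_def j_def by blast+
    have rest: "(\<Sum>k\<in>{..i + j} - {i}. ?a k * ?b (i + j - k)) \<in> Q"
    proof (rule ideal_in_sum[OF Qi])
      fix k assume "k \<in> {..i + j} - {i}"
      then consider "k < i" | "i + j - k < j" by fastforce
      then show "?a k * ?b (i + j - k) \<in> Q"
        by cases (use i(2) j(2) co[OF a] co[OF b] in \<open>auto intro: ideal_inD(4,5)[OF Qi]\<close>)
    qed
    have "Polynomial.coeff (univ_in v (a * b)) (i + j) \<in> Q"
      using ab by (auto simp: ext_prime_def)
    then have "(\<Sum>k\<le>i + j. ?a k * ?b (i + j - k)) \<in> Q"
      by (simp add: rhom.mult[OF rhom_univ_in] coeff_mult)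
    then have "?a i * ?b j + (\<Sum>k\<in>{..i + j} - {i}. ?a k * ?b (i + j - k)) \<in> Q"
      by (simp add: sum.remove[of _ i])
    then have "?a i * ?b j \<in> Q"
      using ideal_in_diff[OF Qi _ rest] by fastforce
    then show False
      using prime_inD(3)[OF Q co[OF a] co[OF b]] i(1) j(1) by blast
  qed
qed

lemma prime_chain_mpoly_ring:
  "prime_chain (mpoly_ring V) d C \<longleftrightarrow> (\<forall>i\<le>d. prime_in V (C i)) \<and> (\<forall>i<d. C i \<subset> C (Suc i))"
  by (simp add: prime_chain_def primeideal_iff_prime_in)

lemma prime_chain_Suc:
  assumes "prime_chain R d C" "C d \<subset> Q" "primeideal Q R"
  shows "prime_chain R (Suc d) (C(Suc d := Q))"
  using assms by (auto simp: prime_chain_def le_Suc_eq less_Suc_eq)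

text \<open>
  Replacing \<open>Q\<close> by its extension from \<open>k[V - {v}]\<close>, for one \<open>v \<in> W\<close> after another, goes down in a
  chain.  The inclusions are strict: the relation \<open>g\<close> for \<open>v\<close> lies in \<open>Q\<close>, but its coefficients with
  respect to \<open>v\<close> lie in \<open>k[T]\<close>, where \<open>Q\<close> is zero.  The relations of the other elements of \<open>W\<close> do not
  contain \<open>v\<close> and stay in the extension.
\<close>

lemma prime_chain_below:
  assumes "finite W" "W \<subseteq> V" "T \<inter> W = {}" "prime_in V Q" "Q \<inter> polys_in T \<subseteq> {0}"
    and "\<And>v. v \<in> W \<Longrightarrow> \<exists>g. g \<noteq> 0 \<and> g \<in> Q \<and> g \<in> polys_in (insert v T)"
  shows "\<exists>C. prime_chain (mpoly_ring V) (card W) C \<and> C (card W) = Q"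
  using assms
proof (induction W arbitrary: Q rule: finite_induct)
  case empty
  then show ?case
    by (intro exI[of _ "\<lambda>_. Q"]) (auto simp: prime_chain_mpoly_ring)
next
  case (insert v W)
  let ?Q = "ext_prime V v Q"
  have sub: "?Q \<subseteq> Q"
    using insert.prems by (intro ext_prime_subset) (auto dest: prime_inD)
  have Qi: "ideal_in V Q"
    using insert.prems by (auto dest: prime_inD)
  have "\<exists>C. prime_chain (mpoly_ring V) (card W) C \<and> C (card W) = ?Q"
  proof (rule insert.IH)
    show "prime_in V ?Q"
      using insert.prems by (intro prime_in_ext_prime) auto
    show "?Q \<inter> polys_in T \<subseteq> {0}"
      using sub insert.prems by auto
    fix u assume u: "u \<in> W"
    then obtain g where g: "g \<noteq> 0" "g \<in> Q" "g \<in> polys_in (insert u T)"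
      using insert.prems(5)[of u] by blast
    have "v \<notin> insert u T"
      using u insert by auto
    then have "univ_in v g = [:g:]"
      using univ_in_free[OF g(3)] by simp
    then have "g \<in> ?Q"
      using g(2) ideal_inD(1,2)[OF Qi] by (auto simp: ext_prime_def coeff_pCons split: nat.splits)
    then show "\<exists>g. g \<noteq> 0 \<and> g \<in> ?Q \<and> g \<in> polys_in (insert u T)"
      using g by blast
  qed (use insert.prems in auto)
  then obtain C where C: "prime_chain (mpoly_ring V) (card W) C" "C (card W) = ?Q"
    by blast
  obtain g where g: "g \<noteq> 0" "g \<in> Q" "g \<in> polys_in (insert v T)"
    using insert.prems(5)[of v] by blast
  have "g \<notin> ?Q"
  proof
    assume "g \<in> ?Q"
    then have "Polynomial.coeff (univ_in v g) k \<in> Q \<inter> polys_in T" for k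
      using coeff_univ_in[OF g(3), of v k] insert.prems(2) by (auto simp: ext_prime_def)
    then have "univ_in v g = 0"
      using insert.prems(4) by (intro poly_eqI) auto
    then show False
      using poly_univ_in[of v g] g(1) by simp
  qed
  with sub g have "?Q \<subset> Q" by blast
  then have "prime_chain (mpoly_ring V) (Suc (card W)) (C(Suc (card W) := Q))"
    using C(2) insert.prems(3) by (intro prime_chain_Suc[OF C(1)]) (simp_all add: primeideal_iff_prime_in)
  moreover have "card (insert v W) = Suc (card W)"
    using insert.hyps by simp
  ultimately show ?case
    by (metis fun_upd_same)
qed

text \<open>
  Apply \<open>prime_chain_below\<close> to a maximal set \<open>T\<close> of indeterminates that are independent modulo \<open>P\<close>; it
  has at most \<open>card L\<close> elements by \<open>rank_bound\<close>, and maximality supplies the relations.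
\<close>

lemma (in graded_system) prime_chain_ending_at:
  assumes P: "prime_in V P" "\<delta> ` I \<subseteq> P"
  shows "\<exists>c C. card V - card L \<le> c \<and> prime_chain (mpoly_ring V) c C \<and> C c = P"
proof -
  note Pi = prime_inD(1)[OF P(1)]
  define \<T> where "\<T> = {T. T \<subseteq> V \<and> P \<inter> polys_in T \<subseteq> {0}}"
  have "{} \<in> \<T>"
  proof -
    have "f = 0" if "f \<in> P" "f \<in> polys_in {}" for f
    proof (rule ccontr)
      assume "f \<noteq> 0"
      have "f = const (lookup f 0)"
        using that(2) by (intro poly_mapping_eqI) (auto simp: polys_in_def const_def lookup_single when_def in_keys_iff)
      then obtain c where c: "f = const c" by blast
      with \<open>f \<noteq> 0\<close> have "c \<noteq> 0" by (auto simp: rhom.zero[OF rhom_const])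
      then have "const (inverse c) * f = 1"
        unfolding c by (simp flip: rhom.mult[OF rhom_const] add: rhom.one[OF rhom_const])
      then show False
        using ideal_inD(4)[OF Pi polys_in_const that(1), of "inverse c"] prime_inD(2)[OF P(1)] by simp
    qed
    then show ?thesis by (auto simp: \<T>_def)
  qed
  moreover have "finite \<T>"
    unfolding \<T>_def using finite_V by simp
  ultimately obtain T where T: "T \<in> \<T>" "\<And>T'. T' \<in> \<T> \<Longrightarrow> T \<subseteq> T' \<Longrightarrow> T' = T"
    using finite_has_maximal[of \<T>] by blast
  have fT: "finite T" and TV: "T \<subseteq> V" and T0: "P \<inter> polys_in T \<subseteq> {0}"
    using T(1) finite_V by (auto simp: \<T>_def intro: finite_subset)
  obtain ts where ts: "set ts = T" "distinct ts"
    using finite_distinct_list[OF fT] by blast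
  have "length (map indet ts :: ('v, 'a) mpoly list) \<le> card L"
    using ts TV T0 by (intro rank_bound[OF Pi P(2)] indets_indep) auto
  then have "card T \<le> card L"
    using ts distinct_card by fastforce
  moreover have "\<exists>C. prime_chain (mpoly_ring V) (card (V - T)) C \<and> C (card (V - T)) = P"
  proof (rule prime_chain_below[where T = T])
    fix v assume v: "v \<in> V - T"
    then have "insert v T \<notin> \<T>"
      using T(2)[of "insert v T"] by auto
    then show "\<exists>g. g \<noteq> 0 \<and> g \<in> P \<and> g \<in> polys_in (insert v T)"
      using v TV by (auto simp: \<T>_def)
  qed (use finite_V P T0 in auto)
  ultimately show ?thesis
    using card_Diff_subset[OF fT TV] diff_le_mono2 by metis
qed

lemma (in graded_system) prime_chain_above:
  assumes "prime_chain (mpoly_ring V) c C" "\<delta> ` I \<subseteq> C 0"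
  shows "c \<le> card L"
proof -
  have "\<exists>fs. length fs = c - i \<and> chain_witnesses V (C i) fs" if "i \<le> c" for i
    using that
  proof (induction i rule: inc_induct)
    case base
    then show ?case
      using assms by (intro exI[of _ "[]"]) (auto simp: prime_chain_mpoly_ring)
  next
    case (step i)
    then obtain fs where fs: "length fs = c - Suc i" "chain_witnesses V (C (Suc i)) fs" by blast
    have "C i \<subset> C (Suc i)" "prime_in V (C i)" "prime_in V (C (Suc i))"
      using assms(1) step by (auto simp: prime_chain_mpoly_ring)
    then obtain f where "f \<in> C (Suc i)" "f \<notin> C i" "f \<in> polys_in V"
      by (meson ideal_inD(1) prime_inD(1) psubset_imp_ex_mem DiffD1 DiffD2)
    then show ?case
      using fs \<open>C i \<subset> C (Suc i)\<close> \<open>prime_in V (C i)\<close> step.hyps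
      by (intro exI[of _ "f # fs"]) auto
  qed
  from this[of 0] obtain fs where fs: "length fs = c" "chain_witnesses V (C 0) fs" by auto
  have "length fs \<le> card L"
    using assms(2) chain_witnesses_polys[OF fs(2)] chain_witnesses_indep[OF fs(2)]
      prime_inD(1)[OF chain_witnesses_prime[OF fs(2)]]
    by (intro rank_bound) auto
  with fs show ?thesis by simp
qed

text \<open>The indeterminates themselves cut out the origin: a graded system with empty \<open>\<delta>\<close>.\<close>

lemma prime_chain_mpoly_ring_length:
  assumes V: "finite V" and C: "prime_chain (mpoly_ring V :: ('v, 'a::field) mpoly ring) c C"
  shows "c \<le> card V"
proof -
  interpret graded_system V "\<lambda>_. 1" "{} :: nat set" "\<lambda>_. 0" "\<lambda>_. 0" V "indet :: 'v \<Rightarrow> ('v, 'a) mpoly" "\<lambda>_. 1"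
  proof
    fix v assume v: "v \<in> V"
    show "homog (\<lambda>_. 1) 1 (indet v :: ('v, 'a) mpoly)"
      by (rule homog_indet)
    have "indet v \<in> sum_ideal (comb_in V ({} :: nat set) (\<lambda>_. 0)) (comb_in V V (indet :: 'v \<Rightarrow> ('v, 'a) mpoly))"
      by (rule sum_ideal_right[OF ideal_in_comb_in generator_in_comb_in]) (use V v in auto)
    then show "\<exists>k. indet v ^ k \<in> sum_ideal (comb_in V ({} :: nat set) (\<lambda>_. 0)) (comb_in V V (indet :: 'v \<Rightarrow> ('v, 'a) mpoly))"
      by (intro exI[of _ 1]) simp
  qed (use V in auto)
  show ?thesis
    using prime_chain_above[OF C] by simp
qed

section \<open>The discriminant coefficients form a system of parameters\<close>

definition rad_in :: "'v set \<Rightarrow> ('v, 'a::comm_ring_1) mpoly set \<Rightarrow> ('v, 'a) mpoly set" where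
  "rad_in V J = {f \<in> polys_in V. \<exists>k. f ^ k \<in> J}"

lemma ideal_in_power_mono:
  assumes "ideal_in V J" "f \<in> polys_in V" "f ^ k \<in> J" "k \<le> l"
  shows "f ^ l \<in> J"
proof -
  have "f ^ l = f ^ (l - k) * f ^ k"
    using assms(4) by (simp flip: power_add)
  then show ?thesis
    using ideal_inD(4)[OF assms(1) polys_in_power[OF assms(2)] assms(3)] by simp
qed

lemma ideal_in_rad_in:
  fixes J :: "('v, 'a::comm_ring_1) mpoly set"
  assumes J: "ideal_in V J"
  shows "ideal_in V (rad_in V J)"
  unfolding ideal_in_def
proof (intro conjI ballI)
  show "rad_in V J \<subseteq> polys_in V" by (auto simp: rad_in_def)
  have "0 ^ 1 \<in> J" using ideal_inD(2)[OF J] by simp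
  then show "0 \<in> rad_in V J" unfolding rad_in_def using polys_in_zero by blast
next
  fix a b assume "a \<in> rad_in V J" "b \<in> rad_in V J"
  then obtain k l where ab: "a \<in> polys_in V" "b \<in> polys_in V" "a ^ k \<in> J" "b ^ l \<in> J"
    by (auto simp: rad_in_def)
  have "(a + b) ^ (k + l) = (\<Sum>i\<le>k + l. of_nat (k + l choose i) * a ^ i * b ^ (k + l - i))"
    by (rule binomial_ring)
  also have "\<dots> \<in> J"
  proof (rule ideal_in_sum[OF J])
    fix i assume "i \<in> {..k + l}"
    show "of_nat (k + l choose i) * a ^ i * b ^ (k + l - i) \<in> J"
    proof (cases "k \<le> i")
      case True
      then show ?thesis
        using ab by (intro ideal_inD(5)[OF J] ideal_inD(4)[OF J] ideal_in_power_mono[OF J _ ab(3)]) auto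
    next
      case False
      then have "l \<le> k + l - i" by simp
      then show ?thesis
        using ab by (intro ideal_inD(4)[OF J] ideal_in_power_mono[OF J _ ab(4)]) auto
    qed
  qed
  finally show "a + b \<in> rad_in V J"
    using ab unfolding rad_in_def by auto
next
  fix a b :: "('v, 'a) mpoly" assume "a \<in> polys_in V" "b \<in> rad_in V J"
  then obtain l where ab: "a \<in> polys_in V" "b \<in> polys_in V" "b ^ l \<in> J"
    by (auto simp: rad_in_def)
  have "(a * b) ^ l \<in> J"
    using ab by (simp add: power_mult_distrib ideal_inD(4)[OF J])
  then show "a * b \<in> rad_in V J"
    using ab unfolding rad_in_def by auto
qed

lemma subset_rad_in: "ideal_in V J \<Longrightarrow> f \<in> J \<Longrightarrow> f \<in> rad_in V J"
  by (auto simp: rad_in_def intro: exI[of _ 1] ideal_inD(1))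

lemma rad_in_power_cancel: "f ^ k \<in> rad_in V J \<Longrightarrow> f \<in> polys_in V \<Longrightarrow> f \<in> rad_in V J"
  by (auto simp: rad_in_def simp flip: power_mult)

lemma rad_in_power: "ideal_in V J \<Longrightarrow> f \<in> rad_in V J \<Longrightarrow> k > 0 \<Longrightarrow> f ^ k \<in> rad_in V J"
  using ideal_inD(5)[OF ideal_in_rad_in, of V J "f ^ (k - 1)" f]
  by (cases k) (auto simp: rad_in_def)

lemma ideal_in_prod_diff:
  assumes K: "ideal_in V K"
    and "\<And>i. i \<in> A \<Longrightarrow> f i \<in> polys_in V" "\<And>i. i \<in> A \<Longrightarrow> g i \<in> polys_in V" "\<And>i. i \<in> A \<Longrightarrow> f i - g i \<in> K"
  shows "prod f A - prod g A \<in> K"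
  using assms(2-)
proof (induction A rule: infinite_finite_induct)
  case (insert i A)
  have "prod f (insert i A) - prod g (insert i A) = prod f A * (f i - g i) + g i * (prod f A - prod g A)"
    using insert.hyps by (simp add: algebra_simps)
  also have "\<dots> \<in> K"
    using insert by (intro ideal_inD(3,4)[OF K] polys_in_prod) auto
  finally show ?case .
qed (use ideal_inD(2)[OF K] in auto)

text \<open>
  Congruent substitutions give congruent values.
\<close>

lemma ideal_in_psubst_diff:
  fixes x y :: "'v \<Rightarrow> ('w, 'a::comm_ring_1) mpoly"
  assumes K: "ideal_in U K" and "P \<in> polys_in V"
    and "\<And>v. v \<in> V \<Longrightarrow> x v \<in> polys_in U" "\<And>v. v \<in> V \<Longrightarrow> y v \<in> polys_in U" "\<And>v. v \<in> V \<Longrightarrow> x v - y v \<in> K"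
  shows "psubst const x P - psubst const y P \<in> K"
proof -
  have pow: "x v ^ k - y v ^ k \<in> K" if "v \<in> V" for v k
    using ideal_in_prod_diff[OF K, of "{..<k}" "\<lambda>_. x v" "\<lambda>_. y v"] assms(3-5)[OF that] by simp
  have "psubst const x P - psubst const y P =
      (\<Sum>m\<in>keys P. const (lookup P m) * (mon x m - mon y m))"
    by (simp add: psubst_def right_diff_distrib sum_subtractf)
  also have "\<dots> \<in> K"
  proof (rule ideal_in_sum[OF K])
    fix m assume m: "m \<in> keys P"
    have "mon x m - mon y m \<in> K"
      unfolding mon_def using m assms(2-4)
      by (intro ideal_in_prod_diff[OF K] pow polys_in_power) (auto simp: polys_in_def[of V])
    then show "const (lookup P m) * (mon x m - mon y m) \<in> K"
      by (intro ideal_inD(4)[OF K]) auto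
  qed
  finally show ?thesis .
qed

text \<open>
  Leading terms of a product of elements of known valuation.
\<close>

lemma prod_dvd_leading:
  fixes x z :: "'i \<Rightarrow> 'a::comm_ring_1"
  assumes "finite A" "\<And>i. i \<in> A \<Longrightarrow> of_nat p ^ c i dvd x i"
    and "\<And>i. i \<in> A \<Longrightarrow> of_nat p ^ Suc (c i) dvd x i - of_nat p ^ c i * z i"
  shows "of_nat p ^ Suc (sum c A) dvd prod x A - of_nat p ^ sum c A * prod z A"
  using assms
proof (induction A rule: finite_induct)
  case (insert i A)
  let ?q = "of_nat p :: 'a"
  have "?q ^ c i dvd x i" "?q ^ Suc (c i) dvd x i - ?q ^ c i * z i"
    using insert.prems by auto
  moreover have "?q ^ Suc (sum c A) dvd prod x A - ?q ^ sum c A * prod z A"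
    using insert by auto
  ultimately have "?q ^ c i * ?q ^ Suc (sum c A) dvd x i * (prod x A - ?q ^ sum c A * prod z A)"
    "?q ^ Suc (c i) * ?q ^ sum c A dvd (x i - ?q ^ c i * z i) * (?q ^ sum c A * prod z A)"
    by (intro mult_dvd_mono; simp)+
  then have "?q ^ Suc (c i + sum c A) dvd x i * (prod x A - ?q ^ sum c A * prod z A)"
    "?q ^ Suc (c i + sum c A) dvd (x i - ?q ^ c i * z i) * (?q ^ sum c A * prod z A)"
    by (simp_all add: power_add mult_ac)
  then have "?q ^ Suc (c i + sum c A) dvd
     x i * (prod x A - ?q ^ sum c A * prod z A) + (x i - ?q ^ c i * z i) * (?q ^ sum c A * prod z A)"
    by (rule dvd_add)
  also have "\<dots> = x i * prod x A - ?q ^ (c i + sum c A) * (z i * prod z A)"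
    by (simp add: algebra_simps power_add)
  finally show ?case
    using insert.hyps by simp
qed simp

text \<open>
  Let \<open>\<pi>\<close> be a root of \<open>\<pi>^n = p\<close>.  Multiplication by \<open>\<Sum>\<^sub>j y\<^sub>j \<pi>^j\<close> has a matrix whose
  \<open>(a,b)\<close> entry is \<open>y\<^bsub>a-b\<^esub>\<close> for \<open>a \<ge> b\<close> and \<open>p y\<^bsub>n+a-b\<^esub>\<close> for \<open>a < b\<close>.
  The indeterminate at level \<open>\<tau> = n s + j\<close> is the component \<open>s\<close> of \<open>y\<^sub>j\<close>; multiplication by \<open>p\<close>
  raises components to the \<open>p\<close>-th power and shifts them.  The components of level below \<open>t\<close>, and
  those of level \<open>nr\<close> or more, are set to zero.  The first column contains each \<open>y\<^sub>j\<close> once, and its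
  indeterminates serve as coordinates.
\<close>

definition level :: "nat \<Rightarrow> coord \<Rightarrow> int" where
  "level n = (\<lambda>(a, b, s). int n * int s + int a - int b)"

definition param :: "nat \<Rightarrow> nat \<Rightarrow> coord" where
  "param n \<tau> = (\<tau> mod n + 1, 1, \<tau> div n)"

definition eisenstein :: "nat \<Rightarrow> nat \<Rightarrow> nat \<Rightarrow> nat \<Rightarrow> coord \<Rightarrow> (coord, 'a::comm_ring_1) mpoly" where
  "eisenstein p n r t v = (if int t \<le> level n v \<and> level n v < int (n * r)
     then indet (param n (nat (level n v))) ^ (if fst v < fst (snd v) then p else 1) else 0)"

lemma level_param: "n > 0 \<Longrightarrow> level n (param n \<tau>) = int \<tau>"
proof -
  have "int n * int (\<tau> div n) + int (\<tau> mod n) = int \<tau>"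
    by (metis mult_div_mod_eq of_nat_add of_nat_mult)
  then show ?thesis by (simp add: level_def param_def)
qed

lemma param_in_base:
  assumes "n > 0" "\<tau> < n * r"
  shows "param n \<tau> \<in> base_indets n r"
proof -
  have "\<tau> mod n < n" using assms by simp
  moreover have "\<tau> div n \<le> n * r"
    using assms(2) div_le_dividend[of \<tau> n] by linarith
  ultimately show ?thesis
    by (auto simp: param_def base_indets_def)
qed

lemma inj_param: "n > 0 \<Longrightarrow> inj (param n)"
  by (metis injI level_param of_nat_eq_iff)

lemma eis_param:
  assumes "n > 0" "\<tau> < n * r"
  shows "eisenstein p n r 0 (param n \<tau>) = indet (param n \<tau>)"
proof -
  have "int \<tau> < int (n * r)" using assms(2) by (simp only: of_nat_less_iff)
  then show ?thesis
    using assms(1) by (simp only: eisenstein_def level_param nat_int) (simp add: param_def)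
qed

lemma polys_in_eis:
  assumes "n > 0"
  shows "eisenstein p n r t v \<in> polys_in (base_indets n r)"
proof -
  have "nat (level n v) < n * r" if "int t \<le> level n v" "level n v < int (n * r)"
    using that by linarith
  then show ?thesis
    using assms by (auto simp: eisenstein_def intro!: polys_in_power polys_in_indet param_in_base)
qed

definition pwt :: "nat \<Rightarrow> coord \<Rightarrow> nat" where
  "pwt p = (\<lambda>(a, b, s). p ^ s)"

text \<open>
  Entries above the diagonal have their components shifted by one and raised to the \<open>p\<close>-th power; both
  effects on the weight \<open>p^s\<close> cancel.
\<close>

lemma homog_eis:
  assumes "n > 0" "v \<in> base_indets n r"
  shows "homog (pwt p) (pwt p v) (eisenstein p n r t v :: (coord, 'a::comm_ring_1) mpoly)"
proof (cases "int t \<le> level n v \<and> level n v < int (n * r)")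
  case True
  obtain a b s where v: "v = (a, b, s)" by (cases v)
  have ab: "1 \<le> a" "a \<le> n" "1 \<le> b" "b \<le> n"
    using assms(2) by (auto simp: v base_indets_def)
  define \<tau> where "\<tau> = nat (level n v)"
  have \<tau>: "int \<tau> = int n * int s + int a - int b"
    using True by (simp add: \<tau>_def level_def v)
  have "pwt p (param n \<tau>) * (if a < b then p else 1) = p ^ s"
  proof (cases "a < b")
    case True
    with \<tau> ab have "s > 0" by (cases s) auto
    then obtain s' where s: "s = Suc s'" by (cases s) auto
    have "int \<tau> = int (n * s' + (n + a - b))"
      using \<tau> ab by (simp add: s algebra_simps of_nat_diff)
    then have "\<tau> = n * s' + (n + a - b)"
      by linarith
    moreover have "n + a - b < n" using True ab by linarith
    ultimately have "\<tau> div n = s'" using assms(1) by simp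
    then show ?thesis using True by (simp add: pwt_def param_def s)
  next
    case False
    have "int \<tau> = int (n * s + (a - b))"
      using \<tau> False by (simp add: of_nat_diff)
    then have "\<tau> = n * s + (a - b)"
      by linarith
    moreover have "a - b < n" using False ab by linarith
    ultimately have "\<tau> div n = s" using assms(1) by simp
    then show ?thesis using False by (simp add: pwt_def param_def)
  qed
  then show ?thesis
    using True homog_power[OF homog_indet[of "pwt p" "param n \<tau>"], of "if a < b then p else 1"]
    by (simp add: eisenstein_def v \<tau>_def pwt_def)
next
  case False
  then have "eisenstein p n r t v = (0 :: (coord, 'a) mpoly)"
    unfolding eisenstein_def by (rule if_not_P)
  then show ?thesis by simp
qed

text \<open>The permutation of \<open>{1..n}\<close> that subtracts \<open>t\<close> modulo \<open>n\<close>.\<close>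

definition shift_perm :: "nat \<Rightarrow> nat \<Rightarrow> nat \<Rightarrow> nat" where
  "shift_perm n t a = (if a \<in> {1..n} then nat ((int a - 1 - int t) mod int n) + 1 else a)"

lemma shift_perm_range:
  assumes "n > 0" "a \<in> {1..n}"
  shows "shift_perm n t a \<in> {1..n}"
proof -
  have "0 \<le> (int a - 1 - int t) mod int n" "(int a - 1 - int t) mod int n < int n"
    using assms(1) by simp_all
  then have "nat ((int a - 1 - int t) mod int n) < n" by linarith
  then show ?thesis
    using assms(2) by (simp add: shift_perm_def)
qed

lemma shift_perm_dvd:
  assumes "n > 0" "a \<in> {1..n}"
  shows "int n dvd int t + int (shift_perm n t a) - int a"
proof -
  have "int (shift_perm n t a) = (int a - 1 - int t) mod int n + 1"
    using assms by (simp add: shift_perm_def)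
  moreover have "int n dvd (int a - 1 - int t) mod int n - (int a - 1 - int t)"
    by (metis dvd_minus_mod dvd_minus_iff minus_diff_eq)
  ultimately show ?thesis
    by (simp add: algebra_simps)
qed

lemma range_dvd_unique:
  assumes "b \<in> {1..n}" "b' \<in> {1..n}" "int n dvd x + int b" "int n dvd x + int b'"
  shows "b = b'"
proof -
  have "int n dvd int b - int b'"
    using dvd_diff[OF assms(3,4)] by simp
  moreover have "\<bar>int b - int b'\<bar> < int n"
    using assms(1,2) by auto
  ultimately show ?thesis
    by (metis abs_ge_zero dvd_abs_iff eq_iff_diff_eq_0 of_nat_eq_iff abs_eq_0 zdvd_not_zless linorder_not_le order_le_less)
qed

lemma shift_perm_permutes:
  assumes "n > 0"
  shows "shift_perm n t permutes {1..n}"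
proof (rule bij_imp_permutes)
  have inj: "inj_on (shift_perm n t) {1..n}"
  proof (rule inj_onI)
    fix a a' assume a: "a \<in> {1..n}" "a' \<in> {1..n}" "shift_perm n t a = shift_perm n t a'"
    have "int n dvd (- int t - int (shift_perm n t a)) + int a" if "a \<in> {1..n}" for a
    proof -
      have "int n dvd - (int t + int (shift_perm n t a) - int a)"
        unfolding dvd_minus_iff by (rule shift_perm_dvd[OF assms that])
      then show ?thesis by (simp add: algebra_simps)
    qed
    from this[OF a(1)] this[OF a(2)] show "a = a'"
      unfolding a(3) by (intro range_dvd_unique[OF a(1,2)])
  qed
  moreover have "shift_perm n t ` {1..n} \<subseteq> {1..n}"
    using shift_perm_range[OF assms] by auto
  ultimately have "shift_perm n t ` {1..n} = {1..n}"
    by (intro endo_inj_surj) auto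
  with inj show "bij_betw (shift_perm n t) {1..n} {1..n}"
    by (auto simp: bij_betw_def)
qed (auto simp: shift_perm_def)

lemma psubst_disc_coeff:
  assumes "\<And>i. (disc_coeff p n r i :: (coord, 'k::field) mpoly) =
           psubst of_int (\<lambda>v. if v \<in> base_indets n r then indet v else 0) (D i)"
    and "\<And>v. v \<in> base_indets n r \<Longrightarrow> x v = red (x' v)"
  shows "psubst const x (disc_coeff p n r i :: (coord, 'k) mpoly) =
    red (psubst of_int (\<lambda>v. if v \<in> base_indets n r then x' v else 0) (D i))"
  unfolding assms(1)
  by (rule rhom_int_eqI[OF rhom_compose[OF rhom_psubst_int rhom_psubst_const] rhom_compose[OF rhom_psubst_int rhom_red]])
     (simp add: assms(2) rhom.zero[OF rhom_psubst_const] rhom.zero[OF rhom_red])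

lemma (in rhom) leibniz_det: "h (leibniz_det n u) = leibniz_det n (\<lambda>i j. h (u i j))"
proof -
  have "h (if e then 1 else - 1) = (if e then 1 else - 1)" for e
    using uminus[of 1] by (simp add: one)
  then show ?thesis
    by (simp add: leibniz_det_def sum mult prod)
qed

lemma leibniz_det_cong:
  assumes "\<And>i j. i \<in> {1..n} \<Longrightarrow> j \<in> {1..n} \<Longrightarrow> u i j = u' i j"
  shows "leibniz_det n u = leibniz_det n u'"
  unfolding leibniz_det_def
proof (intro sum.cong refl arg_cong2[where f = "(*)"] prod.cong)
  fix \<pi> i assume "\<pi> \<in> {\<pi>. \<pi> permutes {1..n}}" "i \<in> {1..n}"
  then show "u i (\<pi> i) = u' i (\<pi> i)"
    using permutes_in_image[of \<pi> "{1..n}" i] by (intro assms) auto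
qed

text \<open>
  Ghost components commute with substitution, so a substitution in \<open>D\<close> acts on the entries of
  the matrix.
\<close>

lemma ghost_psubst_entries:
  assumes D: "\<And>m. m \<le> n * r \<Longrightarrow> witt_poly p m D = leibniz_det n (\<lambda>i j. witt_poly p m (entry_lift n r i j))"
    and m: "m \<le> n * r"
  shows "witt_poly p m (\<lambda>i. psubst of_int (\<lambda>v. if v \<in> base_indets n r then x v else 0) (D i)) =
    leibniz_det n (\<lambda>i j. witt_poly p m (\<lambda>s. if s \<le> n * r then x (i, j, s) else 0))"
proof -
  let ?h = "psubst of_int (\<lambda>v. if v \<in> base_indets n r then x v else 0)"
  have h: "rhom ?h" by (rule rhom_psubst_int)
  have "witt_poly p m (\<lambda>i. ?h (D i)) = leibniz_det n (\<lambda>i j. witt_poly p m (\<lambda>s. ?h (entry_lift n r i j s)))"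
    by (simp flip: rhom.witt_poly[OF h] add: D[OF m] rhom.leibniz_det[OF h])
  also have "\<dots> = leibniz_det n (\<lambda>i j. witt_poly p m (\<lambda>s. if s \<le> n * r then x (i, j, s) else 0))"
    by (intro leibniz_det_cong witt_poly_cong)
       (auto simp: entry_lift_def base_indets_def rhom.zero[OF h])
  finally show ?thesis .
qed

lemma red_of_nat_char: "CHAR('k) = p \<Longrightarrow> red (of_nat p) = (0 :: ('v, 'k::field) mpoly)"
proof -
  assume "CHAR('k) = p"
  then have "const (of_nat p :: 'k) = (0 :: ('v, 'k) mpoly)"
    using of_nat_CHAR[where 'a = 'k] by (simp add: rhom.zero[OF rhom_const])
  then show ?thesis
    by (simp add: rhom.of_nat[OF rhom_red] rhom.of_nat[OF rhom_const])
qed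

text \<open>
  The entry \<open>(a,b)\<close> is divisible by \<open>p^c\<close> for the least \<open>c\<close> with \<open>n c + a - b \<ge> t\<close>.  Along a permutation \<open>\<pi>\<close>
  these exponents add up to at least \<open>t\<close>, with equality only if \<open>\<pi>\<close> subtracts \<open>t\<close> modulo \<open>n\<close>.  So
  the determinant has valuation \<open>t\<close>, and its leading component comes from a single term, a
  product of powers of the coordinate of level \<open>t\<close>.
\<close>

lemma disc_coeff_eis:
  assumes p: "Factorial_Ring.prime p" and char: "CHAR('k::field) = p" and n: "n > 0" and t: "t < n * r"
  obtains e c where "e > 0" "c = 1 \<or> c = - 1"
    "psubst const (eisenstein p n r t) (disc_coeff p n r t :: (coord, 'k) mpoly) = c * indet (param n t) ^ e"
proof -
  obtain D :: "nat \<Rightarrow> (coord, int) mpoly"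
    where D: "\<And>m. m \<le> n * r \<Longrightarrow> witt_poly p m D = leibniz_det n (\<lambda>i j. witt_poly p m (entry_lift n r i j))"
      and \<delta>: "\<And>i. (disc_coeff p n r i :: (coord, 'k) mpoly) =
           psubst of_int (\<lambda>v. if v \<in> base_indets n r then indet v else 0) (D i)"
    using disc_coeff_lift[OF p] by blast
  let ?q = "of_nat p :: (coord, int) mpoly"
  have p0: "p > 0" using p prime_gt_0_nat by auto
  define E where "E i = psubst of_int (\<lambda>v. if v \<in> base_indets n r then eisenstein p n r t v else 0 :: (coord, int) mpoly) (D i)" for i
  have eis_red: "eisenstein p n r t v = red (eisenstein p n r t v)" for v
    by (auto simp: eisenstein_def rhom.power[OF rhom_red] rhom.zero[OF rhom_red])
  have \<delta>E: "psubst const (eisenstein p n r t) (disc_coeff p n r i :: (coord, 'k) mpoly) = red (E i)" for i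
    unfolding E_def by (rule psubst_disc_coeff[OF \<delta> eis_red])
  define M where "M a b s = (if s \<le> n * r then eisenstein p n r t (a, b, s) else 0 :: (coord, int) mpoly)" for a b s
  have wE: "witt_poly p m E = leibniz_det n (\<lambda>a b. witt_poly p m (M a b))" if "m \<le> n * r" for m
    unfolding E_def M_def by (rule ghost_psubst_entries[OF D that])
  \<comment> \<open>The least \<open>s\<close> with \<open>n s + a - b \<ge> t\<close>, that is \<open>(t + b - a) / n\<close> rounded up; with the summand
    \<open>n - 1\<close> the natural number subtraction is exact.\<close>
  define c where "c a b = (t + b + n - 1 - a) div n" for a b
  have cub: "n * s + a < t + b" if "s < c a b" "a \<in> {1..n}" "b \<in> {1..n}" for a b s
  proof -
    have "n * Suc s \<le> n * c a b"
      using that(1) by (intro mult_le_mono2) simp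
    also have "\<dots> \<le> t + b + n - 1 - a"
      unfolding c_def by simp
    finally show ?thesis using that(2,3) n by auto
  qed
  have clb: "t + b \<le> n * c a b + a" if "a \<in> {1..n}" "b \<in> {1..n}" for a b
  proof -
    have "t + b + n - 1 - a = n * c a b + (t + b + n - 1 - a) mod n"
      by (simp add: c_def)
    moreover have "(t + b + n - 1 - a) mod n \<le> n - 1"
      using n by (simp add: less_Suc_eq_le[symmetric])
    ultimately show ?thesis using that n by auto
  qed
  have M0: "M a b s = 0" if "s < c a b" "a \<in> {1..n}" "b \<in> {1..n}" for a b s
  proof -
    have "level n (a, b, s) < int t"
      using cub[OF that] by (simp add: level_def flip: of_nat_mult of_nat_add)
    then show ?thesis by (simp add: M_def eisenstein_def)
  qed
  have in_range: "\<pi> a \<in> {1..n}" if "\<pi> permutes {1..n}" "a \<in> {1..n}" for \<pi> a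
    using permutes_in_image[OF that(1)] that(2) by simp
  \<comment> \<open>Sum \<open>n c + a - \<pi> a \<ge> t\<close> over the rows: \<open>a\<close> and \<open>\<pi> a\<close> cancel, and equality forces \<open>n\<close> to
    divide \<open>t + \<pi> a - a\<close> in each row.\<close>
  have sumc: "t \<le> (\<Sum>a\<in>{1..n}. c a (\<pi> a))"
    and sumc_eq: "(\<Sum>a\<in>{1..n}. c a (\<pi> a)) = t \<Longrightarrow> \<pi> = shift_perm n t" if \<pi>: "\<pi> permutes {1..n}" for \<pi>
  proof -
    have perm: "(\<Sum>a\<in>{1..n}. \<pi> a) = (\<Sum>a\<in>{1..n}. a)"
      using sum.permute[OF \<pi>, of "\<lambda>x. x"] by (simp add: comp_def)
    have le: "t + \<pi> a \<le> n * c a (\<pi> a) + a" if "a \<in> {1..n}" for a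
      using clb[OF that in_range[OF \<pi> that]] .
    have "(\<Sum>a\<in>{1..n}. t + \<pi> a) \<le> (\<Sum>a\<in>{1..n}. n * c a (\<pi> a) + a)"
      by (rule sum_mono[OF le])
    then have "n * t \<le> n * (\<Sum>a\<in>{1..n}. c a (\<pi> a))"
      using perm by (simp add: sum.distrib sum_distrib_left)
    then show "t \<le> (\<Sum>a\<in>{1..n}. c a (\<pi> a))"
      using n by simp
    assume eq: "(\<Sum>a\<in>{1..n}. c a (\<pi> a)) = t"
    have "(\<Sum>a\<in>{1..n}. n * c a (\<pi> a) + a) = (\<Sum>a\<in>{1..n}. t + \<pi> a)"
      using perm eq by (simp add: sum.distrib flip: sum_distrib_left)
    then have eqa: "n * c a (\<pi> a) + a = t + \<pi> a" if "a \<in> {1..n}" for a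
      using sum_mono_inv[of "\<lambda>a. t + \<pi> a" "{1..n}" "\<lambda>a. n * c a (\<pi> a) + a" a] le that by auto
    show "\<pi> = shift_perm n t"
    proof
      fix a
      show "\<pi> a = shift_perm n t a"
      proof (cases "a \<in> {1..n}")
        case True
        have "int t - int a + int (\<pi> a) = int n * int (c a (\<pi> a))"
          using arg_cong[OF eqa[OF True], of int] by simp
        then have "int n dvd int t - int a + int (\<pi> a)" by simp
        moreover have "int n dvd int t - int a + int (shift_perm n t a)"
          using shift_perm_dvd[OF n True, of t] by (simp add: algebra_simps)
        ultimately show ?thesis
          using range_dvd_unique[OF in_range[OF \<pi> True] shift_perm_range[OF n True]] by blast
      next
        case False
        then show ?thesis
          using permutes_not_in[OF \<pi>] by (auto simp: shift_perm_def)
      qed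
    qed
  qed
  let ?\<pi> = "shift_perm n t"
  have \<pi>p: "?\<pi> permutes {1..n}" by (rule shift_perm_permutes[OF n])
  have \<pi>eq: "n * c a (?\<pi> a) + a = t + ?\<pi> a" if a: "a \<in> {1..n}" for a
  proof -
    have r: "?\<pi> a \<in> {1..n}" by (rule shift_perm_range[OF n a])
    obtain q where q: "int t + int (?\<pi> a) - int a = int n * q"
      using shift_perm_dvd[OF n a, of t] by (elim dvdE)
    have "int n * q > - int n"
      using q a r by auto
    have "q \<ge> 0"
    proof (rule ccontr)
      assume "\<not> q \<ge> 0"
      then have "int n * q \<le> int n * (- 1)"
        by (intro mult_left_mono) auto
      with \<open>int n * q > - int n\<close> show False by simp
    qed
    then obtain q' where q': "q = int q'"
      using nonneg_int_cases by blast
    have eq: "t + ?\<pi> a = n * q' + a"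
      using q unfolding q' by (metis add_diff_cancel_right' diff_add_cancel of_nat_add of_nat_eq_iff of_nat_mult)
    then have "t + ?\<pi> a + n - 1 - a = n * q' + (n - 1)"
      using n by simp
    then have "c a (?\<pi> a) = (n * q' + (n - 1)) div n"
      by (simp only: c_def)
    also have "\<dots> = q'"
      using n by (intro div_nat_eqI) (simp_all add: algebra_simps)
    finally have "c a (?\<pi> a) = q'" .
    then show ?thesis using eq by simp
  qed
  have \<pi>sum: "(\<Sum>a\<in>{1..n}. c a (?\<pi> a)) = t"
  proof -
    have perm: "(\<Sum>a\<in>{1..n}. ?\<pi> a) = (\<Sum>a\<in>{1..n}. a)"
      using sum.permute[OF \<pi>p, of "\<lambda>x. x"] by (simp add: comp_def)
    have "(\<Sum>a\<in>{1..n}. n * c a (?\<pi> a) + a) = (\<Sum>a\<in>{1..n}. t + ?\<pi> a)"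
      by (rule sum.cong[OF refl \<pi>eq])
    then have "n * (\<Sum>a\<in>{1..n}. c a (?\<pi> a)) = n * t"
      using perm by (simp add: sum.distrib sum_distrib_left)
    then show ?thesis using n by simp
  qed
  have dvd_entry: "?q ^ c a b dvd witt_poly p m (M a b)" if "a \<in> {1..n}" "b \<in> {1..n}" for a b m
    by (rule ghost_leading_dvd[OF M0[OF _ that] p0])
  have dvd_term: "?q ^ (\<Sum>a\<in>{1..n}. c a (\<pi> a)) dvd (\<Prod>a\<in>{1..n}. witt_poly p m (M a (\<pi> a)))"
    if "\<pi> permutes {1..n}" for \<pi> m
    unfolding power_sum by (rule prod_dvd_prod) (rule dvd_entry[OF _ in_range[OF that]])
  have low: "?q ^ Suc m dvd witt_poly p m E" if m: "m < t" for m
  proof -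
    have "?q ^ Suc m dvd leibniz_det n (\<lambda>a b. witt_poly p m (M a b))"
      unfolding leibniz_det_def
    proof (intro dvd_sum dvd_mult)
      fix \<pi> assume "\<pi> \<in> {\<pi>. \<pi> permutes {1..n}}"
      then have \<pi>: "\<pi> permutes {1..n}" by simp
      have "Suc m \<le> (\<Sum>a\<in>{1..n}. c a (\<pi> a))"
        using sumc[OF \<pi>] m by simp
      then show "?q ^ Suc m dvd (\<Prod>a\<in>{1..n}. witt_poly p m (M a (\<pi> a)))"
        using dvd_term[OF \<pi>] le_imp_power_dvd dvd_trans by blast
    qed
    then show ?thesis
      using wE[of m] m t by simp
  qed
  define sg :: "(coord, int) mpoly" where "sg = (if evenperm ?\<pi> then 1 else - 1)"
  define e where "e = (\<Sum>a\<in>{1..n}. (if a < ?\<pi> a then p else 1) * p ^ (t - c a (?\<pi> a)))"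
  have e0: "e > 0"
    unfolding e_def using n p0 by (intro sum_pos) auto
  have lead: "M a (?\<pi> a) (c a (?\<pi> a)) = indet (param n t) ^ (if a < ?\<pi> a then p else 1)" if a: "a \<in> {1..n}" for a
  proof -
    have lev: "level n (a, ?\<pi> a, c a (?\<pi> a)) = int t"
      using arg_cong[OF \<pi>eq[OF a], of int] by (simp add: level_def)
    have "c a (?\<pi> a) \<le> t"
      using member_le_sum[of a "{1..n}" "\<lambda>a. c a (?\<pi> a)"] a \<pi>sum by simp
    then have "c a (?\<pi> a) \<le> n * r" using t by simp
    moreover have "int t < int (n * r)" using t by (simp only: of_nat_less_iff)
    ultimately show ?thesis
      by (simp only: M_def eisenstein_def lev nat_int) simp
  qed
  have main: "?q ^ Suc t dvd (\<Prod>a\<in>{1..n}. witt_poly p t (M a (?\<pi> a))) - ?q ^ t * indet (param n t) ^ e"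
  proof -
    have "?q ^ Suc (\<Sum>a\<in>{1..n}. c a (?\<pi> a)) dvd (\<Prod>a\<in>{1..n}. witt_poly p t (M a (?\<pi> a)))
        - ?q ^ (\<Sum>a\<in>{1..n}. c a (?\<pi> a)) * (\<Prod>a\<in>{1..n}. M a (?\<pi> a) (c a (?\<pi> a)) ^ (p ^ (t - c a (?\<pi> a))))"
    proof (rule prod_dvd_leading)
      fix a assume a: "a \<in> {1..n}"
      have ct: "c a (?\<pi> a) \<le> t"
        using member_le_sum[of a "{1..n}" "\<lambda>a. c a (?\<pi> a)"] a \<pi>sum by simp
      show "?q ^ c a (?\<pi> a) dvd witt_poly p t (M a (?\<pi> a))"
        by (rule dvd_entry[OF a in_range[OF \<pi>p a]])
      show "?q ^ Suc (c a (?\<pi> a)) dvd witt_poly p t (M a (?\<pi> a)) - ?q ^ c a (?\<pi> a) * M a (?\<pi> a) (c a (?\<pi> a)) ^ (p ^ (t - c a (?\<pi> a)))"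
        by (rule ghost_leading_term[OF M0[OF _ a in_range[OF \<pi>p a]] ct p0])
    qed simp
    moreover have "(\<Prod>a\<in>{1..n}. M a (?\<pi> a) (c a (?\<pi> a)) ^ (p ^ (t - c a (?\<pi> a)))) = indet (param n t) ^ e"
      unfolding e_def power_sum by (intro prod.cong refl) (simp add: lead flip: power_mult)
    ultimately show ?thesis
      unfolding \<pi>sum by simp
  qed
  have "?q ^ Suc t dvd witt_poly p t E - sg * (?q ^ t * indet (param n t) ^ e)"
  proof -
    let ?term = "\<lambda>\<pi>. (if evenperm \<pi> then 1 else - 1) * (\<Prod>a\<in>{1..n}. witt_poly p t (M a (\<pi> a)))"
    have "witt_poly p t E = (\<Sum>\<pi>\<in>{\<pi>. \<pi> permutes {1..n}}. ?term \<pi>)"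
      using wE[of t] t by (simp add: leibniz_det_def)
    also have "\<dots> = ?term ?\<pi> + (\<Sum>\<pi>\<in>{\<pi>. \<pi> permutes {1..n}} - {?\<pi>}. ?term \<pi>)"
      by (rule sum.remove) (use \<pi>p in \<open>auto simp: finite_permutations\<close>)
    finally have "witt_poly p t E - sg * (?q ^ t * indet (param n t) ^ e) =
        sg * ((\<Prod>a\<in>{1..n}. witt_poly p t (M a (?\<pi> a))) - ?q ^ t * indet (param n t) ^ e)
        + (\<Sum>\<pi>\<in>{\<pi>. \<pi> permutes {1..n}} - {?\<pi>}. ?term \<pi>)"
      by (simp add: sg_def right_diff_distrib)
    moreover have "?q ^ Suc t dvd (\<Sum>\<pi>\<in>{\<pi>. \<pi> permutes {1..n}} - {?\<pi>}. ?term \<pi>)"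
    proof (intro dvd_sum dvd_mult)
      fix \<pi> assume "\<pi> \<in> {\<pi>. \<pi> permutes {1..n}} - {?\<pi>}"
      then have \<pi>: "\<pi> permutes {1..n}" "\<pi> \<noteq> ?\<pi>" by auto
      then have "Suc t \<le> (\<Sum>a\<in>{1..n}. c a (\<pi> a))"
        using sumc[OF \<pi>(1)] sumc_eq[OF \<pi>(1)] by fastforce
      then show "?q ^ Suc t dvd (\<Prod>a\<in>{1..n}. witt_poly p t (M a (\<pi> a)))"
        using dvd_term[OF \<pi>(1)] le_imp_power_dvd dvd_trans by blast
    qed
    ultimately show ?thesis
      using dvd_add[OF dvd_mult[OF main, of sg]] by simp
  qed
  moreover have "?q ^ Suc t dvd witt_poly p t E - ?q ^ t * E t"
    by (rule ghost_dvd_leading(2)[OF p low])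
  ultimately have "?q ^ Suc t dvd (witt_poly p t E - sg * (?q ^ t * indet (param n t) ^ e)) - (witt_poly p t E - ?q ^ t * E t)"
    by (rule dvd_diff)
  then obtain x where "(witt_poly p t E - sg * (?q ^ t * indet (param n t) ^ e)) - (witt_poly p t E - ?q ^ t * E t) = ?q ^ Suc t * x"
    by (elim dvdE)
  then have "of_nat (p ^ t) * (E t - sg * indet (param n t) ^ e - ?q * x) = 0"
    by (simp add: algebra_simps)
  from mpoly_int_torsion_free[OF this] p0 have "E t = sg * indet (param n t) ^ e + ?q * x"
    by (simp add: algebra_simps)
  then have "(red (E t) :: (coord, 'k) mpoly) = red sg * indet (param n t) ^ e + red ?q * red x"
    by (simp add: rhom.add[OF rhom_red] rhom.mult[OF rhom_red] rhom.power[OF rhom_red])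
  then have "psubst const (eisenstein p n r t) (disc_coeff p n r t :: (coord, 'k) mpoly) = red sg * indet (param n t) ^ e"
    by (simp add: \<delta>E red_of_nat_char[OF char])
  moreover have "red sg = (1 :: (coord, 'k) mpoly) \<or> red sg = (- 1 :: (coord, 'k) mpoly)"
    by (simp add: sg_def rhom.uminus[OF rhom_red] rhom.one[OF rhom_red])
  ultimately show thesis
    using that e0 by blast
qed

lemma homog_of_int [simp]: "homog wt 0 (of_int z)"
  by (cases z rule: int_diff_cases) (simp add: homog_diff)

lemma homog_uminus_one: "homog wt 0 (- 1)"
  by (simp add: homog_uminus)

lemma homog_torsion_free:
  fixes f :: "('v, int) mpoly"
  assumes "homog wt w (of_nat c * f)" "c > 0"
  shows "homog wt w f"
proof -
  have "of_nat c * (Polynomial.coeff (wgrade wt f) k - Polynomial.coeff (Polynomial.monom f w) k) = 0" for k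
  proof -
    have "of_nat c * wgrade wt f = of_nat c * Polynomial.monom f w"
      using assms(1) by (simp add: homog_def rhom.mult[OF rhom_wgrade] rhom.of_nat[OF rhom_wgrade] of_nat_poly smult_monom)
    then have "Polynomial.coeff (of_nat c * wgrade wt f) k = Polynomial.coeff (of_nat c * Polynomial.monom f w) k"
      by simp
    then show ?thesis
      by (simp add: of_nat_poly right_diff_distrib)
  qed
  then show ?thesis
    unfolding homog_def using assms(2) by (intro poly_eqI) (metis mpoly_int_torsion_free eq_iff_diff_eq_0 not_gr_zero)
qed

lemma homog_witt_poly:
  assumes "\<And>i. i \<le> m \<Longrightarrow> homog wt (w * p ^ i) (u i)"
  shows "homog wt (w * p ^ m) (witt_poly p m u)"
  unfolding witt_poly_def
proof (rule homog_sum)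
  fix i assume i: "i \<in> {..m}"
  have "homog wt (0 + (w * p ^ i) * p ^ (m - i)) (of_nat (p ^ i) * u i ^ (p ^ (m - i)))"
    using i assms by (intro homog_mult homog_power homog_of_nat) auto
  then show "homog wt (w * p ^ m) (of_nat (p ^ i) * u i ^ (p ^ (m - i)))"
    using i by (simp add: mult.assoc flip: power_add)
qed

lemma homog_leibniz_det:
  assumes "\<And>i j. i \<in> {1..n} \<Longrightarrow> j \<in> {1..n} \<Longrightarrow> homog wt w (u i j)"
  shows "homog wt (n * w) (leibniz_det n u)"
  unfolding leibniz_det_def
proof (rule homog_sum)
  fix \<pi> assume "\<pi> \<in> {\<pi>. \<pi> permutes {1..n}}"
  then have "\<pi> i \<in> {1..n}" if "i \<in> {1..n}" for i
    using permutes_in_image[of \<pi> "{1..n}" i] that by simp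
  then have "homog wt (0 + (\<Sum>i\<in>{1..n}. w)) ((if evenperm \<pi> then 1 else - 1) * (\<Prod>i\<in>{1..n}. u i (\<pi> i)))"
    by (intro homog_mult homog_prod assms) (auto simp: homog_uminus_one)
  then show "homog wt (n * w) ((if evenperm \<pi> then 1 else - 1) * (\<Prod>i\<in>{1..n}. u i (\<pi> i)))"
    by simp
qed

text \<open>
  The ghost component \<open>m\<close> of an entry is homogeneous of weight \<open>p^m\<close>, so that of the determinant has
  weight \<open>n p^m\<close>; solve for \<open>D\<^sub>m\<close>.
\<close>

lemma homog_disc_coeff:
  assumes p: "Factorial_Ring.prime p" and "i \<le> n * r"
  shows "homog (pwt p) (n * p ^ i) (disc_coeff p n r i :: (coord, 'k::field) mpoly)"
proof -
  obtain D :: "nat \<Rightarrow> (coord, int) mpoly"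
    where D: "\<And>m. m \<le> n * r \<Longrightarrow> witt_poly p m D = leibniz_det n (\<lambda>i j. witt_poly p m (entry_lift n r i j))"
      and \<delta>: "\<And>i. (disc_coeff p n r i :: (coord, 'k) mpoly) =
           psubst of_int (\<lambda>v. if v \<in> base_indets n r then indet v else 0) (D i)"
    using disc_coeff_lift[OF p] by blast
  have p0: "p > 0" using p prime_gt_0_nat by auto
  have "homog (pwt p) (n * p ^ m) (D m)" if "m \<le> n * r" for m
    using that
  proof (induction m rule: less_induct)
    case (less m)
    have ent: "homog (pwt p) (1 * p ^ s) (entry_lift n r i j s)" for i j s
    proof -
      have "homog (pwt p) (pwt p (i, j, s)) (indet (i, j, s) :: (coord, int) mpoly)"
        by (rule homog_indet)
      then show ?thesis by (simp add: entry_lift_def) (simp add: pwt_def)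
    qed
    have "homog (pwt p) (n * (1 * p ^ m)) (witt_poly p m D)"
      unfolding D[OF less.prems] by (intro homog_leibniz_det homog_witt_poly ent)
    moreover have "homog (pwt p) (n * p ^ m) (\<Sum>i<m. of_nat p ^ i * D i ^ (p ^ (m - i)))"
    proof (rule homog_sum)
      fix i assume i: "i \<in> {..<m}"
      have "homog (pwt p) (0 + (n * p ^ i) * p ^ (m - i)) (of_nat (p ^ i) * D i ^ (p ^ (m - i)))"
        using i less by (intro homog_mult homog_power homog_of_nat) auto
      then show "homog (pwt p) (n * p ^ m) (of_nat p ^ i * D i ^ (p ^ (m - i)))"
        using i by (simp add: mult.assoc flip: power_add)
    qed
    ultimately have "homog (pwt p) (n * p ^ m) (witt_poly p m D - (\<Sum>i<m. of_nat p ^ i * D i ^ (p ^ (m - i))))"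
      by (intro homog_diff) simp_all
    then have "homog (pwt p) (n * p ^ m) (of_nat (p ^ m) * D m)"
      by (simp add: witt_poly_split)
    then show ?case
      by (rule homog_torsion_free) (use p0 in simp)
  qed
  then have "homog (pwt p) (n * p ^ i) (D i)"
    using assms(2) .
  then show ?thesis
    unfolding \<delta>
    by (rule psubst_homog[where V = UNIV]) (auto simp: rhom_of_int homog_indet polys_in_def)
qed

lemma polys_in_disc_coeff:
  assumes "Factorial_Ring.prime p"
  shows "(disc_coeff p n r i :: (coord, 'k::field) mpoly) \<in> polys_in (base_indets n r)"
proof -
  have "\<exists>D. (disc_coeff p n r i :: (coord, 'k) mpoly) = psubst of_int (\<lambda>v. if v \<in> base_indets n r then indet v else 0) D"
    by (rule disc_coeff_lift[OF assms, of n r]) blast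
  then show ?thesis
    by (auto intro!: polys_in_psubst[of _ UNIV] simp: polys_in_def[of UNIV])
qed

lemma finite_base_indets: "finite (base_indets n r)"
  by (simp add: base_indets_def)

lemma card_base_indets: "card (base_indets n r) = n\<^sup>2 * (n * r + 1)"
  by (simp add: base_indets_def card_cartesian_product power2_eq_square algebra_simps)

lemma card_free_params:
  assumes "n > 0"
  shows "card (base_indets n r - param n ` {..<n * r}) = n\<^sup>2 * (n * r + 1) - n * r"
proof -
  have "param n ` {..<n * r} \<subseteq> base_indets n r"
    using param_in_base[OF assms] by auto
  moreover have "card (param n ` {..<n * r}) = n * r"
    using card_image[of "param n" "{..<n * r}"] inj_param[OF assms] by (auto intro: inj_on_subset)
  ultimately show ?thesis
    by (subst card_Diff_subset) (auto simp: card_base_indets)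
qed

text \<open>
  The \<open>\<theta>\<^sub>v\<close> are the equations of the space of matrices of multiplication by \<open>\<Sum>\<^sub>j y\<^sub>j \<pi>^j\<close>.  On that space
  \<open>disc_coeff_eis\<close> shows, level by level, that the coordinates are nilpotent modulo the \<open>\<delta>\<^sub>i\<close>.
\<close>

lemma disc_graded_system:
  assumes p: "Factorial_Ring.prime p" and char: "CHAR('k::field) = p" and n: "n > 0"
  shows "graded_system (base_indets n r) (pwt p)
     {..<n * r} (disc_coeff p n r :: nat \<Rightarrow> (coord, 'k) mpoly) (\<lambda>i. n * p ^ i)
     (base_indets n r - param n ` {..<n * r}) (\<lambda>v. indet v - eisenstein p n r 0 v) (pwt p)"
proof
  let ?S = "base_indets n r"
  let ?L = "?S - param n ` {..<n * r}"
  let ?\<delta> = "disc_coeff p n r :: nat \<Rightarrow> (coord, 'k) mpoly"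
  let ?\<theta> = "\<lambda>v. indet v - eisenstein p n r 0 v :: (coord, 'k) mpoly"
  let ?J = "sum_ideal (comb_in ?S {..<n * r} ?\<delta>) (comb_in ?S ?L ?\<theta>)"
  let ?K = "rad_in ?S ?J"
  have p0: "p > 0" using p prime_gt_0_nat by auto
  show "finite ?S" "finite {..<n * r}" "finite ?L"
    by (simp_all add: finite_base_indets)
  show "0 < pwt p v" for v
    using p0 by (cases v) (simp add: pwt_def)
  show "0 < pwt p v" for v
    using p0 by (cases v) (simp add: pwt_def)
  show \<delta>_in: "?\<delta> i \<in> polys_in ?S" for i
    by (rule polys_in_disc_coeff[OF p])
  show "homog (pwt p) (n * p ^ i) (?\<delta> i)" if "i \<in> {..<n * r}" for i
    using that by (intro homog_disc_coeff[OF p]) auto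
  show \<theta>_in: "?\<theta> v \<in> polys_in ?S" if "v \<in> ?L" for v
    using that by (intro polys_in_diff polys_in_indet polys_in_eis[OF n]) auto
  show "homog (pwt p) (pwt p v) (?\<theta> v)" if "v \<in> ?L" for v
    using that by (intro homog_diff homog_indet homog_eis[OF n]) auto
  have J\<delta>: "ideal_in ?S (comb_in ?S {..<n * r} ?\<delta>)" and J\<theta>: "ideal_in ?S (comb_in ?S ?L ?\<theta>)"
    by (intro ideal_in_comb_in \<delta>_in \<theta>_in; assumption)+
  have J: "ideal_in ?S ?J" and K: "ideal_in ?S ?K"
    by (intro ideal_in_rad_in ideal_in_sum_ideal J\<delta> J\<theta>)+
  have \<delta>K: "?\<delta> i \<in> ?K" if "i < n * r" for i
    using that by (intro subset_rad_in[OF J] sum_ideal_left[OF J\<theta>] generator_in_comb_in) auto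
  have \<theta>K: "?\<theta> v \<in> ?K" if "v \<in> ?S" for v
  proof (cases "v \<in> ?L")
    case True
    then show ?thesis
      by (intro subset_rad_in[OF J] sum_ideal_right[OF J\<delta>] generator_in_comb_in[where \<delta> = ?\<theta>])
         (auto simp: finite_base_indets)
  next
    case False
    then show ?thesis
      using that n ideal_inD(2)[OF K] by (auto simp: eis_param)
  qed
  \<comment> \<open>Modulo the \<open>\<theta>\<^sub>v\<close> and the coordinates of lower level, \<open>\<delta>\<^sub>\<tau>\<close> is, up to sign, a power of the
    coordinate of level \<open>\<tau>\<close>.\<close>
  have yK: "indet (param n \<tau>) \<in> ?K" if "\<tau> < n * r" for \<tau>
    using that
  proof (induction \<tau> rule: less_induct)
    case (less t)
    obtain e c where ec: "e > 0" "c = 1 \<or> c = - 1"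
      "psubst const (eisenstein p n r t) (?\<delta> t) = c * indet (param n t) ^ e"
      using disc_coeff_eis[OF p char n less.prems] by blast
    have diff: "indet v - eisenstein p n r t v \<in> ?K" if v: "v \<in> ?S" for v
    proof -
      have "eisenstein p n r 0 v - eisenstein p n r t v \<in> ?K"
      proof (cases "0 \<le> level n v \<and> level n v < int t \<and> level n v < int (n * r)")
        case True
        then have "nat (level n v) < t" "nat (level n v) < n * r" by linarith+
        then have "indet (param n (nat (level n v))) \<in> ?K"
          using less.IH by auto
        then show ?thesis
          using True p0 rad_in_power[OF J] by (auto simp: eisenstein_def)
      next
        case False
        then have "eisenstein p n r 0 v - eisenstein p n r t v = (0 :: (coord, 'k) mpoly)"
          by (auto simp: eisenstein_def)
        then show ?thesis
          using ideal_inD(2)[OF K] by simp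
      qed
      from ideal_inD(3)[OF K \<theta>K[OF v] this] show ?thesis by simp
    qed
    have "psubst const indet (?\<delta> t) - psubst const (eisenstein p n r t) (?\<delta> t) \<in> ?K"
      by (rule ideal_in_psubst_diff[OF K \<delta>_in[of t]]) (auto intro: polys_in_eis[OF n] diff)
    then have "?\<delta> t - c * indet (param n t) ^ e \<in> ?K"
      by (simp only: psubst_indet_id ec(3))
    from ideal_in_diff[OF K \<delta>K[OF less.prems] this] have "c * indet (param n t) ^ e \<in> ?K"
      by simp
    then have "indet (param n t) ^ e \<in> ?K"
      using ec(2) ideal_in_uminus[OF K] by force
    then show ?case
      by (rule rad_in_power_cancel) (use param_in_base[OF n less.prems] in simp)
  qed
  show "\<exists>k. indet v ^ k \<in> ?J" if v: "v \<in> ?S" for v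
  proof -
    have "eisenstein p n r 0 v \<in> ?K"
    proof (cases "0 \<le> level n v \<and> level n v < int (n * r)")
      case True
      then have "nat (level n v) < n * r" by linarith
      then have "indet (param n (nat (level n v))) \<in> ?K" by (rule yK)
      then show ?thesis
        using True p0 rad_in_power[OF J] by (auto simp: eisenstein_def)
    next
      case False
      then have "eisenstein p n r 0 v = (0 :: (coord, 'k) mpoly)"
        by (auto simp: eisenstein_def)
      then show ?thesis using ideal_inD(2)[OF K] by simp
    qed
    from ideal_inD(3)[OF K \<theta>K[OF v] this] have "indet v \<in> ?K" by simp
    then show ?thesis by (auto simp: rad_in_def)
  qed
qed

section \<open>A long chain of primes on the scheme of bases\<close>

text \<open>
  Composing with the transposition of the two rows shows that the determinant is its own
  negative, and there is no \<open>2\<close>-torsion.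
\<close>

lemma leibniz_det_equal_rows:
  fixes u :: "nat \<Rightarrow> nat \<Rightarrow> ('v, int) mpoly"
  assumes "l \<in> {1..n}" "l' \<in> {1..n}" "l \<noteq> l'" "\<And>j. j \<in> {1..n} \<Longrightarrow> u l j = u l' j"
  shows "leibniz_det n u = 0"
proof -
  let ?\<tau> = "transpose l l'"
  let ?t = "\<lambda>\<pi>. (if evenperm \<pi> then 1 else - 1) * (\<Prod>i\<in>{1..n}. u i (\<pi> i))"
  have \<tau>: "?\<tau> permutes {1..n}"
    using assms by (intro permutes_swap_id) auto
  have "leibniz_det n u = (\<Sum>\<pi>\<in>{\<pi>. \<pi> permutes {1..n}}. ?t (\<pi> \<circ> ?\<tau>))"
    unfolding leibniz_det_def
    by (rule sum.reindex_bij_witness[where i = "\<lambda>\<pi>. \<pi> \<circ> ?\<tau>" and j = "\<lambda>\<pi>. \<pi> \<circ> ?\<tau>"])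
       (use permutes_compose[OF \<tau>] in \<open>auto simp: comp_assoc\<close>)
  also have "\<dots> = (\<Sum>\<pi>\<in>{\<pi>. \<pi> permutes {1..n}}. - ?t \<pi>)"
  proof (rule sum.cong[OF refl])
    fix \<pi> assume "\<pi> \<in> {\<pi>. \<pi> permutes {1..n}}"
    then have \<pi>: "\<pi> permutes {1..n}" by simp
    have "permutation \<pi>" "permutation ?\<tau>"
      using \<pi> \<tau> by (auto simp: permutation_permutes)
    then have even: "evenperm (\<pi> \<circ> ?\<tau>) \<longleftrightarrow> \<not> evenperm \<pi>"
      using assms(3) by (simp add: evenperm_comp evenperm_swap)
    have "(\<Prod>i\<in>{1..n}. u i ((\<pi> \<circ> ?\<tau>) i)) = (\<Prod>i\<in>{1..n}. u (?\<tau> i) ((\<pi> \<circ> ?\<tau>) i))"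
    proof (rule prod.cong[OF refl])
      fix i assume "i \<in> {1..n}"
      then have "(\<pi> \<circ> ?\<tau>) i \<in> {1..n}"
        using permutes_compose[OF \<tau> \<pi>] permutes_in_image by metis
      then show "u i ((\<pi> \<circ> ?\<tau>) i) = u (?\<tau> i) ((\<pi> \<circ> ?\<tau>) i)"
        using assms(4)[of "(\<pi> \<circ> ?\<tau>) i"] unfolding transpose_def by (auto split: if_splits)
    qed
    also have "\<dots> = (\<Prod>i\<in>{1..n}. u i (\<pi> i))"
      using prod.permute[OF \<tau>, of "\<lambda>i. u i (\<pi> i)"] by (simp add: comp_def)
    finally show "?t (\<pi> \<circ> ?\<tau>) = - ?t \<pi>"
      unfolding even by simp
  qed
  also have "\<dots> = - leibniz_det n u"
    by (simp add: leibniz_det_def sum_negf)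
  finally have "leibniz_det n u + leibniz_det n u = 0"
    by (rule eq_neg_iff_add_eq_0[THEN iffD1])
  then have "of_nat 2 * leibniz_det n u = 0"
    by (simp only: of_nat_numeral mult_2)
  then show ?thesis
    by (rule mpoly_int_torsion_free) simp
qed

lemma leibniz_det_row_combination:
  fixes u :: "nat \<Rightarrow> nat \<Rightarrow> ('v, int) mpoly"
  assumes n: "n > 0" and comb: "\<And>j. j \<in> {1..n} \<Longrightarrow> u n j = (\<Sum>l\<in>{1..<n}. c l * u l j)"
  shows "leibniz_det n u = 0"
proof -
  have split: "(\<Prod>i\<in>{1..n}. w i (\<pi> i)) = w n (\<pi> n) * (\<Prod>i\<in>{1..<n}. w i (\<pi> i))" for w :: "nat \<Rightarrow> nat \<Rightarrow> ('v, int) mpoly" and \<pi>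
  proof -
    have "{1..n} = insert n {1..<n}" using n by auto
    then show ?thesis by simp
  qed
  have "leibniz_det n u = (\<Sum>\<pi> | \<pi> permutes {1..n}. \<Sum>l\<in>{1..<n}. c l *
      ((if evenperm \<pi> then 1 else - 1) * (\<Prod>i\<in>{1..n}. (u(n := u l)) i (\<pi> i))))"
    unfolding leibniz_det_def split
  proof (rule sum.cong[OF refl])
    fix \<pi> assume "\<pi> \<in> {\<pi>. \<pi> permutes {1..n}}"
    then have "\<pi> n \<in> {1..n}"
      using permutes_in_image[of \<pi> "{1..n}" n] n by simp
    then show "(if evenperm \<pi> then 1 else - 1) * (u n (\<pi> n) * (\<Prod>i\<in>{1..<n}. u i (\<pi> i))) =
       (\<Sum>l\<in>{1..<n}. c l * ((if evenperm \<pi> then 1 else - 1) *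
          ((u(n := u l)) n (\<pi> n) * (\<Prod>i\<in>{1..<n}. (u(n := u l)) i (\<pi> i)))))"
      by (simp add: comb sum_distrib_left sum_distrib_right mult_ac sum_negf)
  qed
  also have "\<dots> = (\<Sum>l\<in>{1..<n}. c l * leibniz_det n (u(n := u l)))"
    unfolding leibniz_det_def sum_distrib_left by (rule sum.swap)
  also have "\<dots> = 0"
  proof (intro sum.neutral ballI)
    fix l assume "l \<in> {1..<n}"
    then have "leibniz_det n (u(n := u l)) = 0"
      by (intro leibniz_det_equal_rows[of l n n]) auto
    then show "c l * leibniz_det n (u(n := u l)) = 0" by simp
  qed
  finally show ?thesis .
qed

lemma leibniz_det_diagonal:
  assumes "\<And>i j. i \<in> {1..n} \<Longrightarrow> j \<in> {1..n} \<Longrightarrow> i \<noteq> j \<Longrightarrow> u i j = 0"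
  shows "leibniz_det n u = (\<Prod>i\<in>{1..n}. u i i)"
proof -
  have "leibniz_det n u = (\<Sum>\<pi>\<in>{id}. (if evenperm \<pi> then 1 else - 1) * (\<Prod>i\<in>{1..n}. u i (\<pi> i)))"
    unfolding leibniz_det_def
  proof (rule sum.mono_neutral_right)
    show "\<forall>\<pi>\<in>{\<pi>. \<pi> permutes {1..n}} - {id}. (if evenperm \<pi> then 1 else - 1) * (\<Prod>i\<in>{1..n}. u i (\<pi> i)) = 0"
    proof
      fix \<pi> assume "\<pi> \<in> {\<pi>. \<pi> permutes {1..n}} - {id}"
      then have \<pi>: "\<pi> permutes {1..n}" "\<pi> \<noteq> id" by auto
      then obtain i where i: "\<pi> i \<noteq> i" by (auto simp: fun_eq_iff)
      then have "i \<in> {1..n}"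
        using permutes_not_in[OF \<pi>(1)] by blast
      moreover from this have "\<pi> i \<in> {1..n}"
        using permutes_in_image[OF \<pi>(1)] by simp
      ultimately have "u i (\<pi> i) = 0"
        using i assms[of i "\<pi> i"] by simp
      then have "(\<Prod>i\<in>{1..n}. u i (\<pi> i)) = 0"
        using \<open>i \<in> {1..n}\<close> by (intro prod_zero) auto
      then show "(if evenperm \<pi> then 1 else - 1) * (\<Prod>i\<in>{1..n}. u i (\<pi> i)) = 0"
        by simp
    qed
  qed (auto simp: finite_permutations permutes_id)
  then show ?thesis by simp
qed

text \<open>
  The lower components of the last diagonal entry are the dependent variables: the equations
  \<open>\<delta>\<^sub>0 = \<dots> = \<delta>\<^bsub>nr-1\<^esub> = 0\<close> are solved for them.
\<close>

definition free_indets :: "nat \<Rightarrow> nat \<Rightarrow> coord set" where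
  "free_indets n r = base_indets n r - {(n, n, s) | s. s < n * r}"

lemma card_free_indets:
  assumes "n > 0"
  shows "card (free_indets n r) = n\<^sup>2 * (n * r + 1) - n * r"
proof -
  have eq: "{(n, n, s) | s. s < n * r} = (\<lambda>s. (n, n, s)) ` {..<n * r}" by auto
  have "card {(n, n, s) | s. s < n * r} = n * r"
    unfolding eq by (subst card_image) (auto simp: inj_on_def)
  moreover have "{(n, n, s) | s. s < n * r} \<subseteq> base_indets n r"
    using assms by (auto simp: base_indets_def)
  ultimately show ?thesis
    unfolding free_indets_def using finite_base_indets[of n r]
    by (subst card_Diff_subset) (auto simp: card_base_indets intro: finite_subset)
qed

text \<open>
  The components of the matrix \<open>diag(1, \<dots>, 1, p^(nr))\<close>: the first component of an entry \<open>1\<close> is \<open>1\<close>, and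
  the component \<open>nr\<close> of \<open>p^(nr)\<close> is \<open>1\<close>.
\<close>

definition target :: "nat \<Rightarrow> nat \<Rightarrow> coord \<Rightarrow> (coord, 'a::comm_ring_1) mpoly" where
  "target n r = (\<lambda>(i, j, s). if i < n then (if i = j \<and> s = 0 then 1 else 0) else (if j = n \<and> s = n * r then 1 else 0))"

definition specialize :: "nat \<Rightarrow> nat \<Rightarrow> coord set \<Rightarrow> coord \<Rightarrow> (coord, 'a::comm_ring_1) mpoly" where
  "specialize n r K v = (if v \<in> K then target n r v else indet v)"

lemma rhom_target: "rhom h \<Longrightarrow> h (target n r v) = target n r v"
  by (cases v) (auto simp: target_def rhom.one rhom.zero)

lemma red_specialize: "red (specialize n r K v) = specialize n r K v"
  by (simp add: specialize_def rhom_target[OF rhom_red])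

lemma indet_neq_target: "(indet v :: (coord, 'a::comm_ring_1) mpoly) \<noteq> target n r v"
proof
  assume eq: "(indet v :: (coord, 'a) mpoly) = target n r v"
  have ne: "single v (1::nat) \<noteq> 0"
    by (metis lookup_single_eq lookup_zero zero_neq_one)
  have "target n r v = (0 :: (coord, 'a) mpoly) \<or> target n r v = (1 :: (coord, 'a) mpoly)"
    by (cases v) (simp add: target_def)
  then have "lookup (target n r v :: (coord, 'a) mpoly) (single v 1) = 0"
    using ne by (auto simp: lookup_one when_def)
  moreover have "lookup (indet v :: (coord, 'a) mpoly) (single v 1) = 1"
    by (simp add: indet_def)
  ultimately show False
    unfolding eq by simp
qed

definition cut :: "nat \<Rightarrow> (nat \<Rightarrow> 'a::zero) \<Rightarrow> nat \<Rightarrow> 'a" where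
  "cut N x s = (if s \<le> N then x s else 0)"

text \<open>
  The generic matrix of discriminant \<open>nr\<close> whose first \<open>n - 1\<close> rows are part of a basis: its
  last row is a combination, with coefficients \<open>c\<^sub>l\<close>, of the other rows plus a multiple of
  \<open>p^(nr) e\<^sub>n\<close>.  The coefficients and the multiple are named by the indeterminates of the last row.
\<close>

lemma last_row_exists:
  fixes n r p :: nat
  assumes p: "Factorial_Ring.prime p"
  obtains Y :: "nat \<Rightarrow> nat \<Rightarrow> (coord, int) mpoly" where
    "\<And>j m. witt_poly p m (Y j) =
      (\<Sum>l\<in>{1..<n}. witt_poly p m (cut (n * r) (\<lambda>s. indet (n, l, s))) * witt_poly p m (cut (n * r) (\<lambda>s. indet (l, j, s))))
      + (if j = n then witt_poly p m (\<lambda>s. if s = n * r then indet (n, n, s) else 0) else 0)"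
proof -
  let ?g = "\<lambda>j m. (\<Sum>l\<in>{1..<n}. witt_poly p m (cut (n * r) (\<lambda>s. indet (n, l, s))) * witt_poly p m (cut (n * r) (\<lambda>s. indet (l, j, s))))
      + (if j = n then witt_poly p m (\<lambda>s. if s = n * r then indet (n, n, s) else 0) else 0 :: (coord, int) mpoly)"
  let ?\<sigma> = "psubst of_int (\<lambda>v. indet v ^ p) :: (coord, int) mpoly \<Rightarrow> _"
  note f = frob_lift_mpoly[OF p, where 'v = coord]
  have s: "rhom ?\<sigma>" by (rule rhom_psubst_int)
  have "ghostly p ?\<sigma> (?g j)" for j
  proof (rule ghostly_add[OF s])
    show "ghostly p ?\<sigma> (\<lambda>m. \<Sum>l\<in>{1..<n}. witt_poly p m (cut (n * r) (\<lambda>s. indet (n, l, s))) * witt_poly p m (cut (n * r) (\<lambda>s. indet (l, j, s))))"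
      by (intro ghostly_sum[OF s] ghostly_mult[OF s] ghostly_witt_poly[OF f])
    show "ghostly p ?\<sigma> (\<lambda>m. if j = n then witt_poly p m (\<lambda>s. if s = n * r then indet (n, n, s) else 0) else 0)"
      by (cases "j = n") (simp_all add: ghostly_witt_poly[OF f] ghostly_const[OF s, of p 0, simplified])
  qed
  then have "\<exists>Y. \<forall>m. witt_poly p m Y = ?g j m" for j
    using ghost_realizable[OF p, of "?g j"] by blast
  then obtain Y where "\<And>j m. witt_poly p m (Y j) = ?g j m"
    by metis
  then show thesis by (rule that)
qed

lemma witt_poly_top: "witt_poly p N (\<lambda>s. if s = N then z else 0) = of_nat p ^ N * z" if "p > 0"
  using that by (simp add: witt_poly_split zero_power)

lemma prime_in_kernel:
  fixes F :: "('v, 'a::field) mpoly \<Rightarrow> 'b::idom"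
  assumes "rhom F"
  shows "prime_in V {f \<in> polys_in V. F f = 0}"
  unfolding prime_in_def ideal_in_def
  by (auto simp: rhom.zero[OF assms] rhom.one[OF assms] rhom.add[OF assms] rhom.mult[OF assms])

text \<open>
  The first \<open>n - 1\<close> rows are specialized to unit vectors before the coefficients of the last row are
  specialized.  In this order each step changes the value of one indeterminate from itself to a
  constant, so the kernel grows.  At the end of the chain \<open>\<delta>\<^bsub>nr\<^esub>\<close>
  takes the value \<open>1\<close>, hence it is outside all kernels.
\<close>

theorem prime_chain_of_bases:
  fixes p n r :: nat
  assumes p: "Factorial_Ring.prime p" and char: "CHAR('k::field) = p" and n: "n > 0"
  shows "\<exists>C. prime_chain (mpoly_ring (base_indets n r) :: (coord, 'k) mpoly ring) (n\<^sup>2 * (n * r + 1) - n * r) C \<and>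
     (\<forall>i<n * r. disc_coeff p n r i \<in> C 0) \<and> disc_coeff p n r (n * r) \<notin> C (n\<^sup>2 * (n * r + 1) - n * r)"
proof -
  let ?N = "n * r" and ?S = "base_indets n r" and ?F = "free_indets n r"
  let ?\<delta> = "disc_coeff p n r :: nat \<Rightarrow> (coord, 'k) mpoly"
  have p0: "p > 0" using p prime_gt_0_nat by auto
  obtain D :: "nat \<Rightarrow> (coord, int) mpoly"
    where D: "\<And>m. m \<le> ?N \<Longrightarrow> witt_poly p m D = leibniz_det n (\<lambda>i j. witt_poly p m (entry_lift n r i j))"
      and \<delta>: "\<And>i. ?\<delta> i = psubst of_int (\<lambda>v. if v \<in> ?S then indet v else 0) (D i)"
    using disc_coeff_lift[OF p] by blast
  obtain Y :: "nat \<Rightarrow> nat \<Rightarrow> (coord, int) mpoly" where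
    Y: "\<And>j m. witt_poly p m (Y j) =
      (\<Sum>l\<in>{1..<n}. witt_poly p m (cut ?N (\<lambda>s. indet (n, l, s))) * witt_poly p m (cut ?N (\<lambda>s. indet (l, j, s))))
      + (if j = n then witt_poly p m (\<lambda>s. if s = ?N then indet (n, n, s) else 0) else 0)"
    using last_row_exists[OF p] by blast
  define U :: "coord \<Rightarrow> (coord, int) mpoly" where
    "U = (\<lambda>(i, j, s). if i < n then indet (i, j, s) else Y j s)"
  define \<sigma> :: "coord set \<Rightarrow> (coord, int) mpoly \<Rightarrow> (coord, int) mpoly" where
    "\<sigma> K = psubst of_int (specialize n r K)" for K
  have \<sigma>: "rhom (\<sigma> K)" for K
    unfolding \<sigma>_def by (rule rhom_psubst_int)
  have \<sigma>_indet: "\<sigma> K (indet v) = specialize n r K v" for K v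
    by (simp add: \<sigma>_def)
  define \<Phi> :: "coord set \<Rightarrow> (coord, 'k) mpoly \<Rightarrow> (coord, 'k) mpoly" where
    "\<Phi> K = psubst const (\<lambda>v. red (\<sigma> K (U v)))" for K
  have \<Phi>: "rhom (\<Phi> K)" for K
    unfolding \<Phi>_def by (rule rhom_psubst_const)
  \<comment> \<open>The equations of the family of matrices in which the coordinates in \<open>K\<close> are specialized.\<close>
  define Q where "Q K = {f \<in> polys_in ?S. \<Phi> K f = 0}" for K
  have Q_prime: "prime_in ?S (Q K)" for K
    unfolding Q_def by (rule prime_in_kernel[OF \<Phi>])
  have Q_mono: "Q K \<subseteq> Q K'" if "K \<subseteq> K'" for K K'
  proof -
    have "psubst const (specialize n r K') (red (\<sigma> K P)) = red (\<sigma> K' P)" for P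
    proof (rule rhom_int_eqI[OF rhom_compose[OF rhom_compose[OF \<sigma> rhom_red] rhom_psubst_const] rhom_compose[OF \<sigma> rhom_red]])
      fix v
      show "psubst const (specialize n r K') (red (\<sigma> K (indet v))) = red (\<sigma> K' (indet v))"
        using that unfolding \<sigma>_indet red_specialize
        by (auto simp: specialize_def rhom_target[OF rhom_psubst_const])
    qed
    then have comp: "psubst const (specialize n r K') (\<Phi> K f) = \<Phi> K' f" for f
      by (intro rhom_eqI[of "\<lambda>f. psubst const (specialize n r K') (\<Phi> K f)" "\<Phi> K'" f UNIV]
            rhom_compose[OF \<Phi> rhom_psubst_const] \<Phi>)
         (simp_all add: \<Phi>_def polys_in_def rhom_const)
    have "\<Phi> K' f = 0" if "\<Phi> K f = 0" for f
      using comp[of f] that by simp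
    then show ?thesis
      by (auto simp: Q_def)
  qed
  define E where "E K i = psubst of_int (\<lambda>v. if v \<in> ?S then \<sigma> K (U v) else 0) (D i)" for K i
  have \<Phi>\<delta>: "\<Phi> K (?\<delta> i) = red (E K i)" for K i
    unfolding \<Phi>_def E_def by (rule psubst_disc_coeff[OF \<delta>]) simp
  have wE: "witt_poly p m (E K) = leibniz_det n (\<lambda>i j. witt_poly p m (\<lambda>s. \<sigma> K (U (i, j, s))))" if "m \<le> ?N" for m K
  proof -
    have "witt_poly p m (E K) = leibniz_det n (\<lambda>i j. witt_poly p m (\<lambda>s. if s \<le> ?N then \<sigma> K (U (i, j, s)) else 0))"
      unfolding E_def by (rule ghost_psubst_entries[OF D that])
    also have "\<dots> = leibniz_det n (\<lambda>i j. witt_poly p m (\<lambda>s. \<sigma> K (U (i, j, s))))"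
      using that by (intro leibniz_det_cong witt_poly_cong) auto
    finally show ?thesis .
  qed
  have wcut: "witt_poly p m (cut ?N x) = witt_poly p m x" if "m \<le> ?N" for m and x :: "nat \<Rightarrow> (coord, int) mpoly"
    using that by (intro witt_poly_cong) (auto simp: cut_def)
  have wrow: "witt_poly p m (\<lambda>s. \<sigma> K (U (n, j, s))) =
      (\<Sum>l\<in>{1..<n}. witt_poly p m (\<lambda>s. specialize n r K (n, l, s)) * witt_poly p m (\<lambda>s. \<sigma> K (U (l, j, s))))
      + (if j = n then witt_poly p m (\<lambda>s. if s = ?N then specialize n r K (n, n, s) else 0) else 0)"
    if "m \<le> ?N" for m j K
  proof -
    have top: "\<sigma> K (witt_poly p m (\<lambda>s. if s = ?N then indet (n, n, s) else 0)) =
        witt_poly p m (\<lambda>s. if s = ?N then specialize n r K (n, n, s) else 0)"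
      unfolding rhom.witt_poly[OF \<sigma>] by (intro witt_poly_cong) (simp add: \<sigma>_indet rhom.zero[OF \<sigma>])
    have "witt_poly p m (\<lambda>s. \<sigma> K (U (n, j, s))) = \<sigma> K (witt_poly p m (Y j))"
      by (simp add: U_def rhom.witt_poly[OF \<sigma>])
    also have "\<dots> = (\<Sum>l\<in>{1..<n}. \<sigma> K (witt_poly p m (\<lambda>s. indet (n, l, s))) * \<sigma> K (witt_poly p m (\<lambda>s. indet (l, j, s))))
      + (if j = n then \<sigma> K (witt_poly p m (\<lambda>s. if s = ?N then indet (n, n, s) else 0)) else 0)"
      unfolding Y wcut[OF that] by (simp add: rhom.add[OF \<sigma>] rhom.sum[OF \<sigma>] rhom.mult[OF \<sigma>] rhom.zero[OF \<sigma>])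
    finally show ?thesis
      unfolding top by (simp add: rhom.witt_poly[OF \<sigma>] \<sigma>_indet U_def)
  qed
  \<comment> \<open>In the ghost components below \<open>nr\<close> the last row is a combination of the others.\<close>
  have E0: "E K i = 0" if "i < ?N" for K i
  proof (rule ghost_inj_mpoly[OF p _ that])
    fix m assume m: "m < ?N"
    have "witt_poly p m (\<lambda>s. if s = ?N then z s else 0 :: (coord, int) mpoly) = 0" for z
      using m by (intro ghost_leading_zero[OF _ m p0]) auto
    then have "leibniz_det n (\<lambda>i j. witt_poly p m (\<lambda>s. \<sigma> K (U (i, j, s)))) = 0"
      using m by (intro leibniz_det_row_combination[OF n, where c = "\<lambda>l. witt_poly p m (\<lambda>s. specialize n r K (n, l, s))"])
         (subst wrow, auto)
    then show "witt_poly p m (E K) = witt_poly p m (\<lambda>_. 0)"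
      using wE[of m K] m by (simp add: witt_poly_zero[OF p0])
  qed
  have \<delta>_in: "?\<delta> i \<in> Q K" if "i < ?N" for i K
    using that polys_in_disc_coeff[OF p] by (simp add: Q_def \<Phi>\<delta> E0)
  have id_rows: "witt_poly p m (\<lambda>s. \<sigma> K (U (l, j, s))) = (if l = j then 1 else 0)"
    if "{v \<in> ?F. fst v < n} \<subseteq> K" "l \<in> {1..<n}" "j \<in> {1..n}" "m \<le> ?N" for K l j m
  proof -
    have "witt_poly p m (\<lambda>s. \<sigma> K (U (l, j, s))) = witt_poly p m (\<lambda>s. if l = j \<and> s = 0 then 1 else 0)"
    proof (rule witt_poly_cong)
      fix s assume "s \<le> m"
      then have "(l, j, s) \<in> K"
        using that by (auto simp: free_indets_def base_indets_def subset_iff)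
      then show "\<sigma> K (U (l, j, s)) = (if l = j \<and> s = 0 then 1 else 0)"
        using that(2) by (simp add: U_def \<sigma>_indet specialize_def target_def)
    qed
    also have "\<dots> = (if l = j then 1 else 0)"
      by (cases "l = j") (simp_all add: witt_poly_one[OF p0] witt_poly_zero[OF p0])
    finally show ?thesis .
  qed
  have last_row: "witt_poly p m (\<lambda>s. \<sigma> K (U (n, j, s))) =
      (if j = n then witt_poly p m (\<lambda>s. if s = ?N then specialize n r K (n, n, s) else 0)
       else witt_poly p m (\<lambda>s. specialize n r K (n, j, s)))"
    if "{v \<in> ?F. fst v < n} \<subseteq> K" "j \<in> {1..n}" "m \<le> ?N" for K j m
  proof -
    have "(\<Sum>l\<in>{1..<n}. witt_poly p m (\<lambda>s. specialize n r K (n, l, s)) * witt_poly p m (\<lambda>s. \<sigma> K (U (l, j, s)))) =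
        (\<Sum>l\<in>{1..<n}. if l = j then witt_poly p m (\<lambda>s. specialize n r K (n, l, s)) else 0)"
      using that by (intro sum.cong refl) (simp add: id_rows)
    then show ?thesis
      unfolding wrow[OF that(3)] using that(2) by auto
  qed
  \<comment> \<open>Once the first \<open>n - 1\<close> rows are unit vectors, the last row consists of its coefficients.  So
    each coordinate agrees, at the time when it is specialized, with the entry that names it.\<close>
  have coord: "\<sigma> K (U v) = specialize n r K v"
    if v: "v \<in> ?F" "fst v < n \<or> {v \<in> ?F. fst v < n} \<subseteq> K" for K v
  proof -
    obtain i j s where ijs: "v = (i, j, s)" by (cases v)
    have ran: "i \<in> {1..n}" "j \<in> {1..n}" "s \<le> ?N"
      using v(1) by (auto simp: ijs free_indets_def base_indets_def)
    show ?thesis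
    proof (cases "i < n")
      case True
      then show ?thesis by (simp add: ijs U_def \<sigma>_indet)
    next
      case False
      then have i: "i = n" and K: "{v \<in> ?F. fst v < n} \<subseteq> K"
        using ran v(2) by (auto simp: ijs)
      show ?thesis
      proof (cases "j = n")
        case True
        have s: "s = ?N"
          using v(1) ran(3) True i by (auto simp: ijs free_indets_def)
        have "\<sigma> K (U (n, n, s)) = (if s = ?N then specialize n r K (n, n, s) else 0)"
          by (rule ghost_inj_mpoly[OF p, of "Suc ?N" "\<lambda>s. \<sigma> K (U (n, n, s))"])
             (use last_row[OF K, of n] n s in auto)
        then show ?thesis by (simp add: ijs i True s)
      next
        case False
        have "\<sigma> K (U (n, j, s)) = specialize n r K (n, j, s)"
          by (rule ghost_inj_mpoly[OF p, of "Suc ?N" "\<lambda>s. \<sigma> K (U (n, j, s))"])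
             (use last_row[OF K, of j] ran False in auto)
        then show ?thesis by (simp add: ijs i)
      qed
    qed
  qed
  have Q_strict: "Q K \<subset> Q (insert v K)"
    if v: "v \<in> ?F" "v \<notin> K" "fst v < n \<or> {v \<in> ?F. fst v < n} \<subseteq> K" for K v
  proof -
    let ?f = "indet v - target n r v :: (coord, 'k) mpoly"
    have eval: "\<Phi> L ?f = specialize n r L v - target n r v" if "K \<subseteq> L" for L
    proof -
      have "\<Phi> L (indet v) = specialize n r L v"
      proof -
        have "\<sigma> L (U v) = specialize n r L v"
          using coord[of v L] v that by blast
        then show ?thesis by (simp add: \<Phi>_def red_specialize)
      qed
      then show ?thesis
        by (simp add: rhom.diff[OF \<Phi>] rhom_target[OF \<Phi>])
    qed
    have "?f \<in> polys_in ?S"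
      using v(1) by (cases v) (auto simp: free_indets_def target_def intro!: polys_in_diff)
    then have "?f \<in> Q (insert v K)" "?f \<notin> Q K"
      using eval[of K] eval[of "insert v K"] v(2) indet_neq_target[of v n r]
      by (auto simp: Q_def specialize_def)
    then show ?thesis
      using Q_mono[of K "insert v K"] by blast
  qed
  have top: "?\<delta> ?N \<notin> Q ?F"
  proof
    assume "?\<delta> ?N \<in> Q ?F"
    then have "red (E ?F ?N) = (0 :: (coord, 'k) mpoly)"
      by (simp add: Q_def \<Phi>\<delta>)
    moreover have "E ?F ?N = 1"
    proof -
      have entry: "witt_poly p ?N (\<lambda>s. \<sigma> ?F (U (i, j, s))) = (if i = j then if i = n then of_nat p ^ ?N else 1 else 0)"
        if ij: "i \<in> {1..n}" "j \<in> {1..n}" for i j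
      proof (cases "i < n")
        case True
        then show ?thesis
          using ij id_rows[of ?F i j ?N] by auto
      next
        case False
        then have i: "i = n" using ij by simp
        have zero: "witt_poly p ?N (\<lambda>s. specialize n r ?F (n, j, s)) = (0 :: (coord, int) mpoly)" if "j \<noteq> n"
        proof -
          have "witt_poly p ?N (\<lambda>s. specialize n r ?F (n, j, s)) = (witt_poly p ?N (\<lambda>s. 0) :: (coord, int) mpoly)"
            using ij that n by (intro witt_poly_cong)
              (auto simp: specialize_def target_def free_indets_def base_indets_def)
          then show ?thesis by (simp add: witt_poly_zero[OF p0])
        qed
        have "specialize n r ?F (n, n, ?N) = (1 :: (coord, int) mpoly)"
          using n by (auto simp: specialize_def target_def free_indets_def base_indets_def)
        then have "witt_poly p ?N (\<lambda>s. if s = ?N then specialize n r ?F (n, n, s) else 0 :: (coord, int) mpoly) = of_nat p ^ ?N"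
          by (simp add: witt_poly_top[OF p0] cong: if_cong)
        then show ?thesis
          using last_row[of ?F j ?N] ij zero by (auto simp: i)
      qed
      have "witt_poly p ?N (E ?F) = leibniz_det n (\<lambda>i j. if i = j then if i = n then of_nat p ^ ?N else 1 else 0)"
        unfolding wE[OF order_refl] by (intro leibniz_det_cong entry)
      also have "\<dots> = (\<Prod>i\<in>{1..n}. if i = n then of_nat p ^ ?N else 1)"
        by (subst leibniz_det_diagonal) auto
      also have "\<dots> = of_nat p ^ ?N"
        using n by (simp add: prod.delta)
      finally have "of_nat p ^ ?N * E ?F ?N = of_nat p ^ ?N"
        using E0 p0 by (simp add: witt_poly_split zero_power)
      then have "of_nat (p ^ ?N) * (E ?F ?N - 1) = 0"
        by (simp add: algebra_simps)
      from mpoly_int_torsion_free[OF this] show ?thesis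
        using p0 by simp
    qed
    ultimately show False
      by (simp add: rhom.one[OF rhom_red])
  qed
  obtain as where as: "set as = {v \<in> ?F. fst v < n}" "distinct as"
    using finite_distinct_list[of "{v \<in> ?F. fst v < n}"] finite_base_indets[of n r]
    by (auto simp: free_indets_def)
  obtain bs where bs: "set bs = {v \<in> ?F. \<not> fst v < n}" "distinct bs"
    using finite_distinct_list[of "{v \<in> ?F. \<not> fst v < n}"] finite_base_indets[of n r]
    by (auto simp: free_indets_def)
  let ?vs = "as @ bs"
  have vs: "set ?vs = ?F" "distinct ?vs"
    using as bs by auto
  then have len: "length ?vs = n\<^sup>2 * (n * r + 1) - n * r"
    using distinct_card[OF vs(2)] card_free_indets[OF n, of r] by simp
  have "prime_chain (mpoly_ring ?S) (length ?vs) (\<lambda>i. Q (set (take i ?vs)))"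
    unfolding prime_chain_mpoly_ring
  proof (intro conjI allI impI Q_prime)
    fix i assume i: "i < length ?vs"
    have "Q (set (take i ?vs)) \<subset> Q (insert (?vs ! i) (set (take i ?vs)))"
    proof (rule Q_strict)
      show "?vs ! i \<in> ?F"
        using i vs(1) nth_mem by blast
      show "?vs ! i \<notin> set (take i ?vs)"
      proof
        assume "?vs ! i \<in> set (take i ?vs)"
        then obtain j where j: "j < length (take i ?vs)" "take i ?vs ! j = ?vs ! i"
          unfolding in_set_conv_nth by blast
        from j(1) have "j < i" by simp
        moreover have "?vs ! j = ?vs ! i"
          using j(2) by (simp only: nth_take[OF \<open>j < i\<close>])
        ultimately show False
          using nth_eq_iff_index_eq[OF vs(2), of j i] i by simp
      qed
      show "fst (?vs ! i) < n \<or> {v \<in> ?F. fst v < n} \<subseteq> set (take i ?vs)"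
      proof (cases "i < length as")
        case True
        then have "?vs ! i \<in> set as" by (simp add: nth_append)
        then show ?thesis using as(1) by auto
      next
        case False
        then show ?thesis using as(1) by auto
      qed
    qed
    moreover have "set (take (Suc i) ?vs) = insert (?vs ! i) (set (take i ?vs))"
      using i by (simp only: take_Suc_conv_app_nth) auto
    ultimately show "Q (set (take i ?vs)) \<subset> Q (set (take (Suc i) ?vs))"
      by simp
  qed
  moreover have "?\<delta> i \<in> Q (set (take 0 ?vs))" if "i < ?N" for i
    by (rule \<delta>_in[OF that])
  moreover have "?\<delta> ?N \<notin> Q (set (take (length ?vs) ?vs))"
    using top vs(1) by simp
  ultimately show ?thesis
    unfolding len[symmetric] by blast
qed

section \<open>Primes in localizations and quotients\<close>

lemma prime_chain_append:
  assumes "prime_chain R d C" "prime_chain R e D" "C d = D 0"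
  shows "prime_chain R (d + e) (\<lambda>i. if i \<le> d then C i else D (i - d))"
  unfolding prime_chain_def
proof (intro conjI allI impI)
  fix i assume "i \<le> d + e"
  then show "primeideal (if i \<le> d then C i else D (i - d)) R"
    using assms by (auto simp: prime_chain_def)
next
  fix i assume i: "i < d + e"
  consider "i < d" | "i = d" | "i > d" by linarith
  then show "(if i \<le> d then C i else D (i - d)) \<subset> (if Suc i \<le> d then C (Suc i) else D (Suc i - d))"
  proof cases
    case 1
    then show ?thesis using assms by (auto simp: prime_chain_def)
  next
    case 2
    then have "D 0 \<subset> D (Suc 0)" using assms i by (auto simp: prime_chain_def)
    then show ?thesis using 2 assms(3) by simp
  next
    case 3
    then have "D (i - d) \<subset> D (Suc (i - d))" using assms i by (auto simp: prime_chain_def)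
    then show ?thesis using 3 by (simp add: Suc_diff_le)
  qed
qed

lemma prime_chain_mono:
  assumes "prime_chain R d C" "i \<le> j" "j \<le> d"
  shows "C i \<subseteq> C j"
  using assms(2,1,3)
proof (induction j rule: dec_induct)
  case (step j)
  then have "C i \<subseteq> C j" "C j \<subset> C (Suc j)" by (auto simp: prime_chain_def)
  then show ?case by blast
qed simp

lemma prime_chain_map:
  assumes "prime_chain R d C" "\<And>i. i \<le> d \<Longrightarrow> primeideal (h (C i)) S"
    and "\<And>i. i < d \<Longrightarrow> h (C i) \<subset> h (C (Suc i))"
  shows "prime_chain S d (\<lambda>i. h (C i))"
  using assms by (auto simp: prime_chain_def)

locale mpoly_localization =
  fixes V :: "'v::linorder set" and f :: "('v, 'a::field) mpoly"
  assumes f_in: "f \<in> polys_in V" and f_nz: "f \<noteq> 0"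
begin

abbreviation R :: "('v, 'a) mpoly ring" where "R \<equiv> mpoly_ring V"
abbreviation L :: "(('v, 'a) mpoly \<times> nat) set ring" where "L \<equiv> localization R f"
abbreviation frac :: "('v, 'a) mpoly \<Rightarrow> nat \<Rightarrow> (('v, 'a) mpoly \<times> nat) set" where "frac \<equiv> loc_frac R f"

lemma loc_rel_iff:
  "((a, m), (b, l)) \<in> loc_rel R f \<longleftrightarrow> a \<in> polys_in V \<and> b \<in> polys_in V \<and> a * f ^ l = b * f ^ m"
  using f_nz by (auto simp: loc_rel_def)

lemma equiv_loc_rel: "equiv (polys_in V \<times> UNIV) (loc_rel R f)"
proof (rule equivI)
  show "loc_rel R f \<subseteq> (polys_in V \<times> UNIV) \<times> (polys_in V \<times> UNIV)"
    by (auto simp: loc_rel_iff)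
  show "refl_on (polys_in V \<times> UNIV) (loc_rel R f)"
    by (auto simp: refl_on_def loc_rel_iff)
  show "sym (loc_rel R f)"
    by (auto simp: sym_def loc_rel_iff)
  show "trans (loc_rel R f)"
  proof (rule transI)
    fix x y z assume "(x, y) \<in> loc_rel R f" "(y, z) \<in> loc_rel R f"
    moreover obtain a m b l c k where "x = (a, m)" "y = (b, l)" "z = (c, k)"
      by (cases x; cases y; cases z)
    ultimately have *: "a \<in> polys_in V" "c \<in> polys_in V" "a * f ^ l = b * f ^ m" "b * f ^ k = c * f ^ l"
      and eq: "x = (a, m)" "z = (c, k)"
      by (auto simp: loc_rel_iff)
    have "(a * f ^ k) * f ^ l = (a * f ^ l) * f ^ k" by (simp add: mult_ac)
    also have "\<dots> = (b * f ^ k) * f ^ m" by (simp add: *(3) mult_ac)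
    also have "\<dots> = (c * f ^ m) * f ^ l" by (simp add: *(4) mult_ac)
    finally have "a * f ^ k = c * f ^ m" using f_nz by simp
    then show "(x, z) \<in> loc_rel R f"
      using * by (simp add: eq loc_rel_iff)
  qed
qed

lemma frac_eq_iff:
  assumes "a \<in> polys_in V" "b \<in> polys_in V"
  shows "frac a m = frac b l \<longleftrightarrow> a * f ^ l = b * f ^ m"
  unfolding loc_frac_def using eq_equiv_class_iff[OF equiv_loc_rel, of "(a, m)" "(b, l)"] assms
  by (simp add: loc_rel_iff)

lemma carrier_L: "carrier L = {frac a m | a m. a \<in> polys_in V}"
  by (auto simp: localization_def quotient_def loc_frac_def)

lemma mem_frac: "(b, l) \<in> frac a m \<longleftrightarrow> a \<in> polys_in V \<and> b \<in> polys_in V \<and> a * f ^ l = b * f ^ m"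
  by (simp add: loc_frac_def loc_rel_iff)

lemma UN_frac2:
  assumes ab: "a \<in> polys_in V" "b \<in> polys_in V"
    and c: "\<And>a' m' b' l'. (a', m') \<in> frac a m \<Longrightarrow> (b', l') \<in> frac b l \<Longrightarrow> g a' m' b' l' = c"
  shows "(\<Union>(a, m) \<in> frac a m. \<Union>(b, l) \<in> frac b l. g a m b l) = c"
proof -
  have "(a, m) \<in> frac a m" "(b, l) \<in> frac b l"
    using ab by (auto simp: mem_frac)
  then show ?thesis using c by fastforce
qed

lemma mult_frac:
  assumes "a \<in> polys_in V" "b \<in> polys_in V"
  shows "frac a m \<otimes>\<^bsub>L\<^esub> frac b l = frac (a * b) (m + l)"
proof -
  have "(\<Union>(a, m) \<in> frac a m. \<Union>(b, l) \<in> frac b l. frac (a * b) (m + l)) = frac (a * b) (m + l)"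
  proof (rule UN_frac2[OF assms])
    fix a' m' b' l' assume "(a', m') \<in> frac a m" "(b', l') \<in> frac b l"
    then have *: "a' \<in> polys_in V" "b' \<in> polys_in V" "a * f ^ m' = a' * f ^ m" "b * f ^ l' = b' * f ^ l"
      by (auto simp: mem_frac)
    have "a' * b' * f ^ (m + l) = (a' * f ^ m) * (b' * f ^ l)" by (simp add: power_add mult_ac)
    also have "\<dots> = a * b * f ^ (m' + l')" by (simp add: power_add mult_ac flip: *(3,4))
    finally show "frac (a' * b') (m' + l') = frac (a * b) (m + l)"
      using * assms by (subst frac_eq_iff) auto
  qed
  then show ?thesis by (simp add: localization_def)
qed

lemma add_frac:
  assumes "a \<in> polys_in V" "b \<in> polys_in V"
  shows "frac a m \<oplus>\<^bsub>L\<^esub> frac b l = frac (a * f ^ l + b * f ^ m) (m + l)"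
proof -
  have "(\<Union>(a, m) \<in> frac a m. \<Union>(b, l) \<in> frac b l. frac (a * f ^ l + b * f ^ m) (m + l)) = frac (a * f ^ l + b * f ^ m) (m + l)"
  proof (rule UN_frac2[OF assms])
    fix a' m' b' l' assume "(a', m') \<in> frac a m" "(b', l') \<in> frac b l"
    then have *: "a' \<in> polys_in V" "b' \<in> polys_in V" "a * f ^ m' = a' * f ^ m" "b * f ^ l' = b' * f ^ l"
      by (auto simp: mem_frac)
    have "(a' * f ^ l' + b' * f ^ m') * f ^ (m + l) = (a' * f ^ m) * f ^ (l + l') + (b' * f ^ l) * f ^ (m + m')"
      by (simp add: power_add algebra_simps)
    also have "\<dots> = (a * f ^ l + b * f ^ m) * f ^ (m' + l')"
      by (simp add: power_add algebra_simps flip: *(3,4))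
    finally show "frac (a' * f ^ l' + b' * f ^ m') (m' + l') = frac (a * f ^ l + b * f ^ m) (m + l)"
      using * assms f_in by (subst frac_eq_iff) auto
  qed
  then show ?thesis by (simp add: localization_def)
qed

lemma L_zero_one: "\<zero>\<^bsub>L\<^esub> = frac 0 0" "\<one>\<^bsub>L\<^esub> = frac 1 0"
  by (simp_all add: localization_def)

lemma cring_L: "cring L"
proof (intro cringI abelian_groupI comm_monoidI)
  fix x assume "x \<in> carrier L"
  then obtain a m where x: "x = frac a m" "a \<in> polys_in V" by (auto simp: carrier_L)
  then show "\<exists>y\<in>carrier L. y \<oplus>\<^bsub>L\<^esub> x = \<zero>\<^bsub>L\<^esub>"
    by (intro bexI[of _ "frac (- a) m"]) (auto simp: carrier_L add_frac L_zero_one frac_eq_iff f_in intro!: exI)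
next
  fix x y assume "x \<in> carrier L" "y \<in> carrier L"
  then obtain a m b l where *: "x = frac a m" "a \<in> polys_in V" "y = frac b l" "b \<in> polys_in V"
    by (auto simp: carrier_L)
  show "x \<oplus>\<^bsub>L\<^esub> y \<in> carrier L"
    unfolding * carrier_L using * f_in by (simp only: add_frac) auto
  show "x \<otimes>\<^bsub>L\<^esub> y \<in> carrier L"
    unfolding * carrier_L using * by (simp only: mult_frac) auto
next
  fix x y z assume "x \<in> carrier L" "y \<in> carrier L" "z \<in> carrier L"
  then obtain a m b l c k where *: "x = frac a m" "y = frac b l" "z = frac c k"
    "a \<in> polys_in V" "b \<in> polys_in V" "c \<in> polys_in V"
    by (auto simp: carrier_L)
  have "(a * f ^ l + b * f ^ m) * c * f ^ (m + k + (l + k)) =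
      (a * c * f ^ (l + k) + b * c * f ^ (m + k)) * f ^ (m + l + k)"
    by (simp add: power_add algebra_simps)
  then have "frac ((a * f ^ l + b * f ^ m) * c) (m + l + k) =
      frac (a * c * f ^ (l + k) + b * c * f ^ (m + k)) (m + k + (l + k))"
    using *(4-) f_in by (subst frac_eq_iff) auto
  then show "(x \<oplus>\<^bsub>L\<^esub> y) \<otimes>\<^bsub>L\<^esub> z = x \<otimes>\<^bsub>L\<^esub> z \<oplus>\<^bsub>L\<^esub> y \<otimes>\<^bsub>L\<^esub> z"
    using *(4-) f_in by (simp add: *(1-3) add_frac mult_frac)
next
  show "\<zero>\<^bsub>L\<^esub> \<in> carrier L" "\<one>\<^bsub>L\<^esub> \<in> carrier L"
    by (auto simp: carrier_L L_zero_one)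
qed (auto simp: carrier_L add_frac mult_frac L_zero_one frac_eq_iff f_in power_add algebra_simps)

lemma inclusion_hom: "ring_hom_ring R L (\<lambda>a. frac a 0)"
proof -
  interpret R: cring R by (rule cring_mpoly_ring)
  interpret L: cring L by (rule cring_L)
  show ?thesis
    by (intro ring_hom_ringI R.ring_axioms L.ring_axioms) (auto simp: carrier_L mult_frac add_frac L_zero_one)
qed

definition contract where "contract Q = {a \<in> polys_in V. frac a 0 \<in> Q}"
definition expand where "expand P = {frac a m | a m. a \<in> P}"

text \<open>
  Since \<open>f\<close> becomes a unit, a fraction lies in a prime if and only if its numerator does; so primes of
  the localization correspond to the primes that avoid \<open>f\<close>.
\<close>

lemma frac_mem_prime_iff:
  assumes "primeideal Q L" "a \<in> polys_in V"
  shows "frac a m \<in> Q \<longleftrightarrow> frac a 0 \<in> Q"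
proof -
  interpret primeideal Q L by fact
  have "frac (f ^ m) 0 \<in> carrier L" "frac 1 m \<in> carrier L"
    using f_in by (auto simp: carrier_L)
  moreover have "frac a 0 = frac (f ^ m) 0 \<otimes>\<^bsub>L\<^esub> frac a m" "frac a m = frac 1 m \<otimes>\<^bsub>L\<^esub> frac a 0"
    using assms(2) f_in by (auto simp: mult_frac frac_eq_iff mult.commute)
  ultimately show ?thesis
    using I_l_closed by metis
qed

lemma contract_prime:
  assumes "primeideal Q L"
  shows "primeideal (contract Q) R" and "f \<notin> contract Q"
proof -
  interpret ring_hom_ring R L "\<lambda>a. frac a 0" by (rule inclusion_hom)
  show "primeideal (contract Q) R"
    using primeideal_vimage[OF cring_mpoly_ring assms] by (simp add: contract_def)
  interpret Q: primeideal Q L by fact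
  show "f \<notin> contract Q"
  proof
    assume "f \<in> contract Q"
    then have "frac f 1 \<in> Q"
      using frac_mem_prime_iff[OF assms f_in] by (simp add: contract_def)
    moreover have "frac f 1 = \<one>\<^bsub>L\<^esub>"
      using f_in by (simp add: L_zero_one frac_eq_iff)
    ultimately show False
      using Q.one_imp_carrier Q.I_notcarr by auto
  qed
qed

lemma contract_strict:
  assumes "primeideal Q L" "primeideal Q' L" "Q \<subset> Q'"
  shows "contract Q \<subset> contract Q'"
proof -
  obtain x where x: "x \<in> Q'" "x \<notin> Q" using assms(3) by blast
  interpret primeideal Q' L by fact
  have "x \<in> carrier L" using x(1) a_subset by blast
  then obtain a m where a: "x = frac a m" "a \<in> polys_in V" by (auto simp: carrier_L)
  then have "a \<in> contract Q'" "a \<notin> contract Q"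
    using x frac_mem_prime_iff[OF assms(1) a(2), of m] frac_mem_prime_iff[OF assms(2) a(2), of m]
    by (simp_all add: contract_def)
  then show ?thesis
    using assms(3) by (auto simp: contract_def)
qed

lemma frac_mem_expand_iff:
  assumes "prime_in V P" "f \<notin> P" "a \<in> polys_in V"
  shows "frac a m \<in> expand P \<longleftrightarrow> a \<in> P"
proof
  assume "frac a m \<in> expand P"
  then obtain b l where b: "frac a m = frac b l" "b \<in> P" by (auto simp: expand_def)
  have bin: "b \<in> polys_in V" using b(2) assms(1) by (auto dest: prime_inD ideal_inD)
  have "a * f ^ l = b * f ^ m"
    using b(1) assms(3) bin by (simp add: frac_eq_iff)
  also have "\<dots> \<in> P"
    using b(2) f_in by (intro ideal_inD(5)[OF prime_inD(1)[OF assms(1)]]) auto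
  finally show "a \<in> P"
    using prime_inD(3)[OF assms(1,3), of "f ^ l"] prime_in_power[OF assms(1) f_in] assms(2) f_in by auto
qed (auto simp: expand_def)

lemma expand_prime:
  assumes P: "prime_in V P" "f \<notin> P"
  shows "primeideal (expand P) L"
proof -
  interpret L: cring L by (rule cring_L)
  have Pi: "ideal_in V P" using P by (auto dest: prime_inD)
  have Pin: "a \<in> P \<Longrightarrow> a \<in> polys_in V" for a using Pi by (rule ideal_inD)
  note iff = frac_mem_expand_iff[OF P]
  have sub: "expand P \<subseteq> carrier L"
    using Pin by (auto simp: expand_def carrier_L)
  show ?thesis
  proof (intro primeidealI idealI L.add.subgroupI L.ring_axioms L.is_cring)
    show "expand P \<subseteq> carrier L" by (rule sub)
    show "expand P \<noteq> {}" using ideal_inD(2)[OF Pi] by (auto simp: expand_def)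
  next
    fix x y assume "x \<in> expand P" "y \<in> expand P"
    then obtain a m b l where ab: "x = frac a m" "y = frac b l" "a \<in> P" "b \<in> P" by (auto simp: expand_def)
    have "a * f ^ l + b * f ^ m \<in> P"
      by (intro ideal_inD(3)[OF Pi] ideal_inD(5)[OF Pi] polys_in_power f_in ab)
    then show "x \<oplus>\<^bsub>L\<^esub> y \<in> expand P"
      by (simp add: ab add_frac Pin[OF ab(3)] Pin[OF ab(4)]) (auto simp: expand_def)
  next
    fix x assume "x \<in> expand P"
    then obtain a m where x: "x = frac a m" "a \<in> P" by (auto simp: expand_def)
    have "frac (- a) m \<oplus>\<^bsub>L\<^esub> x = \<zero>\<^bsub>L\<^esub>"
      using x Pin f_in by (simp add: add_frac L_zero_one frac_eq_iff)
    then have "\<ominus>\<^bsub>L\<^esub> x = frac (- a) m"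
      using x Pin by (intro L.minus_equality) (auto simp: carrier_L)
    then show "\<ominus>\<^bsub>L\<^esub> x \<in> expand P"
      using x Pin ideal_in_uminus[OF Pi] by (simp add: iff)
  next
    fix x y assume "x \<in> expand P" "y \<in> carrier L"
    then obtain a m b l where ab: "x = frac a m" "y = frac b l" "a \<in> P" "b \<in> polys_in V"
      by (auto simp: expand_def carrier_L)
    have "b * a \<in> P" "a * b \<in> P"
      using ideal_inD(4,5)[OF Pi] ab(3,4) by blast+
    then show "y \<otimes>\<^bsub>L\<^esub> x \<in> expand P" "x \<otimes>\<^bsub>L\<^esub> y \<in> expand P"
      by (simp_all add: ab mult_frac Pin[OF ab(3)]) (auto simp: expand_def)
  next
    show "carrier L \<noteq> expand P"
    proof
      assume "carrier L = expand P"
      moreover have "frac 1 0 \<in> carrier L" by (auto simp: carrier_L)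
      ultimately have "frac 1 0 \<in> expand P" by (simp only:)
      then show False using iff[of 1 0] P by (auto dest: prime_inD)
    qed
  next
    fix x y assume "x \<in> carrier L" "y \<in> carrier L" "x \<otimes>\<^bsub>L\<^esub> y \<in> expand P"
    then obtain a m b l where "x = frac a m" "y = frac b l" "a \<in> polys_in V" "b \<in> polys_in V"
      "frac (a * b) (m + l) \<in> expand P"
      by (auto simp: carrier_L mult_frac)
    then show "x \<in> expand P \<or> y \<in> expand P"
      using prime_inD(3)[OF P(1)] by (auto simp: iff)
  qed
qed

lemma contract_expand: "prime_in V P \<Longrightarrow> f \<notin> P \<Longrightarrow> contract (expand P) = P"
  using frac_mem_expand_iff[of P] by (auto simp: contract_def dest: prime_inD ideal_inD)

lemma expand_contract:
  assumes "primeideal Q L"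
  shows "expand (contract Q) = Q"
proof -
  interpret primeideal Q L by fact
  show ?thesis
  proof
    show "expand (contract Q) \<subseteq> Q"
    proof
      fix x assume "x \<in> expand (contract Q)"
      then obtain a m where a: "x = frac a m" "a \<in> polys_in V" "frac a 0 \<in> Q"
        by (auto simp: expand_def contract_def)
      then show "x \<in> Q"
        using frac_mem_prime_iff[OF assms a(2), of m] by simp
    qed
    show "Q \<subseteq> expand (contract Q)"
    proof
      fix x assume x: "x \<in> Q"
      then have "x \<in> carrier L" using a_subset by blast
      then obtain a m where a: "x = frac a m" "a \<in> polys_in V" by (auto simp: carrier_L)
      then have "frac a 0 \<in> Q"
        using x frac_mem_prime_iff[OF assms a(2), of m] by simp
      then show "x \<in> expand (contract Q)"
        using a by (auto simp: expand_def contract_def)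
    qed
  qed
qed

lemma expand_strict:
  assumes "prime_in V P" "f \<notin> P" "prime_in V P'" "f \<notin> P'" "P \<subset> P'"
  shows "expand P \<subset> expand P'"
proof -
  have "expand P \<subseteq> expand P'"
    using assms(5) by (auto simp: expand_def)
  moreover have "expand P \<noteq> expand P'"
  proof
    assume "expand P = expand P'"
    then have "contract (expand P) = contract (expand P')" by simp
    then show False
      using assms(5) by (simp only: contract_expand[OF assms(1,2)] contract_expand[OF assms(3,4)])
  qed
  ultimately show ?thesis by blast
qed

lemma contract_chain:
  assumes "prime_chain L d C"
  shows "prime_chain R d (\<lambda>i. contract (C i))"
proof (rule prime_chain_map[OF assms])
  show "primeideal (contract (C i)) R" if "i \<le> d" for i
    using assms that by (intro contract_prime) (simp add: prime_chain_def)
  show "contract (C i) \<subset> contract (C (Suc i))" if "i < d" for i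
    using assms that by (intro contract_strict) (simp_all add: prime_chain_def)
qed

lemma expand_chain:
  assumes "prime_chain R d C" "f \<notin> C d"
  shows "prime_chain L d (\<lambda>i. expand (C i))"
proof -
  have "prime_in V (C i)" "f \<notin> C i" if "i \<le> d" for i
    using assms that prime_chain_mono[OF assms(1) that] by (auto simp: prime_chain_mpoly_ring)
  moreover have "C i \<subset> C (Suc i)" if "i < d" for i
    using assms(1) that by (auto simp: prime_chain_def)
  ultimately show ?thesis
    by (intro prime_chain_map[OF assms(1)] expand_prime expand_strict) auto
qed

end

lemma zero_Quot: "\<zero>\<^bsub>R Quot J\<^esub> = J"
  by (simp add: FactRing_def)

lemma carrier_QuotE:
  assumes "x \<in> carrier (R Quot J)"
  obtains a where "a \<in> carrier R" "x = J +>\<^bsub>R\<^esub> a"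
  using assms unfolding FactRing_def A_RCOSETS_def' by auto

lemma prime_chain_Quot_contract:
  assumes R: "cring R" and J: "ideal J R" and C: "prime_chain (R Quot J) d C"
  defines "D \<equiv> \<lambda>i. {a \<in> carrier R. J +>\<^bsub>R\<^esub> a \<in> C i}"
  shows "prime_chain R d D" and "J \<subseteq> D 0"
proof -
  interpret J: ideal J R by fact
  interpret h: ring_hom_ring R "R Quot J" "(+>\<^bsub>R\<^esub>) J" by (rule J.rcos_ring_hom_ring)
  have prime: "primeideal (D i) R" if "i \<le> d" for i
    unfolding D_def using C that by (intro h.primeideal_vimage[OF R]) (auto simp: prime_chain_def)
  have strict: "D i \<subset> D (Suc i)" if "i < d" for i
  proof -
    have C': "C i \<subset> C (Suc i)" "primeideal (C (Suc i)) (R Quot J)"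
      using C that by (auto simp: prime_chain_def)
    then obtain x where x: "x \<in> C (Suc i)" "x \<notin> C i" by blast
    interpret P: primeideal "C (Suc i)" "R Quot J" by (rule C')
    have "x \<in> carrier (R Quot J)" using x(1) P.a_subset by blast
    then obtain a where "a \<in> carrier R" "x = J +>\<^bsub>R\<^esub> a"
      by (rule carrier_QuotE)
    then have "a \<in> D (Suc i)" "a \<notin> D i" using x by (simp_all add: D_def)
    moreover have "D i \<subseteq> D (Suc i)" using C'(1) unfolding D_def by blast
    ultimately show ?thesis by blast
  qed
  show "prime_chain R d D"
    using prime strict by (simp add: prime_chain_def)
  show "J \<subseteq> D 0"
  proof
    fix a assume a: "a \<in> J"
    have "primeideal (C 0) (R Quot J)" using C by (auto simp: prime_chain_def)
    then interpret P: primeideal "C 0" "R Quot J" .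
    note zero_Quot[of R J]
    moreover have "\<zero>\<^bsub>R Quot J\<^esub> \<in> C 0"
      by (rule additive_subgroup.zero_closed[OF ideal.axioms(1)[OF P.is_ideal]])
    ultimately have "J \<in> C 0"
      by (simp only:)
    moreover have "J +>\<^bsub>R\<^esub> a = J"
      using a by (rule J.a_rcos_const)
    ultimately show "a \<in> D 0"
      using a J.a_subset by (auto simp: D_def)
  qed
qed

lemma prime_chain_Quot_image:
  assumes R: "cring R" and J: "ideal J R" and C: "prime_chain R d C" "J \<subseteq> C 0"
  shows "prime_chain (R Quot J) d (\<lambda>i. (+>\<^bsub>R\<^esub>) J ` C i)"
proof (rule prime_chain_map[OF C(1)])
  interpret R: cring R by fact
  interpret J: ideal J R by fact
  interpret h: ring_hom_ring R "R Quot J" "(+>\<^bsub>R\<^esub>) J" by (rule J.rcos_ring_hom_ring)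
  have CJ: "J \<subseteq> C i" "primeideal (C i) R" if "i \<le> d" for i
    using C prime_chain_mono[OF C(1), of 0 i] that by (auto simp: prime_chain_def)
  have img: "ideal ((+>\<^bsub>R\<^esub>) J ` C i) (R Quot J)" if "i \<le> d" for i
    using CJ[OF that] by (intro R.ring_ideal_imp_quot_ideal J) (auto simp: primeideal_def)
  have mem: "J +>\<^bsub>R\<^esub> a \<in> (+>\<^bsub>R\<^esub>) J ` C i \<longleftrightarrow> a \<in> C i" if "i \<le> d" "a \<in> carrier R" for i a
  proof -
    have "C i = \<Union> ((+>\<^bsub>R\<^esub>) J ` C i)"
      using R.ideal_incl_iff[OF J, of "C i"] CJ[OF that(1)] by (auto simp: primeideal_def)
    then show ?thesis
      using R.canonical_proj_vimage_mem_iff[OF J additive_subgroup.a_subset[OF ideal.axioms(1)[OF img[OF that(1)]]] that(2)]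
      by simp
  qed
  show "primeideal ((+>\<^bsub>R\<^esub>) J ` C i) (R Quot J)" if i: "i \<le> d" for i
  proof (rule primeidealI[OF img[OF i] J.quotient_is_cring[OF R]])
    interpret P: primeideal "C i" R by (rule CJ[OF i])
    show "carrier (R Quot J) \<noteq> (+>\<^bsub>R\<^esub>) J ` C i"
    proof
      assume eq: "carrier (R Quot J) = (+>\<^bsub>R\<^esub>) J ` C i"
      have "J +>\<^bsub>R\<^esub> \<one>\<^bsub>R\<^esub> \<in> (+>\<^bsub>R\<^esub>) J ` C i"
        unfolding eq[symmetric] by (rule h.hom_closed[OF R.one_closed])
      then have "\<one>\<^bsub>R\<^esub> \<in> C i"
        by (simp only: mem[OF i R.one_closed])
      then show False using P.one_imp_carrier P.I_notcarr by auto
    qed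
    fix x y assume "x \<in> carrier (R Quot J)" "y \<in> carrier (R Quot J)"
      and xy: "x \<otimes>\<^bsub>R Quot J\<^esub> y \<in> (+>\<^bsub>R\<^esub>) J ` C i"
    then obtain a b where ab: "a \<in> carrier R" "b \<in> carrier R" "x = J +>\<^bsub>R\<^esub> a" "y = J +>\<^bsub>R\<^esub> b"
      by (metis carrier_QuotE)
    have "J +>\<^bsub>R\<^esub> (a \<otimes>\<^bsub>R\<^esub> b) \<in> (+>\<^bsub>R\<^esub>) J ` C i"
      using xy by (simp only: ab(3,4) h.hom_mult[OF ab(1,2)])
    then have "a \<otimes>\<^bsub>R\<^esub> b \<in> C i"
      by (simp only: mem[OF i R.m_closed[OF ab(1,2)]])
    then have "a \<in> C i \<or> b \<in> C i"
      by (rule P.I_prime[OF ab(1,2)])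
    then show "x \<in> (+>\<^bsub>R\<^esub>) J ` C i \<or> y \<in> (+>\<^bsub>R\<^esub>) J ` C i"
      using ab by auto
  qed
  show "(+>\<^bsub>R\<^esub>) J ` C i \<subset> (+>\<^bsub>R\<^esub>) J ` C (Suc i)" if i: "i < d" for i
  proof -
    have sub: "C i \<subset> C (Suc i)" using C(1) i by (auto simp: prime_chain_def)
    then obtain a where a: "a \<in> C (Suc i)" "a \<notin> C i" by blast
    interpret P: primeideal "C (Suc i)" R using CJ[of "Suc i"] i by auto
    have "a \<in> carrier R" using a P.a_subset by blast
    then have "J +>\<^bsub>R\<^esub> a \<notin> (+>\<^bsub>R\<^esub>) J ` C i"
      using mem[of i a] a i by auto
    then show ?thesis using sub a(1) by blast
  qed
qed

section \<open>The scheme of bases\<close>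

theorem proposition3p8:
  fixes p n r :: nat
  assumes "Factorial_Ring.prime p"
    and "algebraic_closure (ring_of_type_algebra :: 'k::field ring) (range of_int)"
    and "CHAR('k) = p"
    and "n \<ge> 1" and "r \<ge> 1"
  shows "codim (bases_open TYPE('k) p n r) (bases_ideal TYPE('k) p n r) = enat (n * r) \<and>
         krull_dim (bases_ring TYPE('k) p n r) = enat (n\<^sup>2 * (n * r + 1) - n * r)"
proof -
  let ?S = "base_indets n r"
  let ?\<delta> = "disc_coeff p n r :: nat \<Rightarrow> (coord, 'k) mpoly"
  let ?f = "?\<delta> (n * r)"
  define N where "N = n\<^sup>2 * (n * r + 1)"
  define M where "M = N - n * r"
  note p = assms(1) and char = assms(3)
  have n: "n > 0" using assms(4) by simp
  interpret G: graded_system ?S "pwt p" "{..<n * r}" ?\<delta> "\<lambda>i. n * p ^ i"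
     "?S - param n ` {..<n * r}" "\<lambda>v. indet v - eisenstein p n r 0 v" "pwt p"
    by (rule disc_graded_system[OF p char n])
  have cards: "card ?S = N" "card (?S - param n ` {..<n * r}) = M"
    using card_free_params[OF n, of r] by (simp_all add: card_base_indets N_def M_def)
  have "n * r \<le> N"
  proof -
    have "n * r \<le> 1 * (n * r + 1)" by simp
    also have "\<dots> \<le> N" unfolding N_def using n by (intro mult_le_mono1) simp
    finally show ?thesis .
  qed
  then have NM: "N - M = n * r" "n * r + M = N" by (simp_all add: M_def)
  obtain C where C: "prime_chain (mpoly_ring ?S :: (coord, 'k) mpoly ring) M C"
    "\<And>i. i < n * r \<Longrightarrow> ?\<delta> i \<in> C 0" "?f \<notin> C M"
    using prime_chain_of_bases[OF p char n, of r] unfolding M_def N_def by blast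
  have C_prime: "prime_in ?S (C i)" if "i \<le> M" for i
    using C(1) that by (auto simp: prime_chain_mpoly_ring)
  interpret loc: mpoly_localization ?S ?f
  proof
    show "?f \<in> polys_in ?S" by (rule polys_in_disc_coeff[OF p])
    show "?f \<noteq> 0" using C(3) ideal_inD(2)[OF prime_inD(1)[OF C_prime[OF order_refl]]] by auto
  qed
  let ?R = "mpoly_ring ?S :: (coord, 'k) mpoly ring"
  let ?L = "bases_open TYPE('k) p n r" and ?J = "bases_ideal TYPE('k) p n r"
  have L: "?L = localization ?R ?f" by (simp add: bases_open_def)
  let ?gens = "(\<lambda>i. loc_frac ?R ?f (?\<delta> i) 0) ` {..<n * r}"
  have J: "?J = Idl\<^bsub>?L\<^esub> ?gens" by (simp add: bases_ideal_def)
  interpret L: cring ?L unfolding L by (rule loc.cring_L)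
  have gens: "?gens \<subseteq> carrier ?L"
    unfolding L loc.carrier_L using polys_in_disc_coeff[OF p] by auto
  have J_ideal: "ideal ?J ?L"
    unfolding J by (rule L.genideal_ideal[OF gens])
  have J_iff: "?J \<subseteq> Q \<longleftrightarrow> ?\<delta> ` {..<n * r} \<subseteq> loc.contract Q" if "ideal Q ?L" for Q
  proof
    assume "?J \<subseteq> Q"
    then show "?\<delta> ` {..<n * r} \<subseteq> loc.contract Q"
      using L.genideal_self[OF gens] polys_in_disc_coeff[OF p] unfolding J loc.contract_def by blast
  next
    assume "?\<delta> ` {..<n * r} \<subseteq> loc.contract Q"
    then show "?J \<subseteq> Q"
      unfolding J by (intro L.genideal_minimal[OF that]) (auto simp: loc.contract_def)
  qed
  have lower: "enat (n * r) \<le> height ?L Q" if Q: "primeideal Q ?L" "?J \<subseteq> Q" for Q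
  proof -
    have Q': "primeideal Q (localization ?R ?f)" using Q(1) by (simp add: L)
    have sub: "?\<delta> ` {..<n * r} \<subseteq> loc.contract Q"
      using J_iff Q by (auto simp: primeideal_def)
    have "prime_in ?S (loc.contract Q)"
      using loc.contract_prime(1)[OF Q'] by (simp add: primeideal_iff_prime_in)
    from G.prime_chain_ending_at[OF this sub]
    obtain c B where B: "card ?S - card (?S - param n ` {..<n * r}) \<le> c"
      "prime_chain ?R c B" "B c = loc.contract Q"
      by blast
    have "prime_chain ?L c (\<lambda>i. loc.expand (B i))"
      unfolding L using loc.contract_prime(2)[OF Q'] by (intro loc.expand_chain B) (simp add: B)
    moreover have "loc.expand (B c) = Q"
      using loc.expand_contract[OF Q'] by (simp add: B)
    ultimately have "enat c \<le> height ?L Q"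
      unfolding height_def by (intro Sup_upper) auto
    moreover have "n * r \<le> c"
      using B(1) NM by (simp add: cards)
    ultimately show ?thesis
      by (meson enat_ord_simps(1) order_trans)
  qed
  \<comment> \<open>A chain below \<open>C 0\<close> can be continued by \<open>C\<close>, of length \<open>M\<close>, and then has length at most \<open>N\<close>.\<close>
  define P0 where "P0 = loc.expand (C 0)"
  have f_notin: "?f \<notin> C i" if "i \<le> M" for i
    using prime_chain_mono[OF C(1) that] C(3) by blast
  have P0: "primeideal P0 ?L" "loc.contract P0 = C 0"
    unfolding P0_def L using loc.expand_prime loc.contract_expand C_prime[of 0] f_notin[of 0] by auto
  have JP0: "?J \<subseteq> P0"
    using J_iff P0 C(2) by (auto simp: primeideal_def)
  have upper: "height ?L P0 \<le> enat (n * r)"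
    unfolding height_def
  proof (rule Sup_least)
    fix x assume "x \<in> {enat d | d. \<exists>D. prime_chain ?L d D \<and> D d = P0}"
    then obtain d D where D: "x = enat d" "prime_chain ?L d D" "D d = P0" by blast
    have "prime_chain ?R d (\<lambda>i. loc.contract (D i))"
      using D(2) unfolding L by (rule loc.contract_chain)
    from prime_chain_append[OF this C(1)] have "d + M \<le> card ?S"
      using D(3) P0(2) by (intro prime_chain_mpoly_ring_length[OF finite_base_indets]) auto
    then show "x \<le> enat (n * r)"
      using NM by (simp add: D(1) cards)
  qed
  have "codim ?L ?J = enat (n * r)"
    unfolding codim_def
  proof (rule antisym)
    have "(INF P\<in>{P. primeideal P ?L \<and> ?J \<subseteq> P}. height ?L P) \<le> height ?L P0"
      using P0 JP0 by (intro INF_lower) auto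
    then show "(INF P\<in>{P. primeideal P ?L \<and> ?J \<subseteq> P}. height ?L P) \<le> enat (n * r)"
      using upper by (rule order_trans)
    show "enat (n * r) \<le> (INF P\<in>{P. primeideal P ?L \<and> ?J \<subseteq> P}. height ?L P)"
      using lower by (intro INF_greatest) auto
  qed
  moreover have "krull_dim (bases_ring TYPE('k) p n r) = enat M"
    unfolding krull_dim_def bases_ring_def
  proof (rule antisym)
    show "Sup {enat d | d. \<exists>D. prime_chain (?L Quot ?J) d D} \<le> enat M"
    proof (rule Sup_least)
      fix x assume "x \<in> {enat d | d. \<exists>D. prime_chain (?L Quot ?J) d D}"
      then obtain d D where D: "x = enat d" "prime_chain (?L Quot ?J) d D" by blast
      note E = prime_chain_Quot_contract[OF L.is_cring J_ideal D(2)]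
      have "primeideal {a \<in> carrier ?L. ?J +>\<^bsub>?L\<^esub> a \<in> D 0} ?L"
        using E(1) by (auto simp: prime_chain_def)
      then have "?\<delta> ` {..<n * r} \<subseteq> loc.contract {a \<in> carrier ?L. ?J +>\<^bsub>?L\<^esub> a \<in> D 0}"
        using J_iff E(2) by (auto simp: primeideal_def)
      moreover have "prime_chain ?R d (\<lambda>i. loc.contract {a \<in> carrier ?L. ?J +>\<^bsub>?L\<^esub> a \<in> D i})"
        using E(1) unfolding L by (rule loc.contract_chain)
      ultimately have "d \<le> card (?S - param n ` {..<n * r})"
        by (intro G.prime_chain_above)
      then have "d \<le> M" by (simp only: cards)
      then show "x \<le> enat M" by (simp add: D(1))
    qed
    have "prime_chain ?L M (\<lambda>i. loc.expand (C i))"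
      unfolding L by (rule loc.expand_chain[OF C(1,3)])
    then have "prime_chain (?L Quot ?J) M (\<lambda>i. (+>\<^bsub>?L\<^esub>) ?J ` loc.expand (C i))"
      using JP0 by (intro prime_chain_Quot_image[OF L.is_cring J_ideal]) (auto simp: P0_def)
    then show "enat M \<le> Sup {enat d | d. \<exists>D. prime_chain (?L Quot ?J) d D}"
      by (intro Sup_upper) auto
  qed
  ultimately show ?thesis
    by (simp add: M_def N_def)
qed

end
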